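(* Let $(g,\mathbf{v})$ be an admissible pair with $v_1=1$, with measure $\mu_{g;\mathbf{v}}$ and limit shape $\omega_{\Lambda_{g;\mathbf{v}}}$. The support of $\mu_{g;\mathbf{v}}$ is countably infinite. Moreover, if $g>0$ the unique accumulation point (in $[-\infty,+\infty]$) of the support of $\mu_{g;\mathbf{v}}$ is $+\infty$, and if $g<0$ it is $-\infty$. Consequently, the limit shape $\omega_{\Lambda_{g;\mathbf{v}}}$ is a semi-infinite staircase shape with only slopes $\pm1$ (a piecewise linear function with infinitely many local minima) that extends to $+\infty$ if $g>0$, and extends to $-\infty$ if $g<0$.
   Context: Admissible pairs. $\mathrm{Sym}=\mathbb{R}[p_1,p_2,\dots]$; $J^{(\alpha)}_\lambda$ is the integral form Jack symmetric function (Macdonald, Ch. VI.10; coefficient of $p_1^{|\lambda|}$ equal to $1$). A sequence $\mathbf{v}$ determines a totally Jack-positive specialization if the algebra homomorphism $p_k\mapsto v_k$ takes nonnegative values on $J^{(\alpha)}_\lambda$ for all partitions $\lambda$ and all $\alpha>0$. $(g,\mathbf{v})\in\mathbb{R}\times\mathbb{R}^\infty$ is admissible if either $g>0$ and $\mathbf{v}$ determines a totally Jack-positive specialization, or $g<0$ and $((-1)^{j-1}v_j)_{j\ge1}$ does. Łukasiewicz paths. $\mathbf{L}_0(\ell)$ is the set of sequences $\Gamma=(w_0,\dots,w_\ell)$, $w_j=(j,y_j)$, $y_j\in\mathbb{Z}_{\ge0}$, $y_0=y_\ell=0$, $y_j-y_{j-1}\ge-1$, with no $j\ge1$ such that $y_j=y_{j-1}=0$.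 $\mathbf{S}^i_\rightarrow(\Gamma)=\{w_j:j\ge1,y_j=y_{j-1}=i\}$, $\mathbf{S}_i(\Gamma)=\{w_j:j\ge1,y_j-y_{j-1}=i\}$ for $i\ge1$. Measure and limit shape. For an admissible pair with $v_1=1$, $\mu_{g;\mathbf{v}}$ is the (existing and unique) probability measure on $\mathbb{R}$ with moments $\int x^\ell\mu_{g;\mathbf{v}}(dx)=\sum_{\Gamma\in\mathbf{L}_0(\ell)}\prod_{i\ge1}(ig)^{|\mathbf{S}^i_\rightarrow(\Gamma)|}v_i^{|\mathbf{S}_i(\Gamma)|}$, $\ell\ge1$. The limit shape $\omega_{\Lambda_{g;\mathbf{v}}}$ is the $1$-Lipschitz function $\omega\colon\mathbb{R}\to\mathbb{R}_{\ge0}$ with $\omega(x)\ge|x|$, $\int\frac{\omega(x)-|x|}2dx=1$, associated with $\mu_{g;\mathbf{v}}$ by the Markov--Krein correspondence: $\int\frac{\mu_{g;\mathbf{v}}(dx)}{z-x}=\frac1z\exp\int\frac1{x-z}\big(\frac{\omega(x)-|x|}2\big)'dx$ for $\Im z>0$. It is the sup-norm limit in probability of profiles of rescaled random Young diagrams: of $T_{\sqrt{\alpha/d},1/\sqrt{\alpha d}}\lambda$ (each box of $\lambda$ rescaled to width $\sqrt{\alpha/d}$, height $1/\sqrt{\alpha d}$; profile = boundary in coordinates $(x-y,x+y)$), where $\alpha=g^2d$ if $g>0$, $\alpha=1/(g^2d)$ if $g<0$, and $\lambda\in\mathbb{Y}_d$ is distributed by the measure $\mathbb{P}$ with $\big(\tfrac{g^2d}{\lceil|g|d\rceil^2}\big)^{\|\mu\|/2}\prod_iv_{\mu_i}=\sum_{\lambda\in\mathbb{Y}_d}\mathbb{P}(\lambda)\chi^{(\alpha)}_\lambda(\mu)$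 for all $\mu\in\mathbb{Y}_d$; here $\|\mu\|=|\mu|-\ell(\mu)$, $\chi^{(\alpha)}_\lambda(\mu)=\alpha^{-\|\mu\|/2}\frac{z_\mu}{d!}[p_\mu]J^{(\alpha)}_\lambda$, $z_\mu=\prod_i i^{m_i(\mu)}m_i(\mu)!$. *)

theory Defs
  imports "HOL-Probability.Probability" "HOL-Library.Poly_Mapping"
begin

section \<open>Symmetric functions\<close>

text \<open>
  A partition is a finite multiset of positive integers. The ring \<open>Sym = \<real>[p\<^sub>1, p\<^sub>2, \<dots>]\<close> is
  encoded through its linear basis of the products \<open>p\<^sub>\<mu>\<close>, with \<open>\<mu>\<close> ranging over all partitions:
  \<open>lookup f \<mu>\<close> is the coefficient of \<open>p\<^sub>\<mu>\<close> in \<open>f\<close>. The multiplication of finitely supported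
  functions on multisets then satisfies \<open>p\<^sub>\<mu> p\<^sub>\<nu> = p\<^sub>\<mu>\<^sub>+\<^sub>\<nu>\<close>, as it should.
\<close>

type_synonym sym = "nat multiset \<Rightarrow>\<^sub>0 real"

definition is_partition :: "nat multiset \<Rightarrow> bool" where
  "is_partition \<mu> \<longleftrightarrow> 0 \<notin># \<mu>"

text \<open>The type \<^typ>\<open>sym\<close> also has keys containing the part \<open>0\<close>; these are not in \<open>Sym\<close>.\<close>

definition Sym :: "sym set" where
  "Sym = {f. \<forall>\<mu>\<in>Poly_Mapping.keys f. is_partition \<mu>}"

text \<open>Value at \<open>f\<close> of the algebra homomorphism with \<open>p\<^sub>k \<mapsto> v k\<close> for \<open>k \<ge> 1\<close>.\<close>

definition specialize :: "(nat \<Rightarrow> real) \<Rightarrow> sym \<Rightarrow> real" where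
  "specialize v f = (\<Sum>\<mu>\<in>Poly_Mapping.keys f. Poly_Mapping.lookup f \<mu> * (\<Prod>k\<in>#\<mu>. v k))"

text \<open>
  Polynomials in the variables \<open>x\<^sub>0, x\<^sub>1, \<dots>\<close>; a key \<open>e\<close> is the monomial with exponent
  \<open>lookup e i\<close> at \<open>x\<^sub>i\<close>.
\<close>

type_synonym xpoly = "(nat \<Rightarrow>\<^sub>0 nat) \<Rightarrow>\<^sub>0 real"

definition power_sum :: "nat \<Rightarrow> nat \<Rightarrow> xpoly" where
  "power_sum N k = (\<Sum>i<N. Poly_Mapping.single (Poly_Mapping.single i k) 1)"

text \<open>The symmetric polynomial \<open>f(x\<^sub>0, \<dots>, x\<^bsub>N-1\<^esub>)\<close>.\<close>

definition in_variables :: "nat \<Rightarrow> sym \<Rightarrow> xpoly" where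
  "in_variables N f =
     (\<Sum>\<mu>\<in>Poly_Mapping.keys f. Poly_Mapping.single 0 (Poly_Mapping.lookup f \<mu>) *
        (\<Prod>k\<in>#\<mu>. power_sum N k))"

definition exponents_of_shape :: "nat \<Rightarrow> nat multiset \<Rightarrow> (nat \<Rightarrow>\<^sub>0 nat) set" where
  "exponents_of_shape N \<mu> =
     {e. Poly_Mapping.keys e \<subseteq> {..<N} \<and>
        image_mset (Poly_Mapping.lookup e) (mset_set (Poly_Mapping.keys e)) = \<mu>}"

text \<open>The monomial symmetric polynomial \<open>m\<^sub>\<mu>(x\<^sub>0, \<dots>, x\<^bsub>N-1\<^esub>)\<close>.\<close>

definition monomial_sym :: "nat \<Rightarrow> nat multiset \<Rightarrow> xpoly" where
  "monomial_sym N \<mu> = (\<Sum>e\<in>exponents_of_shape N \<mu>. Poly_Mapping.single e 1)"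

definition parts :: "nat multiset \<Rightarrow> nat list" where
  "parts \<mu> = rev (sorted_list_of_multiset \<mu>)"

definition dominated_by :: "nat multiset \<Rightarrow> nat multiset \<Rightarrow> bool" where
  "dominated_by \<mu> \<kappa> \<longleftrightarrow> is_partition \<mu> \<and> is_partition \<kappa> \<and> sum_mset \<mu> = sum_mset \<kappa> \<and>
     (\<forall>k. sum_list (take k (parts \<mu>)) \<le> sum_list (take k (parts \<kappa>)))"

definition z_aut :: "nat multiset \<Rightarrow> real" where
  "z_aut \<mu> = (\<Prod>i\<in>set_mset \<mu>. real i ^ count \<mu> i * fact (count \<mu> i))"

text \<open>The scalar product with \<open>\<langle>p\<^sub>\<mu>, p\<^sub>\<nu>\<rangle> = \<delta>\<^sub>\<mu>\<^sub>\<nu> z\<^sub>\<mu> \<alpha>\<^bsup>l(\<mu>)\<^esup>\<close>.\<close>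

definition jack_inner :: "real \<Rightarrow> sym \<Rightarrow> sym \<Rightarrow> real" where
  "jack_inner \<alpha> f g =
     (\<Sum>\<mu>\<in>Poly_Mapping.keys f. Poly_Mapping.lookup f \<mu> * Poly_Mapping.lookup g \<mu> * z_aut \<mu> * \<alpha> ^ size \<mu>)"

text \<open>
  \<open>J\<close> is the family of integral form Jack symmetric functions with parameter \<open>\<alpha>\<close>: triangular in
  the monomial symmetric functions with respect to the dominance order, orthogonal, and with
  coefficient of \<open>p\<^sub>1\<^sup>n\<close> normalized to \<open>1\<close>. For \<open>\<alpha> > 0\<close> these conditions determine \<open>J \<kappa>\<close> for every
  partition \<open>\<kappa>\<close>, and such a family exists (Macdonald, Symmetric Functions and Hall Polynomials,
  Section VI.10); the values of \<open>J\<close> at multisets that are not partitions are immaterial.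
  An identity in \<open>Sym\<close> is an identity in every number \<open>N\<close> of variables, with the same coefficients.
\<close>

definition jack_functions :: "real \<Rightarrow> (nat multiset \<Rightarrow> sym) \<Rightarrow> bool" where
  "jack_functions \<alpha> J \<longleftrightarrow>
     (\<forall>\<kappa>. is_partition \<kappa> \<longrightarrow>
        J \<kappa> \<in> Sym \<and>
        (\<exists>u. \<forall>N. in_variables N (J \<kappa>) =
           (\<Sum>\<mu> | dominated_by \<mu> \<kappa>. Poly_Mapping.single 0 (u \<mu>) * monomial_sym N \<mu>)) \<and>
        Poly_Mapping.lookup (J \<kappa>) (replicate_mset (sum_mset \<kappa>) 1) = 1) \<and>
     (\<forall>\<kappa> \<mu>. is_partition \<kappa> \<and> is_partition \<mu> \<and> \<kappa> \<noteq> \<mu> \<longrightarrow> jack_inner \<alpha> (J \<kappa>) (J \<mu>) = 0)"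

text \<open>
  Sequences \<open>v\<^sub>1, v\<^sub>2, \<dots>\<close> are functions on \<^typ>\<open>nat\<close> whose value at \<open>0\<close> is never used.
  The bound family \<open>J\<close> below is the Jack family, being unique on partitions.
\<close>

definition totally_jack_positive :: "(nat \<Rightarrow> real) \<Rightarrow> bool" where
  "totally_jack_positive v \<longleftrightarrow>
     (\<forall>\<alpha>>0. \<exists>J. jack_functions \<alpha> J \<and> (\<forall>\<kappa>. is_partition \<kappa> \<longrightarrow> specialize v (J \<kappa>) \<ge> 0))"

definition admissible :: "real \<Rightarrow> (nat \<Rightarrow> real) \<Rightarrow> bool" where
  "admissible g v \<longleftrightarrow>
     g > 0 \<and> totally_jack_positive v \<or>
     g < 0 \<and> totally_jack_positive (\<lambda>j. (-1) ^ (j - 1) * v j)"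


section \<open>Lukasiewicz paths and the measure\<close>

text \<open>A path \<open>((0, y\<^sub>0), \<dots>, (l, y\<^sub>l))\<close> is encoded as the list of its heights \<open>y\<^sub>0, \<dots>, y\<^sub>l\<close>.\<close>

definition lukasiewicz_paths :: "nat \<Rightarrow> nat list set" where
  "lukasiewicz_paths l = {y. length y = Suc l \<and> y ! 0 = 0 \<and> y ! l = 0 \<and>
     (\<forall>j\<in>{1..l}. int (y ! j) - int (y ! (j - 1)) \<ge> -1) \<and>
     \<not> (\<exists>j\<in>{1..l}. y ! j = 0 \<and> y ! (j - 1) = 0)}"

definition horizontal_steps_at :: "nat list \<Rightarrow> nat \<Rightarrow> nat set" where
  "horizontal_steps_at y i = {j \<in> {1..<length y}. y ! j = i \<and> y ! (j - 1) = i}"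

definition up_steps :: "nat list \<Rightarrow> nat \<Rightarrow> nat set" where
  "up_steps y i = {j \<in> {1..<length y}. int (y ! j) - int (y ! (j - 1)) = int i}"

text \<open>
  The product over all \<open>i \<ge> 1\<close> is cut off at \<open>l\<close>: a path of length \<open>l\<close> from \<open>0\<close> to \<open>0\<close> has no
  vertex of height greater than \<open>l\<close>, hence all further factors are \<open>1\<close>.
\<close>

definition path_moment :: "real \<Rightarrow> (nat \<Rightarrow> real) \<Rightarrow> nat \<Rightarrow> real" where
  "path_moment g v l = (\<Sum>y\<in>lukasiewicz_paths l.
     \<Prod>i\<in>{1..l}. (real i * g) ^ card (horizontal_steps_at y i) * v i ^ card (up_steps y i))"

definition is_path_measure :: "real \<Rightarrow> (nat \<Rightarrow> real) \<Rightarrow> real measure \<Rightarrow> bool" where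
  "is_path_measure g v M \<longleftrightarrow> real_distribution M \<and>
     (\<forall>l\<ge>1. has_bochner_integral M (\<lambda>x. x ^ l) (path_moment g v l))"

definition measure_support :: "real measure \<Rightarrow> real set" where
  "measure_support M = {x. \<forall>U. open U \<and> x \<in> U \<longrightarrow> emeasure M U > 0}"


section \<open>Limit shapes\<close>

definition excess :: "(real \<Rightarrow> real) \<Rightarrow> real \<Rightarrow> real" where
  "excess \<omega> x = (\<omega> x - \<bar>x\<bar>) / 2"

text \<open>
  The derivative of \<open>excess \<omega>\<close> exists almost everywhere, since \<open>\<omega>\<close> is Lipschitz;
  the junk values of \<^const>\<open>deriv\<close> on the exceptional null set do not affect the integral.
\<close>

definition markov_krein :: "real measure \<Rightarrow> (real \<Rightarrow> real) \<Rightarrow> bool" where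
  "markov_krein M \<omega> \<longleftrightarrow> (\<forall>z::complex. Im z > 0 \<longrightarrow>
     (LINT x|M. 1 / (z - of_real x)) =
     1 / z * exp (LINT x|lebesgue. 1 / (of_real x - z) * of_real (deriv (excess \<omega>) x)))"

definition is_limit_shape :: "real measure \<Rightarrow> (real \<Rightarrow> real) \<Rightarrow> bool" where
  "is_limit_shape M \<omega> \<longleftrightarrow>
     1-lipschitz_on UNIV \<omega> \<and> (\<forall>x. \<omega> x \<ge> \<bar>x\<bar>) \<and>
     has_bochner_integral lebesgue (excess \<omega>) 1 \<and> markov_krein M \<omega>"

text \<open>
  The points \<open>a n\<close> are the local minima and the points \<open>b n\<close> the local maxima of \<open>\<omega>\<close>.
  On the left of the first minimum \<open>\<omega>\<close> agrees with the profile \<open>\<bar>x\<bar> = - x\<close> of the empty diagram.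
\<close>

definition staircase_to_pinfinity :: "(real \<Rightarrow> real) \<Rightarrow> bool" where
  "staircase_to_pinfinity \<omega> \<longleftrightarrow> (\<exists>a b :: nat \<Rightarrow> real.
     (\<forall>n. a n < b n \<and> b n < a (Suc n)) \<and>
     filterlim a at_top sequentially \<and>
     (\<forall>x \<le> a 0. \<omega> x = - x) \<and>
     (\<forall>n. \<forall>x\<in>{a n..b n}. \<omega> x = \<omega> (a n) + (x - a n)) \<and>
     (\<forall>n. \<forall>x\<in>{b n..a (Suc n)}. \<omega> x = \<omega> (b n) - (x - b n)))"

definition staircase_to_minfinity :: "(real \<Rightarrow> real) \<Rightarrow> bool" where
  "staircase_to_minfinity \<omega> \<longleftrightarrow> staircase_to_pinfinity (\<lambda>x. \<omega> (- x))"


section \<open>Finiteness of the index sets of the sums\<close>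

lemma finite_lukasiewicz_paths: "finite (lukasiewicz_paths l)"
proof -
  have "lukasiewicz_paths l \<subseteq> {y. set y \<subseteq> {..l} \<and> length y = Suc l}"
  proof
    fix y assume y: "y \<in> lukasiewicz_paths l"
    have len: "length y = Suc l" and last: "y ! l = 0"
      using y by (auto simp: lukasiewicz_paths_def)
    have step: "int (y ! j) - int (y ! (j - 1)) \<ge> -1" if "j \<in> {1..l}" for j
      using y that by (auto simp: lukasiewicz_paths_def)
    have height: "y ! (l - k) \<le> k" if "k \<le> l" for k
      using that
    proof (induction k)
      case 0
      then show ?case using last by simp
    next
      case (Suc k)
      have "int (y ! (l - k)) - int (y ! (l - k - 1)) \<ge> -1"
        using Suc.prems by (intro step) auto
      then show ?case using Suc by (simp add: Suc_diff_Suc)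
    qed
    have "y ! i \<le> l" if "i \<le> l" for i
      using height[of "l - i"] that by simp
    then show "y \<in> {y. set y \<subseteq> {..l} \<and> length y = Suc l}"
      using len by (force simp: in_set_conv_nth less_Suc_eq_le)
  qed
  then show ?thesis
    by (rule finite_subset) (simp add: finite_lists_length_eq)
qed

lemma finite_dominated_by: "finite {\<mu>. dominated_by \<mu> \<kappa>}"
proof -
  have size: "size \<mu> \<le> sum_mset \<mu>" if "is_partition \<mu>" for \<mu>
    using that unfolding is_partition_def by (induction \<mu>) (auto simp: Suc_le_eq)
  have set: "set_mset \<mu> \<subseteq> {..sum_mset \<mu>}" for \<mu> :: "nat multiset"
    by (auto dest: multi_member_split)
  have "\<mu> \<in> (\<Union>n\<in>{..sum_mset \<kappa>}. multisets_of_size {..sum_mset \<kappa>} n)"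
    if "dominated_by \<mu> \<kappa>" for \<mu>
  proof -
    have "is_partition \<mu>" and eq: "sum_mset \<mu> = sum_mset \<kappa>"
      using that by (simp_all add: dominated_by_def)
    then show ?thesis
      using size[of \<mu>] set[of \<mu>] unfolding eq multisets_of_size_def by blast
  qed
  then have "{\<mu>. dominated_by \<mu> \<kappa>} \<subseteq>
      (\<Union>n\<in>{..sum_mset \<kappa>}. multisets_of_size {..sum_mset \<kappa>} n)"
    by blast
  then show ?thesis
    by (rule finite_subset) auto
qed

lemma finite_exponents_of_shape: "finite (exponents_of_shape N \<mu>)"
proof -
  let ?F = "{f. \<forall>i. (i \<in> {..<N} \<longrightarrow> f i \<in> insert 0 (set_mset \<mu>)) \<and> (i \<notin> {..<N} \<longrightarrow> f i = 0)}"
  have "Poly_Mapping.lookup ` exponents_of_shape N \<mu> \<subseteq> ?F"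
  proof
    fix f assume "f \<in> Poly_Mapping.lookup ` exponents_of_shape N \<mu>"
    then obtain e where e: "f = Poly_Mapping.lookup e" "Poly_Mapping.keys e \<subseteq> {..<N}"
        "image_mset (Poly_Mapping.lookup e) (mset_set (Poly_Mapping.keys e)) = \<mu>"
      by (auto simp: exponents_of_shape_def)
    have "set_mset \<mu> = Poly_Mapping.lookup e ` Poly_Mapping.keys e"
      using e(3) by auto
    then show "f \<in> ?F"
      using e(1,2) by (auto simp: in_keys_iff)
  qed
  moreover have "finite ?F"
    by (rule finite_set_of_finite_funs) auto
  ultimately have "finite (Poly_Mapping.lookup ` exponents_of_shape N \<mu>)"
    by (rule finite_subset)
  then show ?thesis
    by (rule finite_imageD) (simp add: inj_on_def poly_mapping_eqI)
qed

end

theory Submission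
  imports Defs "HOL-Complex_Analysis.Complex_Analysis"
begin

text \<open>
  By reflection we may assume \<open>g > 0\<close>. Letting \<open>\<alpha> \<rightarrow> \<infinity>\<close> in the positivity at the Jack functions of the shapes
  \<open>(n)\<close> and \<open>(n-1, 1)\<close> gives \<open>0 \<le> v\<^sub>n \<le> v\<^bsub>n-1\<^esub>\<close>, hence \<open>0 \<le> v\<^sub>n \<le> 1\<close>.

  The moments are the matrix entries \<open>\<langle>e\<^sub>0, T\<^sup>l e\<^sub>0\<rangle>\<close> of an operator with the recursively defined polynomials
  \<open>p\<^bsub>n+1\<^esub> = (x - gn) p\<^sub>n - v\<^sub>1 p\<^bsub>n-1\<^esub> - \<dots> - v\<^sub>n p\<^sub>0\<close>, and \<open>\<integral>p\<^sub>n d\<mu> = \<delta>\<^bsub>n,0\<^esub>\<close>. Evaluating \<open>\<integral>x p\<^sub>a p\<^sub>b d\<mu>\<close> in two ways yields a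
  recursion for \<open>\<integral>p\<^sub>a p\<^sub>b d\<mu>\<close> and the bound \<open>\<integral>p\<^sub>n\<^sup>2 d\<mu> \<le> (g+1)\<^sup>n (2n)\<^sup>n\<close>. On the other hand \<open>p\<^sub>n(u)\<close>, divided by a
  factor of modulus about \<open>g\<^sup>n n!\<close>, converges locally uniformly to an entire function, which is nonzero at
  \<open>-4\<close>. Comparing the two growth rates, \<open>\<mu>\<close>-almost every \<open>x\<close> is a zero of this entire function, so the support
  is discrete; it is bounded below because \<open>|p\<^sub>n|\<close> grows too fast to the left of \<open>-4\<close>, and it is
  unbounded because the moments grow faster than exponentially.

  The Stieltjes transform of such a measure is real off the support, and between two atoms it decreases from
  \<open>\<infinity>\<close> to \<open>-\<infinity>\<close>. By the Markov--Krein correspondence its sign is the slope of \<open>\<omega>\<close>: the argument of the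
  exponential is a Poisson integral of the derivative of \<open>(\<omega>(x) - |x|)/2\<close>.
\<close>

section \<open>Totally Jack-positive specializations\<close>

text \<open>The Jack functions are reached through duality. The coefficient of a monomial of shape
  (n) or (n-1, 1) is a linear functional that vanishes on all Jack functions not high enough in the
  dominance order; orthogonality then makes the vector of this functional a multiple of the Jack
  function itself. As a polynomial in 1/\<alpha> this vector starts with the partitions of least
  length.

  The obstacle in the analytic half is that the path operator is not symmetric: the p_n are not
  orthogonal, and their second moments have to be estimated. The estimate is of order C^n n!, while
  squares of p_n have order (n!)^2 because of the diagonal entries g n. The bound v_n \<le> 1 makes
  the lower terms of the recursion a summable perturbation of the product of the x - g n. The point
  -4 lies so far to the left that each |p_n| exceeds twice its predecessor, which prevents the limit
  from vanishing there.

  In the geometric half, boundary values of the Poisson integral are compared only after integration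
  over an interval, where the kernel turns into arctangents.\<close>

abbreviation coeff_at :: "('a \<Rightarrow>\<^sub>0 'b::zero) \<Rightarrow> 'a \<Rightarrow> 'b" where
  "coeff_at \<equiv> Poly_Mapping.lookup"

section \<open>Coefficients of monomials in products of power sums\<close>

lemma lookup_single_times:
  fixes p :: xpoly
  shows "coeff_at (Poly_Mapping.single a c * p) e =
    (if \<exists>b. e = a + b then c * coeff_at p (THE b. e = a + b) else 0)"
proof -
  have "coeff_at (Poly_Mapping.single a c * p) e
      = (\<Sum>l. (c when a = l) * (\<Sum>q. coeff_at p q when e = l + q))"
    by (simp add: lookup_mult lookup_single)
  also have "\<dots> = (\<Sum>l. (c * (\<Sum>q. coeff_at p q when e = l + q)) when a = l)"
    by (simp add: when_mult)
  also have "\<dots> = c * (\<Sum>q. coeff_at p q when e = a + q)"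
    by simp
  also have "\<dots> = (if \<exists>b. e = a + b then c * coeff_at p (THE b. e = a + b) else 0)"
  proof (cases "\<exists>b. e = a + b")
    case True
    then obtain b where b: "e = a + b" by blast
    then have "(THE b. e = a + b) = b" by auto
    moreover have "(\<Sum>q. coeff_at p q when e = a + q) = coeff_at p b"
      using b by simp
    ultimately show ?thesis using b by auto
  next
    case False
    then show ?thesis by simp
  qed
  finally show ?thesis .
qed

lemma lookup_single_times_add [simp]:
  fixes p :: xpoly
  shows "coeff_at (Poly_Mapping.single a c * p) (a + b) = c * coeff_at p b"
  by (auto simp: lookup_single_times)

lemma lookup_const_times [simp]:
  fixes p :: xpoly
  shows "coeff_at (Poly_Mapping.single 0 c * p) b = c * coeff_at p b"
  using lookup_single_times_add[of 0 c p b] by simp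

definition power_sum_prod :: "nat \<Rightarrow> nat multiset \<Rightarrow> xpoly" where
  "power_sum_prod N \<mu> = (\<Prod>k\<in>#\<mu>. power_sum N k)"

lemma power_sum_prod_empty [simp]: "power_sum_prod N {#} = 1"
  by (simp add: power_sum_prod_def)

lemma power_sum_prod_add_mset:
  "power_sum_prod N (add_mset k \<mu>) =
     (\<Sum>i<N. Poly_Mapping.single (Poly_Mapping.single i k) 1 * power_sum_prod N \<mu>)"
  by (simp add: power_sum_prod_def power_sum_def sum_distrib_right)

lemma lookup_power_sum_prod_nonneg: "coeff_at (power_sum_prod N \<mu>) e \<ge> 0"
proof (induction \<mu> arbitrary: e)
  case empty
  then show ?case by (simp add: lookup_one when_def)
next
  case (add k \<mu>)
  then show ?case
    by (auto simp: power_sum_prod_add_mset lookup_sum lookup_single_times intro!: sum_nonneg)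
qed

definition exponent_shape :: "(nat \<Rightarrow>\<^sub>0 nat) \<Rightarrow> nat multiset" where
  "exponent_shape e = image_mset (coeff_at e) (mset_set (Poly_Mapping.keys e))"

lemma exponents_of_shape_iff:
  "e \<in> exponents_of_shape N \<mu> \<longleftrightarrow> Poly_Mapping.keys e \<subseteq> {..<N} \<and> exponent_shape e = \<mu>"
  by (simp add: exponents_of_shape_def exponent_shape_def)

lemma keys_single_add:
  fixes e :: "nat \<Rightarrow>\<^sub>0 nat"
  assumes "k > 0"
  shows "Poly_Mapping.keys (Poly_Mapping.single i k + e) = insert i (Poly_Mapping.keys e)"
  using assms by (auto simp: in_keys_iff lookup_add lookup_single when_def split: if_splits)

lemma exponent_shape_single_add:
  assumes "k > 0" "i \<notin> Poly_Mapping.keys e"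
  shows "exponent_shape (Poly_Mapping.single i k + e) = add_mset k (exponent_shape e)"
proof -
  have "coeff_at e i = 0" using assms(2) by (simp add: in_keys_iff)
  then show ?thesis
    unfolding exponent_shape_def using assms
    by (auto simp: keys_single_add lookup_add lookup_single when_def intro!: image_mset_cong)
qed

lemma exponent_shape_zero [simp]: "exponent_shape 0 = {#}"
  by (simp add: exponent_shape_def)

lemma size_exponent_shape: "size (exponent_shape e) = card (Poly_Mapping.keys e)"
  by (simp add: exponent_shape_def)

text \<open>A monomial of a product of power sums arises by assigning a variable to each part. At
  most \<open>size \<mu>\<close> variables can occur, and if that many occur then the parts sit at
  distinct variables, so the exponents are the parts. As parts are positive, every assigned variable
  stays visible in the monomial.\<close>

lemma lookup_power_sum_prod_nonzeroD:
  assumes "is_partition \<mu>" "coeff_at (power_sum_prod N \<mu>) e \<noteq> 0"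
  shows "(\<Sum>i<N. coeff_at e i) = sum_mset \<mu> \<and> Poly_Mapping.keys e \<subseteq> {..<N} \<and>
    card (Poly_Mapping.keys e) \<le> size \<mu> \<and>
    (card (Poly_Mapping.keys e) = size \<mu> \<longrightarrow> exponent_shape e = \<mu>)"
  using assms
proof (induction \<mu> arbitrary: e)
  case empty
  then show ?case by (auto simp: lookup_one when_def split: if_splits)
next
  case (add k \<mu>)
  have k: "k > 0" and \<mu>: "is_partition \<mu>"
    using add.prems(1) by (auto simp: is_partition_def)
  obtain i where i: "i < N"
    "coeff_at (Poly_Mapping.single (Poly_Mapping.single i k) 1 * power_sum_prod N \<mu>) e \<noteq> 0"
    using add.prems(2) unfolding power_sum_prod_add_mset lookup_sum
    by (meson lessThan_iff sum.not_neutral_contains_not_neutral)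
  then obtain b where b: "e = Poly_Mapping.single i k + b"
    by (auto simp: lookup_single_times split: if_splits)
  have "coeff_at (power_sum_prod N \<mu>) b \<noteq> 0"
    using i(2) unfolding b by simp
  note IH = add.IH[OF \<mu> this]
  have sum: "(\<Sum>j<N. coeff_at e j) = k + (\<Sum>j<N. coeff_at b j)"
    using i(1) by (simp add: b lookup_add sum.distrib lookup_single when_def)
  have keys: "Poly_Mapping.keys e = insert i (Poly_Mapping.keys b)"
    using k by (simp add: b keys_single_add)
  show ?case
  proof (cases "i \<in> Poly_Mapping.keys b")
    case True
    then show ?thesis using IH sum keys i(1) by (auto simp: insert_absorb)
  next
    case False
    then have "exponent_shape e = add_mset k (exponent_shape b)"
      using k by (simp add: b exponent_shape_single_add)
    then show ?thesis using IH sum keys i(1) False by (auto)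
  qed
qed

text \<open>All coefficients are nonnegative, so nothing can cancel the term that sends each part to
  a variable carrying it as exponent.\<close>

lemma lookup_power_sum_prod_pos:
  assumes "e \<in> exponents_of_shape N \<mu>"
  shows "coeff_at (power_sum_prod N \<mu>) e > 0"
  using assms
proof (induction \<mu> arbitrary: e)
  case empty
  then have "Poly_Mapping.keys e = {}"
    by (auto simp: exponents_of_shape_iff exponent_shape_def mset_set_empty_iff)
  then show ?case by simp
next
  case (add k \<mu>)
  have sh: "exponent_shape e = add_mset k \<mu>" and kN: "Poly_Mapping.keys e \<subseteq> {..<N}"
    using add.prems by (auto simp: exponents_of_shape_iff)
  have "k \<in># exponent_shape e" using sh by simp
  then obtain i where i: "i \<in> Poly_Mapping.keys e" "coeff_at e i = k"
    by (auto simp: exponent_shape_def)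
  define b where "b = Poly_Mapping.update i 0 e"
  have k: "k > 0" using i by (auto simp: in_keys_iff)
  have eb: "e = Poly_Mapping.single i k + b"
    using i by (intro poly_mapping_eqI) (auto simp: b_def lookup_add lookup_update lookup_single when_def)
  have ib: "i \<notin> Poly_Mapping.keys b"
    by (auto simp: b_def in_keys_iff lookup_update)
  have kb: "Poly_Mapping.keys b \<subseteq> {..<N}"
    using kN k unfolding eb by (auto simp: keys_single_add)
  have "exponent_shape b = \<mu>"
    using sh k ib unfolding eb by (simp add: exponent_shape_single_add)
  then have IH: "coeff_at (power_sum_prod N \<mu>) b > 0"
    using kb by (intro add.IH) (simp add: exponents_of_shape_iff)
  have "coeff_at (power_sum_prod N \<mu>) b
      = coeff_at (Poly_Mapping.single (Poly_Mapping.single i k) 1 * power_sum_prod N \<mu>) e"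
    unfolding eb by simp
  also have "\<dots> \<le> coeff_at (power_sum_prod N (add_mset k \<mu>)) e"
    unfolding power_sum_prod_add_mset lookup_sum
    using i(1) kN
    by (intro member_le_sum) (auto simp: lookup_single_times lookup_power_sum_prod_nonneg)
  finally show ?case using IH by simp
qed

lemma exponents_of_shape_nonempty:
  assumes "is_partition \<mu>"
  shows "exponents_of_shape (size \<mu>) \<mu> \<noteq> {}"
  using assms
proof (induction \<mu>)
  case empty
  have "0 \<in> exponents_of_shape (size {#}) {#}" by (simp add: exponents_of_shape_iff)
  then show ?case by blast
next
  case (add k \<mu>)
  then obtain e where e: "e \<in> exponents_of_shape (size \<mu>) \<mu>"
    by (auto simp: is_partition_def)
  have k: "k > 0" using add.prems by (auto simp: is_partition_def)
  have "size \<mu> \<notin> Poly_Mapping.keys e" using e by (auto simp: exponents_of_shape_iff)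
  then have "Poly_Mapping.single (size \<mu>) k + e \<in> exponents_of_shape (size (add_mset k \<mu>)) (add_mset k \<mu>)"
    using e k by (auto simp: exponents_of_shape_iff exponent_shape_single_add keys_single_add)
  then show ?case by blast
qed

lemma lookup_in_variables:
  "coeff_at (in_variables N f) e =
     (\<Sum>\<mu>\<in>Poly_Mapping.keys f. coeff_at f \<mu> * coeff_at (power_sum_prod N \<mu>) e)"
  by (simp add: in_variables_def power_sum_prod_def lookup_sum)

lemma lookup_monomial_sym:
  "coeff_at (monomial_sym N \<mu>) e = (if e \<in> exponents_of_shape N \<mu> then 1 else 0)"
  by (simp add: monomial_sym_def lookup_sum lookup_single when_def
      finite_exponents_of_shape flip: sum.inter_restrict)

lemma sum_lookup_of_shape:
  assumes "e \<in> exponents_of_shape N \<mu>"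
  shows "(\<Sum>i<N. coeff_at e i) = sum_mset \<mu>"
proof -
  have "sum_mset \<mu> = (\<Sum>i\<in>Poly_Mapping.keys e. coeff_at e i)"
    using assms by (auto simp: exponents_of_shape_iff exponent_shape_def sum_unfold_sum_mset)
  also have "\<dots> = (\<Sum>i<N. coeff_at e i)"
    using assms by (intro sum.mono_neutral_left) (auto simp: exponents_of_shape_iff in_keys_iff)
  finally show ?thesis by simp
qed

definition monomial_triangular :: "nat multiset \<Rightarrow> (nat multiset \<Rightarrow> real) \<Rightarrow> sym \<Rightarrow> bool" where
  "monomial_triangular \<kappa> u f \<longleftrightarrow> (\<forall>N. in_variables N f =
     (\<Sum>\<mu> | dominated_by \<mu> \<kappa>. Poly_Mapping.single 0 (u \<mu>) * monomial_sym N \<mu>))"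

lemma lookup_monomial_triangular:
  assumes "monomial_triangular \<kappa> u f"
  shows "coeff_at (in_variables N f) e =
    (\<Sum>\<mu> | dominated_by \<mu> \<kappa>. u \<mu> * (if e \<in> exponents_of_shape N \<mu> then 1 else 0))"
  using assms unfolding monomial_triangular_def by (simp add: lookup_sum lookup_monomial_sym)

text \<open>
  The power sums are algebraically independent: for a key of maximal length, no other key
  contributes to the coefficient of the monomial of that shape.
\<close>

lemma monomial_triangular_homogeneous:
  assumes "f \<in> Sym" "monomial_triangular \<kappa> u f" "\<mu> \<in> Poly_Mapping.keys f"
  shows "sum_mset \<mu> = sum_mset \<kappa>"
proof (rule ccontr)
  assume neq: "sum_mset \<mu> \<noteq> sum_mset \<kappa>"
  \<comment> \<open>A longest key of the wrong degree is tested against a monomial of its own shape.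
    Keys of the right degree are excluded by degree, the other keys of the wrong degree by
    length.\<close>
  define B where "B = {\<nu> \<in> Poly_Mapping.keys f. sum_mset \<nu> \<noteq> sum_mset \<kappa>}"
  have "finite B" "B \<noteq> {}" using assms(3) neq by (auto simp: B_def)
  then have "Max (size ` B) \<in> size ` B" by (intro Max_in) auto
  then obtain \<nu> where "\<nu> \<in> B" "size \<nu> = Max (size ` B)" by auto
  then have \<nu>: "\<nu> \<in> B" "\<And>\<rho>. \<rho> \<in> B \<Longrightarrow> size \<rho> \<le> size \<nu>"
    using \<open>finite B\<close> by auto
  have part: "is_partition \<rho>" if "\<rho> \<in> Poly_Mapping.keys f" for \<rho>
    using that assms(1) by (auto simp: Sym_def)
  define N where "N = size \<nu>"
  obtain e where e: "e \<in> exponents_of_shape N \<nu>"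
    using exponents_of_shape_nonempty[of \<nu>] part \<nu>(1) by (auto simp: B_def N_def)
  have sum_e: "(\<Sum>i<N. coeff_at e i) = sum_mset \<nu>" using sum_lookup_of_shape[OF e] .
  have card_e: "card (Poly_Mapping.keys e) = size \<nu>"
    using e by (simp add: exponents_of_shape_iff flip: size_exponent_shape)
  have "coeff_at f \<rho> * coeff_at (power_sum_prod N \<rho>) e = 0"
    if "\<rho> \<in> Poly_Mapping.keys f" "\<rho> \<noteq> \<nu>" for \<rho>
  proof (rule ccontr)
    assume "\<not> ?thesis"
    then have nz: "coeff_at (power_sum_prod N \<rho>) e \<noteq> 0" by auto
    note D = lookup_power_sum_prod_nonzeroD[OF part[OF that(1)] nz]
    have "\<rho> \<in> B" using D sum_e \<nu>(1) that(1) by (auto simp: B_def)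
    then have "size \<rho> = card (Poly_Mapping.keys e)"
      using D \<nu>(2)[of \<rho>] card_e by auto
    then show False using D e that(2) by (auto simp: exponents_of_shape_iff)
  qed
  then have "(\<Sum>\<rho>\<in>Poly_Mapping.keys f - {\<nu>}. coeff_at f \<rho> * coeff_at (power_sum_prod N \<rho>) e) = 0"
    by (intro sum.neutral) blast
  then have "coeff_at (in_variables N f) e = coeff_at f \<nu> * coeff_at (power_sum_prod N \<nu>) e"
    unfolding lookup_in_variables using \<nu>(1)
    by (subst sum.remove[of _ \<nu>]) (auto simp: B_def)
  also have "\<dots> \<noteq> 0"
    using lookup_power_sum_prod_pos[OF e] \<nu>(1) by (auto simp: B_def in_keys_iff)
  finally have "coeff_at (in_variables N f) e \<noteq> 0" .
  moreover have "coeff_at (in_variables N f) e = 0"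
    unfolding lookup_monomial_triangular[OF assms(2)]
  proof (rule sum.neutral, safe)
    fix \<rho> assume "dominated_by \<rho> \<kappa>"
    then have "sum_mset \<rho> = sum_mset \<kappa>" by (simp add: dominated_by_def)
    then have "e \<notin> exponents_of_shape N \<rho>"
      using sum_lookup_of_shape[of e N \<rho>] sum_e \<nu>(1) by (auto simp: B_def)
    then show "u \<rho> * (if e \<in> exponents_of_shape N \<rho> then 1 else 0) = 0" by simp
  qed
  ultimately show False by simp
qed

text \<open>In one variable a product of power sums only remembers its degree, so the coefficient of
  the n-th power in a homogeneous function is the sum of its power sum coefficients.\<close>

lemma power_sum_prod_one_variable:
  "power_sum_prod 1 \<mu> = Poly_Mapping.single (Poly_Mapping.single 0 (sum_mset \<mu>)) 1"
  by (induction \<mu>) (auto simp: power_sum_prod_add_mset mult_single single_add)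

lemma lookup_single_times_zero:
  fixes p :: xpoly
  assumes "\<And>b. e \<noteq> a + b"
  shows "coeff_at (Poly_Mapping.single a c * p) e = 0"
  using assms by (auto simp: lookup_single_times)

lemma lookup_single_times_eq:
  fixes p :: xpoly
  assumes "e = a + b"
  shows "coeff_at (Poly_Mapping.single a c * p) e = c * coeff_at p b"
  using assms by simp

text \<open>The monomial x_0^a x_1 arises exactly when one part equal to 1 goes to x_1 and all
  others go to x_0, which leaves \<open>count \<mu> 1\<close> choices. The first conjunct is the
  case without x_1, to which the induction falls back when the new part goes to x_1.\<close>

lemma lookup_power_sum_prod_two_variables:
  assumes "is_partition \<mu>"
  shows "coeff_at (power_sum_prod 2 \<mu>) (Poly_Mapping.single 0 a) =
      (if a = sum_mset \<mu> then 1 else 0) \<and>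
    coeff_at (power_sum_prod 2 \<mu>) (Poly_Mapping.single 0 a + Poly_Mapping.single 1 1) =
      (if a + 1 = sum_mset \<mu> then real (count \<mu> 1) else 0)"
  using assms
proof (induction \<mu> arbitrary: a)
  case empty
  have "Poly_Mapping.single 0 a + Poly_Mapping.single 1 1 \<noteq> (0 :: nat \<Rightarrow>\<^sub>0 nat)"
    by (metis add_eq_0_iff_both_eq_0 lookup_add lookup_single_eq lookup_zero one_neq_zero)
  moreover have "Poly_Mapping.single 0 a = (0 :: nat \<Rightarrow>\<^sub>0 nat) \<longleftrightarrow> a = 0"
    by (metis lookup_single_eq lookup_zero single_zero)
  ultimately show ?case by (simp add: lookup_one when_def)
next
  case (add k \<mu>)
  have k: "k > 0" and \<mu>: "is_partition \<mu>" using add.prems by (auto simp: is_partition_def)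
  let ?s = "\<lambda>i j. Poly_Mapping.single (i::nat) (j::nat)"
  let ?q = "power_sum_prod 2 \<mu>"
  have split: "coeff_at (power_sum_prod 2 (add_mset k \<mu>)) e =
      coeff_at (Poly_Mapping.single (?s 0 k) 1 * ?q) e +
      coeff_at (Poly_Mapping.single (?s 1 k) 1 * ?q) e" for e
    by (simp add: power_sum_prod_add_mset lookup_add eval_nat_numeral)
  have A: "coeff_at (Poly_Mapping.single (?s 0 k) 1 * ?q) (?s 0 a) =
      (if a \<ge> k then coeff_at ?q (?s 0 (a - k)) else 0)"
  proof (cases "a \<ge> k")
    case True
    then have "?s 0 a = ?s 0 k + ?s 0 (a - k)" by (simp flip: single_add)
    then show ?thesis using True by (simp add: lookup_single_times_eq)
  next
    case False
    have "?s 0 a \<noteq> ?s 0 k + b" for b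
      using False by (metis le_add1 lookup_add lookup_single_eq)
    then show ?thesis using False by (simp add: lookup_single_times_zero)
  qed
  have "?s 0 a \<noteq> ?s 1 k + b" for b
    using k by (metis add_eq_0_iff_both_eq_0 less_numeral_extra(3) lookup_add lookup_single_eq
        lookup_single_not_eq zero_neq_one)
  then have B: "coeff_at (Poly_Mapping.single (?s 1 k) 1 * ?q) (?s 0 a) = 0"
    by (simp add: lookup_single_times_zero)
  have C: "coeff_at (Poly_Mapping.single (?s 0 k) 1 * ?q) (?s 0 a + ?s 1 1) =
      (if a \<ge> k then coeff_at ?q (?s 0 (a - k) + ?s 1 1) else 0)"
  proof (cases "a \<ge> k")
    case True
    then have "?s 0 a + ?s 1 1 = ?s 0 k + (?s 0 (a - k) + ?s 1 1)"
      by (simp add: add.assoc[symmetric] flip: single_add)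
    then show ?thesis using True by (simp add: lookup_single_times_eq)
  next
    case False
    have "?s 0 a + ?s 1 1 \<noteq> ?s 0 k + b" for b
    proof
      assume "?s 0 a + ?s 1 1 = ?s 0 k + b"
      then have "coeff_at (?s 0 a + ?s 1 1) 0 = coeff_at (?s 0 k + b) 0" by simp
      then show False using False by (simp add: lookup_add lookup_single)
    qed
    then show ?thesis using False by (simp add: lookup_single_times_zero)
  qed
  have D: "coeff_at (Poly_Mapping.single (?s 1 k) 1 * ?q) (?s 0 a + ?s 1 1) =
      (if k = 1 then coeff_at ?q (?s 0 a) else 0)"
  proof (cases "k = 1")
    case True
    then have "?s 0 a + ?s 1 1 = ?s 1 k + ?s 0 a" by (simp add: add.commute)
    then show ?thesis using True by (simp add: lookup_single_times_eq)
  next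
    case False
    have "?s 0 a + ?s 1 1 \<noteq> ?s 1 k + b" for b
    proof
      assume "?s 0 a + ?s 1 1 = ?s 1 k + b"
      then have "coeff_at (?s 0 a + ?s 1 1) 1 = coeff_at (?s 1 k + b) 1" by simp
      then show False using False k by (simp add: lookup_add lookup_single)
    qed
    then show ?thesis using False by (simp add: lookup_single_times_zero)
  qed
  \<comment> \<open>Settles the borderline case \<open>a < k\<close>, where
    \<open>a + 1 = k + sum_mset \<mu>\<close> forces degree 0 for \<mu>.\<close>
  have cnt: "count \<mu> 1 \<le> sum_mset \<mu>"
  proof (cases "1 \<in># \<mu>")
    case True
    have "count \<mu> 1 \<le> size \<mu>" by (rule count_le_size)
    also have "\<dots> \<le> sum_mset \<mu>"
      using \<mu> unfolding is_partition_def by (induction \<mu>) (auto simp: Suc_le_eq)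
    finally show ?thesis .
  qed (simp add: not_in_iff)
  show ?case
    using add.IH[OF \<mu>] k cnt unfolding split A B C D by auto
qed

section \<open>The top of the dominance order\<close>

lemma sum_list_take_1_parts:
  assumes "\<mu> \<noteq> {#}"
  shows "sum_list (take 1 (parts \<mu>)) = last (sorted_list_of_multiset \<mu>)"
proof -
  have "sorted_list_of_multiset \<mu> \<noteq> []"
    using assms by (metis mset.simps(1) mset_sorted_list_of_multiset)
  then show ?thesis
    by (cases "sorted_list_of_multiset \<mu>" rule: rev_cases) (auto simp: parts_def)
qed

lemma parts_take_1_ge:
  assumes "m \<in># \<mu>"
  shows "m \<le> sum_list (take 1 (parts \<mu>))"
proof -
  define l where "l = sorted_list_of_multiset \<mu>"
  have "m \<in> set l" "sorted l" using assms by (auto simp: l_def)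
  then have "m \<le> last l"
    by (cases l rule: rev_cases) (auto simp: sorted_append)
  then show ?thesis using assms by (subst sum_list_take_1_parts) (auto simp: l_def)
qed

lemma parts_take_1_mem:
  assumes "\<mu> \<noteq> {#}"
  shows "sum_list (take 1 (parts \<mu>)) \<in># \<mu>"
proof -
  have "sorted_list_of_multiset \<mu> \<noteq> []"
    using assms by (metis mset.simps(1) mset_sorted_list_of_multiset)
  then have "last (sorted_list_of_multiset \<mu>) \<in> set (sorted_list_of_multiset \<mu>)"
    by (rule last_in_set)
  then show ?thesis unfolding sum_list_take_1_parts[OF assms] by simp
qed

definition partitions_of :: "nat \<Rightarrow> nat multiset set" where
  "partitions_of n = {\<mu>. is_partition \<mu> \<and> sum_mset \<mu> = n}"

lemma sum_list_parts: "sum_list (parts \<mu>) = sum_mset \<mu>"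
  by (metis mset_rev mset_sorted_list_of_multiset parts_def sum_mset_sum_list)

lemma dominated_by_row:
  assumes "n \<ge> 1" "\<mu> \<in> partitions_of n"
  shows "dominated_by \<mu> {#n#}"
proof -
  have "sum_list (take k (parts \<mu>)) \<le> sum_list (take k (parts {#n#}))" for k
  proof (cases k)
    case (Suc j)
    have "sum_list (take k (parts \<mu>)) \<le> sum_list (take k (parts \<mu>)) + sum_list (drop k (parts \<mu>))"
      by simp
    also have "\<dots> = sum_mset \<mu>"
      by (metis append_take_drop_id sum_list_append sum_list_parts)
    also have "\<dots> = sum_list (take k (parts {#n#}))"
      using assms Suc by (simp add: partitions_of_def parts_def)
    finally show ?thesis .
  qed simp
  then show ?thesis using assms by (auto simp: dominated_by_def partitions_of_def is_partition_def)
qed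

lemma finite_partitions_of:
  assumes "n \<ge> 1"
  shows "finite (partitions_of n)"
  using dominated_by_row[OF assms] by (intro finite_subset[OF _ finite_dominated_by[of "{#n#}"]]) auto

lemma dominates_row:
  assumes "n \<ge> 1" "dominated_by {#n#} \<kappa>"
  shows "\<kappa> = {#n#}"
proof -
  have \<kappa>: "is_partition \<kappa>" "sum_mset \<kappa> = n" using assms(2) by (auto simp: dominated_by_def)
  have ne: "\<kappa> \<noteq> {#}" using \<kappa> assms(1) by auto
  define k where "k = sum_list (take 1 (parts \<kappa>))"
  have "sum_list (take 1 (parts {#n#})) \<le> k"
    using assms(2) unfolding dominated_by_def k_def by blast
  then have "n \<le> k" using parts_take_1_ge[of n "{#n#}"] by simp
  moreover have "k \<in># \<kappa>" unfolding k_def by (rule parts_take_1_mem[OF ne])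
  then obtain \<nu> where \<nu>: "\<kappa> = add_mset k \<nu>" by (metis multi_member_split)
  ultimately have "k = n" "sum_mset \<nu> = 0" using \<kappa> by auto
  moreover have "\<nu> = {#}"
    using \<kappa>(1) \<open>sum_mset \<nu> = 0\<close> unfolding \<nu> is_partition_def by (cases \<nu>) auto
  ultimately show ?thesis using \<nu> by simp
qed

text \<open>Comparing first parts is enough: the largest part of \<kappa> is n or n - 1, and the
  remaining parts have total 0 or 1.\<close>

lemma dominates_hook:
  assumes "n \<ge> 2" "dominated_by {#n - 1, 1#} \<kappa>"
  shows "\<kappa> = {#n#} \<or> \<kappa> = {#n - 1, 1#}"
proof -
  have \<kappa>: "is_partition \<kappa>" "sum_mset \<kappa> = n" using assms by (auto simp: dominated_by_def)
  have ne: "\<kappa> \<noteq> {#}" using \<kappa> assms(1) by auto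
  define k where "k = sum_list (take 1 (parts \<kappa>))"
  have "sum_list (take 1 (parts {#n - 1, 1#})) \<le> k"
    using assms(2) unfolding dominated_by_def k_def by blast
  then have "n - 1 \<le> k" using parts_take_1_ge[of "n - 1" "{#n - 1, 1#}"] by simp
  moreover have "k \<in># \<kappa>" unfolding k_def by (rule parts_take_1_mem[OF ne])
  then obtain \<nu> where \<nu>: "\<kappa> = add_mset k \<nu>" by (metis multi_member_split)
  have p: "0 \<notin># \<nu>" using \<kappa>(1) by (auto simp: \<nu> is_partition_def)
  have s: "k + sum_mset \<nu> = n" using \<kappa> by (simp add: \<nu>)
  have "\<nu> = {#}" if "sum_mset \<nu> = 0" using that p by (cases \<nu>) auto
  moreover have "\<nu> = {#1#}" if "sum_mset \<nu> = 1"
  proof (cases \<nu>)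
    case (add j \<rho>)
    then have "j + sum_mset \<rho> = 1" "j > 0" using that p by auto
    then have "j = 1" "sum_mset \<rho> = 0" by linarith+
    moreover have "\<rho> = {#}" using \<open>sum_mset \<rho> = 0\<close> p add by (cases \<rho>) auto
    ultimately show ?thesis using add by simp
  qed (use that in simp)
  moreover have "sum_mset \<nu> = 0 \<and> k = n \<or> sum_mset \<nu> = 1 \<and> k = n - 1"
    using s \<open>n - 1 \<le> k\<close> by linarith
  ultimately show ?thesis using \<nu> by auto
qed

text \<open>
  Bessel's inequality holds at each coordinate vector, and the defects sum to zero because a square
  matrix has as many rows as columns.
\<close>

lemma orthonormal_square_complete:
  fixes a :: "'a \<Rightarrow> 'a \<Rightarrow> real"
  assumes P: "finite P"
    and orth: "\<And>k l. k \<in> P \<Longrightarrow> l \<in> P \<Longrightarrow> (\<Sum>i\<in>P. a k i * a l i) = (if k = l then 1 else 0)"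
    and ij: "i \<in> P" "j \<in> P"
  shows "(\<Sum>k\<in>P. a k i * a k j) = (if i = j then 1 else 0)"
proof -
  define d where "d i j = (if i = j then 1 else (0::real))" for i j :: 'a
  have defect: "(\<Sum>j\<in>P. (d i j - (\<Sum>k\<in>P. a k i * a k j))\<^sup>2) = 1 - (\<Sum>k\<in>P. (a k i)\<^sup>2)"
    if i: "i \<in> P" for i
  proof -
    have 1: "(\<Sum>j\<in>P. (d i j)\<^sup>2) = 1"
      using i P by (simp add: d_def if_distrib[of "\<lambda>x. x^2"] cong: if_cong)
    have 2: "(\<Sum>j\<in>P. d i j * (\<Sum>k\<in>P. a k i * a k j)) = (\<Sum>k\<in>P. (a k i)\<^sup>2)"
      using i P by (simp add: d_def if_distrib[of "\<lambda>x. x * _"] power2_eq_square cong: if_cong)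
    have "(\<Sum>j\<in>P. (\<Sum>k\<in>P. a k i * a k j)\<^sup>2)
        = (\<Sum>j\<in>P. \<Sum>k\<in>P. \<Sum>l\<in>P. a k i * a k j * (a l i * a l j))"
      by (simp add: power2_eq_square sum_product)
    also have "\<dots> = (\<Sum>k\<in>P. \<Sum>l\<in>P. a k i * a l i * (\<Sum>j\<in>P. a k j * a l j))"
      by (subst sum.swap, rule sum.cong[OF refl], subst sum.swap, rule sum.cong[OF refl])
        (simp add: sum_distrib_left mult_ac)
    also have "\<dots> = (\<Sum>k\<in>P. \<Sum>l\<in>P. a k i * a l i * (if k = l then 1 else 0))"
      by (intro sum.cong refl) (simp add: orth)
    also have "\<dots> = (\<Sum>k\<in>P. (a k i)\<^sup>2)"
      using P by (simp add: if_distrib[of "\<lambda>x. _ * x"] power2_eq_square cong: if_cong)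
    finally have 3: "(\<Sum>j\<in>P. (\<Sum>k\<in>P. a k i * a k j)\<^sup>2) = (\<Sum>k\<in>P. (a k i)\<^sup>2)" .
    have "(\<Sum>j\<in>P. (d i j - (\<Sum>k\<in>P. a k i * a k j))\<^sup>2)
       = (\<Sum>j\<in>P. (d i j)\<^sup>2) + (\<Sum>j\<in>P. (\<Sum>k\<in>P. a k i * a k j)\<^sup>2)
         - 2 * (\<Sum>j\<in>P. d i j * (\<Sum>k\<in>P. a k i * a k j))"
      by (simp add: power2_diff sum.distrib sum_subtractf sum_distrib_left mult.assoc)
    then show ?thesis using 1 2 3 by simp
  qed
  have "(\<Sum>i\<in>P. \<Sum>j\<in>P. (d i j - (\<Sum>k\<in>P. a k i * a k j))\<^sup>2) = (\<Sum>i\<in>P. 1 - (\<Sum>k\<in>P. (a k i)\<^sup>2))"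
    by (intro sum.cong refl) (simp add: defect)
  also have "\<dots> = real (card P) - (\<Sum>k\<in>P. \<Sum>i\<in>P. (a k i)\<^sup>2)"
    by (simp add: sum_subtractf) (rule sum.swap)
  also have "(\<Sum>k\<in>P. \<Sum>i\<in>P. (a k i)\<^sup>2) = (\<Sum>k\<in>P. 1)"
    by (intro sum.cong refl) (simp add: orth power2_eq_square)
  finally have "(\<Sum>i\<in>P. \<Sum>j\<in>P. (d i j - (\<Sum>k\<in>P. a k i * a k j))\<^sup>2) = 0" by simp
  then have "\<forall>i\<in>P. (\<Sum>j\<in>P. (d i j - (\<Sum>k\<in>P. a k i * a k j))\<^sup>2) = 0"
    using P by (subst (asm) sum_nonneg_eq_0_iff) (auto intro: sum_nonneg)
  then have "(d i j - (\<Sum>k\<in>P. a k i * a k j))\<^sup>2 = 0"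
    using ij P by (metis (no_types, lifting) sum_nonneg_eq_0_iff zero_le_power2)
  then show ?thesis by (simp add: d_def)
qed

text \<open>Scaling column i by \<open>sqrt (w i)\<close> and row k by \<open>1 / sqrt (N k)\<close>
  turns U into a square matrix with orthonormal rows, hence with orthonormal columns. In the
  application P is the set of partitions of n, which indexes both the Jack functions and the
  products of power sums.\<close>

lemma orthogonal_square_expansion:
  fixes U :: "'a \<Rightarrow> 'a \<Rightarrow> real" and w N :: "'a \<Rightarrow> real"
  assumes P: "finite P" and w: "\<And>i. i \<in> P \<Longrightarrow> w i > 0"
    and orth: "\<And>k l. k \<in> P \<Longrightarrow> l \<in> P \<Longrightarrow> k \<noteq> l \<Longrightarrow> (\<Sum>i\<in>P. U k i * U l i * w i) = 0"
    and N: "\<And>k. k \<in> P \<Longrightarrow> N k = (\<Sum>i\<in>P. U k i * U k i * w i)" "\<And>k. k \<in> P \<Longrightarrow> N k > 0"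
    and i: "i \<in> P"
  shows "f i = (\<Sum>k\<in>P. (\<Sum>j\<in>P. f j * U k j * w j) * U k i / N k)"
proof -
  define a where "a k i = U k i * sqrt (w i) / sqrt (N k)" for k i
  have "(\<Sum>i\<in>P. a k i * a l i) = (if k = l then 1 else 0)" if "k \<in> P" "l \<in> P" for k l
  proof -
    have "(\<Sum>i\<in>P. a k i * a l i) = (\<Sum>i\<in>P. U k i * U l i * w i / (sqrt (N k) * sqrt (N l)))"
    proof (intro sum.cong refl)
      fix i assume "i \<in> P"
      have "a k i * a l i = U k i * U l i * (sqrt (w i) * sqrt (w i)) / (sqrt (N k) * sqrt (N l))"
        by (simp add: a_def)
      also have "sqrt (w i) * sqrt (w i) = w i" using w[OF \<open>i \<in> P\<close>] by simp
      finally show "a k i * a l i = U k i * U l i * w i / (sqrt (N k) * sqrt (N l))" .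
    qed
    also have "\<dots> = (\<Sum>i\<in>P. U k i * U l i * w i) / (sqrt (N k) * sqrt (N l))"
      by (simp add: sum_divide_distrib)
    also have "\<dots> = (if k = l then 1 else 0)"
      using orth[OF that] N(1)[of k] N(2)[of k] that by auto
    finally show ?thesis .
  qed
  note comp = orthonormal_square_complete[OF P this]
  have "(\<Sum>k\<in>P. (\<Sum>j\<in>P. f j * U k j * w j) * U k i / N k)
      = (\<Sum>k\<in>P. \<Sum>j\<in>P. f j * sqrt (w j) / sqrt (w i) * (a k i * a k j))"
  proof (intro sum.cong refl)
    fix k assume k: "k \<in> P"
    have "f j * U k j * w j * U k i / N k = f j * sqrt (w j) / sqrt (w i) * (a k i * a k j)"
      if j: "j \<in> P" for j
    proof -
      have "sqrt (w i) \<noteq> 0" "sqrt (w j) * sqrt (w j) = w j" "sqrt (N k) * sqrt (N k) = N k"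
        using w[OF i] w[OF j] N(2)[OF k] by simp_all
      then have "f j * sqrt (w j) / sqrt (w i) * (a k i * a k j)
        = f j * (sqrt (w j) * sqrt (w j)) * U k i * U k j / (sqrt (N k) * sqrt (N k))"
        unfolding a_def by (simp add: field_simps)
      then show ?thesis
        unfolding \<open>sqrt (w j) * sqrt (w j) = w j\<close> \<open>sqrt (N k) * sqrt (N k) = N k\<close> by (simp add: mult_ac)
    qed
    then show "(\<Sum>j\<in>P. f j * U k j * w j) * U k i / N k
      = (\<Sum>j\<in>P. f j * sqrt (w j) / sqrt (w i) * (a k i * a k j))"
      by (simp add: sum_distrib_right sum_divide_distrib)
  qed
  also have "\<dots> = (\<Sum>j\<in>P. f j * sqrt (w j) / sqrt (w i) * (\<Sum>k\<in>P. a k i * a k j))"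
    by (subst sum.swap) (simp add: sum_distrib_left)
  also have "\<dots> = (\<Sum>j\<in>P. f j * sqrt (w j) / sqrt (w i) * (if i = j then 1 else 0))"
    using i by (intro sum.cong refl) (simp add: comp)
  also have "\<dots> = f i"
    using i P w[OF i] by (simp add: if_distrib[of "\<lambda>x. _ * x"] cong: if_cong)
  finally show ?thesis by simp
qed


section \<open>Jack functions as an orthogonal basis in each degree\<close>

definition jack_weight :: "real \<Rightarrow> nat multiset \<Rightarrow> real" where
  "jack_weight \<alpha> \<mu> = z_aut \<mu> * \<alpha> ^ size \<mu>"

lemma z_aut_pos: "is_partition \<mu> \<Longrightarrow> z_aut \<mu> > 0"
  unfolding z_aut_def is_partition_def by (intro prod_pos ballI mult_pos_pos zero_less_power) (auto intro: gr0I)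

lemma jack_weight_pos: "is_partition \<mu> \<Longrightarrow> \<alpha> > 0 \<Longrightarrow> jack_weight \<alpha> \<mu> > 0"
  by (simp add: jack_weight_def z_aut_pos)

lemma jack_inner_eq:
  assumes "finite P" "Poly_Mapping.keys f \<subseteq> P"
  shows "jack_inner \<alpha> f h = (\<Sum>\<mu>\<in>P. coeff_at f \<mu> * coeff_at h \<mu> * jack_weight \<alpha> \<mu>)"
  unfolding jack_inner_def jack_weight_def using assms
  by (intro sum.mono_neutral_cong_left) (auto simp: in_keys_iff)

lemma specialize_eq:
  assumes "finite P" "Poly_Mapping.keys f \<subseteq> P"
  shows "specialize v f = (\<Sum>\<mu>\<in>P. coeff_at f \<mu> * (\<Prod>k\<in>#\<mu>. v k))"
  unfolding specialize_def using assms
  by (intro sum.mono_neutral_cong_left) (auto simp: in_keys_iff)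

text \<open>Homogeneity is not part of the definition of \<open>jack_functions\<close>; it follows
  from triangularity and the algebraic independence of the power sums. It confines all coefficients
  to a finite index set.\<close>

lemma jack_functionsD:
  assumes "jack_functions \<alpha> J" "\<kappa> \<in> partitions_of n"
  shows "Poly_Mapping.keys (J \<kappa>) \<subseteq> partitions_of n" "\<exists>u. monomial_triangular \<kappa> u (J \<kappa>)"
    "coeff_at (J \<kappa>) (replicate_mset n 1) = 1"
proof -
  have \<kappa>: "is_partition \<kappa>" "sum_mset \<kappa> = n" using assms(2) by (auto simp: partitions_of_def)
  show u: "\<exists>u. monomial_triangular \<kappa> u (J \<kappa>)"
    using assms(1) \<kappa>(1) unfolding jack_functions_def monomial_triangular_def by blast
  have S: "J \<kappa> \<in> Sym" using assms(1) \<kappa>(1) unfolding jack_functions_def by blast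
  then show "Poly_Mapping.keys (J \<kappa>) \<subseteq> partitions_of n"
    using u monomial_triangular_homogeneous[OF S] \<kappa>(2)
    by (auto simp: partitions_of_def Sym_def)
  show "coeff_at (J \<kappa>) (replicate_mset n 1) = 1"
    using assms(1) \<kappa> unfolding jack_functions_def by blast
qed

lemma ones_mem_partitions_of: "replicate_mset n 1 \<in> partitions_of n"
  by (simp add: partitions_of_def is_partition_def)

text \<open>The sum of the coefficients is the coefficient of the n-th power in one variable, that
  is, of the monomial symmetric function of shape (n). By triangularity it can only be nonzero if
  \<kappa> dominates (n).\<close>

lemma jack_row_functional:
  assumes "jack_functions \<alpha> J" "n \<ge> 1" "\<kappa> \<in> partitions_of n" "\<kappa> \<noteq> {#n#}"
  shows "(\<Sum>\<mu>\<in>partitions_of n. coeff_at (J \<kappa>) \<mu>) = 0"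
proof -
  note D = jack_functionsD[OF assms(1,3)]
  obtain u where u: "monomial_triangular \<kappa> u (J \<kappa>)" using D(2) by blast
  let ?e = "Poly_Mapping.single (0::nat) n"
  have "exponent_shape ?e = {#n#}"
    using exponent_shape_single_add[of n 0 0] assms(2) by simp
  then have "coeff_at (in_variables 1 (J \<kappa>)) ?e = 0"
    unfolding lookup_monomial_triangular[OF u]
    using dominates_row[OF assms(2)] assms(4)
    by (intro sum.neutral) (auto simp: exponents_of_shape_iff)
  moreover have "coeff_at (in_variables 1 (J \<kappa>)) ?e = (\<Sum>\<mu>\<in>Poly_Mapping.keys (J \<kappa>). coeff_at (J \<kappa>) \<mu>)"
    unfolding lookup_in_variables power_sum_prod_one_variable using D(1)
    by (intro sum.cong refl) (auto simp: partitions_of_def)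
  moreover have "\<dots> = (\<Sum>\<mu>\<in>partitions_of n. coeff_at (J \<kappa>) \<mu>)"
    using D(1) finite_partitions_of[OF assms(2)]
    by (intro sum.mono_neutral_left) (auto simp: in_keys_iff)
  ultimately show ?thesis by simp
qed

text \<open>The weights \<open>count \<mu> 1\<close> compute the coefficient of x_0^(n-1) x_1, a
  monomial of shape (n-1, 1). Both partitions that dominate this shape are excluded.\<close>

lemma jack_hook_functional:
  assumes "jack_functions \<alpha> J" "n \<ge> 2" "\<kappa> \<in> partitions_of n" "\<kappa> \<noteq> {#n#}" "\<kappa> \<noteq> {#n - 1, 1#}"
  shows "(\<Sum>\<mu>\<in>partitions_of n. real (count \<mu> 1) * coeff_at (J \<kappa>) \<mu>) = 0"
proof -
  note D = jack_functionsD[OF assms(1,3)]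
  obtain u where u: "monomial_triangular \<kappa> u (J \<kappa>)" using D(2) by blast
  let ?e = "Poly_Mapping.single (0::nat) (n - 1) + Poly_Mapping.single 1 (1::nat)"
  have "exponent_shape (Poly_Mapping.single 1 (1::nat)) = {#1#}"
    using exponent_shape_single_add[of 1 1 0] by simp
  then have "exponent_shape ?e = {#n - 1, 1#}"
    using exponent_shape_single_add[of "n - 1" 0 "Poly_Mapping.single 1 (1::nat)"] assms(2)
    by (auto simp: in_keys_iff lookup_single)
  then have "coeff_at (in_variables 2 (J \<kappa>)) ?e = 0"
    unfolding lookup_monomial_triangular[OF u]
    using dominates_hook[OF assms(2)] assms(4,5)
    by (intro sum.neutral) (auto simp: exponents_of_shape_iff)
  moreover have "coeff_at (in_variables 2 (J \<kappa>)) ?e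
      = (\<Sum>\<mu>\<in>Poly_Mapping.keys (J \<kappa>). real (count \<mu> 1) * coeff_at (J \<kappa>) \<mu>)"
    unfolding lookup_in_variables
  proof (intro sum.cong refl)
    fix \<mu> assume "\<mu> \<in> Poly_Mapping.keys (J \<kappa>)"
    then have "is_partition \<mu>" "n - 1 + 1 = sum_mset \<mu>"
      using D(1) assms(2) by (auto simp: partitions_of_def)
    then show "coeff_at (J \<kappa>) \<mu> * coeff_at (power_sum_prod 2 \<mu>) ?e
        = real (count \<mu> 1) * coeff_at (J \<kappa>) \<mu>"
      using lookup_power_sum_prod_two_variables[of \<mu> "n - 1"] by simp
  qed
  moreover have "\<dots> = (\<Sum>\<mu>\<in>partitions_of n. real (count \<mu> 1) * coeff_at (J \<kappa>) \<mu>)"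
    using D(1) assms(2) finite_partitions_of[of n]
    by (intro sum.mono_neutral_left) (auto simp: in_keys_iff)
  ultimately show ?thesis by simp
qed

text \<open>
  The vector \<open>L \<mu> / jack_weight \<alpha> \<mu>\<close> represents the functional \<open>L\<close> for the scalar product that makes
  the Jack functions orthogonal.
\<close>

lemma jack_dual_vector:
  assumes J: "jack_functions \<alpha> J" and \<alpha>: "\<alpha> > 0" and n: "n \<ge> 1" and \<kappa>: "\<kappa> \<in> partitions_of n"
    and L: "\<And>\<rho>. \<rho> \<in> partitions_of n \<Longrightarrow> \<rho> \<noteq> \<kappa> \<Longrightarrow> (\<Sum>\<mu>\<in>partitions_of n. L \<mu> * coeff_at (J \<rho>) \<mu>) = 0"
    and \<mu>: "\<mu> \<in> partitions_of n"
  shows "L \<mu> / jack_weight \<alpha> \<mu> =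
    L (replicate_mset n 1) / jack_weight \<alpha> (replicate_mset n 1) * coeff_at (J \<kappa>) \<mu>"
proof -
  let ?P = "partitions_of n" and ?w = "jack_weight \<alpha>" and ?U = "\<lambda>\<rho>. coeff_at (J \<rho>)"
  define N where "N \<rho> = (\<Sum>\<mu>\<in>?P. ?U \<rho> \<mu> * ?U \<rho> \<mu> * ?w \<mu>)" for \<rho>
  have fin: "finite ?P" using finite_partitions_of[OF n] .
  have w: "?w \<mu> > 0" if "\<mu> \<in> ?P" for \<mu>
    using that jack_weight_pos[OF _ \<alpha>] by (simp add: partitions_of_def)
  have Npos: "N \<rho> > 0" if \<rho>: "\<rho> \<in> ?P" for \<rho>
    unfolding N_def
  proof (rule sum_pos2[OF fin ones_mem_partitions_of])
    show "0 < ?U \<rho> (replicate_mset n 1) * ?U \<rho> (replicate_mset n 1) * ?w (replicate_mset n 1)"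
      using jack_functionsD(3)[OF J \<rho>] w[OF ones_mem_partitions_of] by simp
    show "0 \<le> ?U \<rho> \<mu> * ?U \<rho> \<mu> * ?w \<mu>" if "\<mu> \<in> ?P" for \<mu>
      using w[OF that] by simp
  qed
  have orth: "(\<Sum>\<mu>\<in>?P. ?U \<rho> \<mu> * ?U \<sigma> \<mu> * ?w \<mu>) = 0" if "\<rho> \<in> ?P" "\<sigma> \<in> ?P" "\<rho> \<noteq> \<sigma>" for \<rho> \<sigma>
    using J that jack_inner_eq[OF fin jack_functionsD(1)[OF J that(1)], of \<alpha> "J \<sigma>"]
    unfolding jack_functions_def partitions_of_def by auto
  define B where "B = (\<Sum>\<mu>\<in>?P. L \<mu> * ?U \<kappa> \<mu>) / N \<kappa>"
  have *: "L \<mu> / ?w \<mu> = B * ?U \<kappa> \<mu>" if \<mu>: "\<mu> \<in> ?P" for \<mu>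
  proof -
    have 1: "(\<Sum>\<nu>\<in>?P. L \<nu> / ?w \<nu> * ?U \<rho> \<nu> * ?w \<nu>) = (\<Sum>\<nu>\<in>?P. L \<nu> * ?U \<rho> \<nu>)" for \<rho>
    proof (rule sum.cong[OF refl])
      fix \<nu> assume "\<nu> \<in> ?P"
      then show "L \<nu> / ?w \<nu> * ?U \<rho> \<nu> * ?w \<nu> = L \<nu> * ?U \<rho> \<nu>" using w[of \<nu>] by simp
    qed
    have "L \<mu> / ?w \<mu> = (\<Sum>\<rho>\<in>?P. (\<Sum>\<nu>\<in>?P. L \<nu> / ?w \<nu> * ?U \<rho> \<nu> * ?w \<nu>) * ?U \<rho> \<mu> / N \<rho>)"
      by (rule orthogonal_square_expansion[OF fin w orth N_def Npos \<mu>])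
    also have "\<dots> = (\<Sum>\<rho>\<in>?P. if \<rho> = \<kappa> then B * ?U \<kappa> \<mu> else 0)"
      unfolding 1 by (intro sum.cong refl) (auto simp: L B_def)
    also have "\<dots> = B * ?U \<kappa> \<mu>" using fin \<kappa> by simp
    finally show ?thesis .
  qed
  have "L (replicate_mset n 1) / ?w (replicate_mset n 1) = B"
    using *[OF ones_mem_partitions_of] jack_functionsD(3)[OF J \<kappa>] by simp
  then show ?thesis using *[OF \<mu>] by simp
qed

text \<open>The vector of L is a multiple of \<open>J \<kappa>\<close>. Since the coefficient of
  p_1^n in \<open>J \<kappa>\<close> is 1, the factor is read off at
  \<open>replicate_mset n 1\<close>, where L is nonnegative.\<close>

lemma jack_dual_specialization_nonneg:
  assumes J: "jack_functions \<alpha> J" and \<alpha>: "\<alpha> > 0" and n: "n \<ge> 1" and \<kappa>: "\<kappa> \<in> partitions_of n"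
    and L: "\<And>\<rho>. \<rho> \<in> partitions_of n \<Longrightarrow> \<rho> \<noteq> \<kappa> \<Longrightarrow> (\<Sum>\<mu>\<in>partitions_of n. L \<mu> * coeff_at (J \<rho>) \<mu>) = 0"
    and L1: "L (replicate_mset n 1) \<ge> 0" and v: "specialize v (J \<kappa>) \<ge> 0"
  shows "(\<Sum>\<mu>\<in>partitions_of n. L \<mu> / jack_weight \<alpha> \<mu> * (\<Prod>k\<in>#\<mu>. v k)) \<ge> 0"
proof -
  define c where "c = L (replicate_mset n 1) / jack_weight \<alpha> (replicate_mset n 1)"
  have "c \<ge> 0"
    using L1 jack_weight_pos[OF _ \<alpha>, of "replicate_mset n 1"] ones_mem_partitions_of[of n]
    by (simp add: c_def partitions_of_def)
  have "(\<Sum>\<mu>\<in>partitions_of n. L \<mu> / jack_weight \<alpha> \<mu> * (\<Prod>k\<in>#\<mu>. v k))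
      = (\<Sum>\<mu>\<in>partitions_of n. c * coeff_at (J \<kappa>) \<mu> * (\<Prod>k\<in>#\<mu>. v k))"
    using jack_dual_vector[OF J \<alpha> n \<kappa> L] by (intro sum.cong refl) (simp add: c_def)
  also have "\<dots> = c * specialize v (J \<kappa>)"
    unfolding specialize_eq[OF finite_partitions_of[OF n] jack_functionsD(1)[OF J \<kappa>]]
    by (simp add: sum_distrib_left mult.assoc)
  finally show ?thesis using \<open>c \<ge> 0\<close> v by simp
qed

text \<open>The constant functional 1 vanishes on every Jack function of degree n except that of the
  row, so this sum is a positive multiple of \<open>specialize v (J {#n#})\<close>.\<close>

lemma jack_row_test:
  assumes v: "totally_jack_positive v" and n: "n \<ge> 1" and \<alpha>: "\<alpha> > 0"
  shows "(\<Sum>\<mu>\<in>partitions_of n. 1 / jack_weight \<alpha> \<mu> * (\<Prod>k\<in>#\<mu>. v k)) \<ge> 0"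
proof -
  obtain J where J: "jack_functions \<alpha> J" "\<And>\<kappa>. is_partition \<kappa> \<Longrightarrow> specialize v (J \<kappa>) \<ge> 0"
    using v \<alpha> unfolding totally_jack_positive_def by blast
  have row: "{#n#} \<in> partitions_of n" using n by (auto simp: partitions_of_def is_partition_def)
  show ?thesis
    using jack_dual_specialization_nonneg[OF J(1) \<alpha> n row, of "\<lambda>_. 1"]
      jack_row_functional[OF J(1) n] J(2)[of "{#n#}"] row
    by (simp add: partitions_of_def)
qed

text \<open>The functional \<open>count \<mu> 1\<close> need not vanish on the Jack function of the
  row. That function is proportional to the inverse weights, so up to a common factor it takes the
  values b and a under \<open>count \<mu> 1\<close> and under 1; subtracting the constant b / a
  makes L vanish there. The claim is positivity at (n-1, 1), multiplied by a.\<close>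

lemma jack_hook_test:
  assumes v: "totally_jack_positive v" and n: "n \<ge> 2" and \<alpha>: "\<alpha> > 0"
  shows "(\<Sum>\<mu>\<in>partitions_of n. 1 / jack_weight \<alpha> \<mu>) *
        (\<Sum>\<mu>\<in>partitions_of n. real (count \<mu> 1) / jack_weight \<alpha> \<mu> * (\<Prod>k\<in>#\<mu>. v k))
     \<ge> (\<Sum>\<mu>\<in>partitions_of n. real (count \<mu> 1) / jack_weight \<alpha> \<mu>) *
        (\<Sum>\<mu>\<in>partitions_of n. 1 / jack_weight \<alpha> \<mu> * (\<Prod>k\<in>#\<mu>. v k))"
proof -
  let ?P = "partitions_of n" and ?w = "jack_weight \<alpha>"
  have n1: "n \<ge> 1" using n by simp
  obtain J where J: "jack_functions \<alpha> J" "\<And>\<kappa>. is_partition \<kappa> \<Longrightarrow> specialize v (J \<kappa>) \<ge> 0"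
    using v \<alpha> unfolding totally_jack_positive_def by blast
  have row: "{#n#} \<in> ?P" using n by (auto simp: partitions_of_def is_partition_def)
  have hook: "{#n - 1, 1#} \<in> ?P" using n by (auto simp: partitions_of_def is_partition_def)
  have fin: "finite ?P" using finite_partitions_of[OF n1] .
  have w: "?w \<mu> > 0" if "\<mu> \<in> ?P" for \<mu>
    using that jack_weight_pos[OF _ \<alpha>] by (simp add: partitions_of_def)
  define a where "a = (\<Sum>\<mu>\<in>?P. 1 / ?w \<mu>)"
  define b where "b = (\<Sum>\<mu>\<in>?P. real (count \<mu> 1) / ?w \<mu>)"
  have a: "a > 0"
    unfolding a_def using w w[OF row] by (intro sum_pos2[OF fin row]) (auto intro: less_imp_le)
  have cnt: "count \<mu> 1 \<le> n" if "\<mu> \<in> ?P" for \<mu>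
  proof -
    have "count \<mu> 1 \<le> size \<mu>" by (rule count_le_size)
    also have "\<dots> \<le> sum_mset \<mu>"
      using that unfolding is_partition_def partitions_of_def
      by (induction \<mu> arbitrary: n) (auto simp: Suc_le_eq)
    finally show ?thesis using that by (simp add: partitions_of_def)
  qed
  \<comment> \<open>The largest possible count is n, attained at \<open>replicate_mset n 1\<close>;
    hence b / a is at most n and L is nonnegative at that partition.\<close>
  have "b \<le> (\<Sum>\<mu>\<in>?P. real n * (1 / ?w \<mu>))"
    unfolding b_def using cnt w by (intro sum_mono) (auto simp: divide_right_mono less_imp_le)
  then have ba: "b \<le> real n * a" by (simp add: a_def sum_distrib_left)
  define L where "L \<mu> = real (count \<mu> 1) - b / a" for \<mu> :: "nat multiset"
  have U_row: "1 / ?w \<mu> = 1 / ?w (replicate_mset n 1) * coeff_at (J {#n#}) \<mu>" if "\<mu> \<in> ?P" for \<mu>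
    using jack_dual_vector[OF J(1) \<alpha> n1 row _ that, of "\<lambda>_. 1"] jack_row_functional[OF J(1) n1]
    by simp
  have L_row: "(\<Sum>\<mu>\<in>?P. L \<mu> * coeff_at (J {#n#}) \<mu>) = 0"
  proof -
    define W where "W = ?w (replicate_mset n 1)"
    have "W > 0" using w[OF ones_mem_partitions_of] by (simp add: W_def)
    have "coeff_at (J {#n#}) \<mu> = W * (1 / ?w \<mu>)" if "\<mu> \<in> ?P" for \<mu>
      using U_row[OF that] \<open>W > 0\<close> by (simp add: W_def)
    then have "(\<Sum>\<mu>\<in>?P. L \<mu> * coeff_at (J {#n#}) \<mu>) = (\<Sum>\<mu>\<in>?P. L \<mu> * (W * (1 / ?w \<mu>)))"
      by (intro sum.cong refl) simp
    also have "\<dots> = (\<Sum>\<mu>\<in>?P. W * (real (count \<mu> 1) / ?w \<mu> - b / a * (1 / ?w \<mu>)))"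
      by (intro sum.cong refl) (simp add: L_def algebra_simps diff_divide_distrib)
    also have "\<dots> = W * ((\<Sum>\<mu>\<in>?P. real (count \<mu> 1) / ?w \<mu>) - b / a * (\<Sum>\<mu>\<in>?P. 1 / ?w \<mu>))"
      by (simp only: sum_distrib_left[symmetric] sum_subtractf)
    also have "\<dots> = W * (b - b / a * a)"
      by (simp only: a_def[symmetric] b_def[symmetric])
    finally show ?thesis using a by simp
  qed
  have Lz: "(\<Sum>\<mu>\<in>?P. L \<mu> * coeff_at (J \<rho>) \<mu>) = 0" if \<rho>: "\<rho> \<in> ?P" "\<rho> \<noteq> {#n - 1, 1#}" for \<rho>
  proof (cases "\<rho> = {#n#}")
    case False
    have "(\<Sum>\<mu>\<in>?P. L \<mu> * coeff_at (J \<rho>) \<mu>) = (\<Sum>\<mu>\<in>?P. real (count \<mu> 1) * coeff_at (J \<rho>) \<mu>)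
        - b / a * (\<Sum>\<mu>\<in>?P. coeff_at (J \<rho>) \<mu>)"
      by (simp add: L_def left_diff_distrib sum_subtractf sum_distrib_left)
    then show ?thesis
      using jack_row_functional[OF J(1) n1 \<rho>(1) False] jack_hook_functional[OF J(1) n \<rho>(1) False \<rho>(2)]
      by simp
  qed (use L_row in simp)
  have "b / a \<le> real n" using ba a by (simp add: field_simps)
  then have L1: "L (replicate_mset n 1) \<ge> 0" by (simp add: L_def)
  have "(\<Sum>\<mu>\<in>?P. L \<mu> / ?w \<mu> * (\<Prod>k\<in>#\<mu>. v k)) \<ge> 0"
    using J(2)[of "{#n - 1, 1#}"] hook
    by (intro jack_dual_specialization_nonneg[OF J(1) \<alpha> n1 hook Lz L1]) (auto simp: partitions_of_def)
  also have "(\<Sum>\<mu>\<in>?P. L \<mu> / ?w \<mu> * (\<Prod>k\<in>#\<mu>. v k)) =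
      (\<Sum>\<mu>\<in>?P. real (count \<mu> 1) / ?w \<mu> * (\<Prod>k\<in>#\<mu>. v k)) - b / a * (\<Sum>\<mu>\<in>?P. 1 / ?w \<mu> * (\<Prod>k\<in>#\<mu>. v k))"
    unfolding L_def by (simp add: sum_distrib_left diff_divide_distrib left_diff_distrib sum_subtractf)
  finally have "b / a * (\<Sum>\<mu>\<in>?P. 1 / ?w \<mu> * (\<Prod>k\<in>#\<mu>. v k))
      \<le> (\<Sum>\<mu>\<in>?P. real (count \<mu> 1) / ?w \<mu> * (\<Prod>k\<in>#\<mu>. v k))" by simp
  then have "a * (b / a * (\<Sum>\<mu>\<in>?P. 1 / ?w \<mu> * (\<Prod>k\<in>#\<mu>. v k)))
      \<le> a * (\<Sum>\<mu>\<in>?P. real (count \<mu> 1) / ?w \<mu> * (\<Prod>k\<in>#\<mu>. v k))"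
    using a by (intro mult_left_mono) auto
  then have "b * (\<Sum>\<mu>\<in>?P. 1 / ?w \<mu> * (\<Prod>k\<in>#\<mu>. v k))
      \<le> a * (\<Sum>\<mu>\<in>?P. real (count \<mu> 1) / ?w \<mu> * (\<Prod>k\<in>#\<mu>. v k))"
    using a by simp
  then show ?thesis unfolding a_def b_def .
qed

section \<open>Leading terms as the Jack parameter tends to infinity\<close>

lemma size_eq_1_partition: "\<mu> \<in> partitions_of n \<Longrightarrow> size \<mu> = 1 \<longleftrightarrow> \<mu> = {#n#}"
  by (metis (mono_tags, lifting) mem_Collect_eq partitions_of_def size_1_singleton_mset size_single
      sum_mset.singleton)

lemma size_pos_partition: "n \<ge> 1 \<Longrightarrow> \<mu> \<in> partitions_of n \<Longrightarrow> size \<mu> \<ge> 1"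
  by (cases \<mu>) (auto simp: partitions_of_def)

lemma partition_size_2_with_1:
  assumes "\<mu> \<in> partitions_of n" "size \<mu> = 2" "1 \<in># \<mu>"
  shows "\<mu> = {#n - 1, 1#}"
proof -
  obtain \<nu> where \<nu>: "\<mu> = add_mset 1 \<nu>" using assms(3) by (metis multi_member_split)
  then have "size \<nu> = 1" using assms(2) by simp
  then obtain j where "\<nu> = {#j#}" by (blast dest: size_1_singleton_mset)
  then show ?thesis using \<nu> assms(1) by (auto simp: partitions_of_def)
qed

text \<open>With \<theta> = 1/\<alpha> the inverse weight is a monomial in \<theta>, so that the
  limit of large \<alpha> amounts to extracting the lowest power of \<theta>.\<close>

lemma inverse_jack_weight:
  "\<theta> > 0 \<Longrightarrow> c / jack_weight (1 / \<theta>) \<mu> = c / z_aut \<mu> * \<theta> ^ size \<mu>"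
  by (simp add: jack_weight_def power_one_over field_simps)

lemma row_sum_limit:
  assumes "n \<ge> 1"
  shows "((\<lambda>\<theta>. (\<Sum>\<mu>\<in>partitions_of n. c \<mu> * \<theta> ^ size \<mu>) / \<theta>) \<longlongrightarrow> c {#n#}) (at_right (0::real))"
proof -
  let ?P = "partitions_of n"
  have fin: "finite ?P" using finite_partitions_of[OF assms] .
  have row: "{#n#} \<in> ?P" using assms by (auto simp: partitions_of_def is_partition_def)
  have "((\<lambda>\<theta>. \<Sum>\<mu>\<in>?P. c \<mu> * \<theta> ^ (size \<mu> - 1)) \<longlongrightarrow> (\<Sum>\<mu>\<in>?P. c \<mu> * 0 ^ (size \<mu> - 1))) (at_right (0::real))"
    by (intro tendsto_intros)
  also have "(\<Sum>\<mu>\<in>?P. c \<mu> * 0 ^ (size \<mu> - 1)) = (\<Sum>\<mu>\<in>?P. if \<mu> = {#n#} then c {#n#} else 0)"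
  proof (intro sum.cong refl)
    fix \<mu> assume \<mu>: "\<mu> \<in> ?P"
    show "c \<mu> * 0 ^ (size \<mu> - 1) = (if \<mu> = {#n#} then c {#n#} else 0)"
      using size_eq_1_partition[OF \<mu>] size_pos_partition[OF assms \<mu>] by (auto simp: power_0_left)
  qed
  also have "\<dots> = c {#n#}" using fin row by simp
  finally show ?thesis
  proof (rule Lim_transform_eventually)
    show "\<forall>\<^sub>F \<theta> in at_right 0. (\<Sum>\<mu>\<in>?P. c \<mu> * \<theta> ^ (size \<mu> - 1)) = (\<Sum>\<mu>\<in>?P. c \<mu> * \<theta> ^ size \<mu>) / \<theta>"
      using eventually_at_right_less[of "0::real"]
    proof eventually_elim
      case (elim \<theta>)
      then show ?case unfolding sum_divide_distrib
        using size_pos_partition[OF assms] by (intro sum.cong refl) (simp add: power_diff)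
    qed
  qed
qed

text \<open>The hypothesis on c removes the partition (n) and all partitions into two parts without
  a part 1, so the order \<theta>^2 comes from (n-1, 1) alone.\<close>

lemma hook_sum_limit:
  assumes "n \<ge> 2" "\<And>\<mu>. 1 \<notin># \<mu> \<Longrightarrow> c \<mu> = 0"
  shows "((\<lambda>\<theta>. (\<Sum>\<mu>\<in>partitions_of n. c \<mu> * \<theta> ^ size \<mu>) / \<theta>\<^sup>2) \<longlongrightarrow> c {#n - 1, 1#}) (at_right (0::real))"
proof -
  let ?P = "partitions_of n"
  have n1: "n \<ge> 1" using assms by simp
  have fin: "finite ?P" using finite_partitions_of[OF n1] .
  have hook: "{#n - 1, 1#} \<in> ?P" using assms by (auto simp: partitions_of_def is_partition_def)
  have c1: "c \<mu> = 0" if "\<mu> \<in> ?P" "size \<mu> < 2" for \<mu>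
  proof -
    have "size \<mu> = 1" using size_pos_partition[OF n1 that(1)] that(2) by linarith
    then have "\<mu> = {#n#}" using size_eq_1_partition[OF that(1)] by simp
    then show ?thesis using assms by auto
  qed
  have "((\<lambda>\<theta>. \<Sum>\<mu>\<in>?P. c \<mu> * \<theta> ^ (size \<mu> - 2)) \<longlongrightarrow> (\<Sum>\<mu>\<in>?P. c \<mu> * 0 ^ (size \<mu> - 2))) (at_right (0::real))"
    by (intro tendsto_intros)
  also have "(\<Sum>\<mu>\<in>?P. c \<mu> * 0 ^ (size \<mu> - 2)) = (\<Sum>\<mu>\<in>?P. if \<mu> = {#n - 1, 1#} then c {#n - 1, 1#} else 0)"
  proof (intro sum.cong refl)
    fix \<mu> assume \<mu>: "\<mu> \<in> ?P"
    show "c \<mu> * 0 ^ (size \<mu> - 2) = (if \<mu> = {#n - 1, 1#} then c {#n - 1, 1#} else 0)"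
    proof (cases "size \<mu> = 2 \<and> 1 \<in># \<mu>")
      case True
      then show ?thesis using partition_size_2_with_1[OF \<mu>] by auto
    next
      case False
      then have "\<mu> \<noteq> {#n - 1, 1#}" by auto
      moreover have "c \<mu> * 0 ^ (size \<mu> - 2) = 0"
      proof (cases "size \<mu> > 2")
        case False2: False
        then have "c \<mu> = 0" using False c1[OF \<mu>] assms(2)[of \<mu>] by (cases "size \<mu> = 2") auto
        then show ?thesis by simp
      qed (simp add: power_0_left)
      ultimately show ?thesis by simp
    qed
  qed
  also have "\<dots> = c {#n - 1, 1#}" using fin hook by simp
  finally show ?thesis
  proof (rule Lim_transform_eventually)
    show "\<forall>\<^sub>F \<theta> in at_right 0. (\<Sum>\<mu>\<in>?P. c \<mu> * \<theta> ^ (size \<mu> - 2)) = (\<Sum>\<mu>\<in>?P. c \<mu> * \<theta> ^ size \<mu>) / \<theta>\<^sup>2"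
      using eventually_at_right_less[of "0::real"]
    proof eventually_elim
      case (elim \<theta>)
      show ?case unfolding sum_divide_distrib
      proof (intro sum.cong refl)
        fix \<mu> assume \<mu>: "\<mu> \<in> ?P"
        show "c \<mu> * \<theta> ^ (size \<mu> - 2) = c \<mu> * \<theta> ^ size \<mu> / \<theta>\<^sup>2"
          using c1[OF \<mu>] elim by (cases "size \<mu> < 2") (auto simp: power_diff)
      qed
    qed
  qed
qed

lemma totally_jack_positive_nonneg:
  assumes v: "totally_jack_positive v" and n: "n \<ge> 1"
  shows "v n \<ge> 0"
proof -
  define c where "c \<mu> = 1 / z_aut \<mu> * (\<Prod>k\<in>#\<mu>. v k)" for \<mu>
  have "(\<Sum>\<mu>\<in>partitions_of n. c \<mu> * \<theta> ^ size \<mu>) / \<theta> \<ge> 0" if "\<theta> > 0" for \<theta> :: real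
  proof -
    have "(\<Sum>\<mu>\<in>partitions_of n. c \<mu> * \<theta> ^ size \<mu>)
        = (\<Sum>\<mu>\<in>partitions_of n. 1 / jack_weight (1 / \<theta>) \<mu> * (\<Prod>k\<in>#\<mu>. v k))"
      using that by (intro sum.cong refl) (simp add: inverse_jack_weight c_def)
    then show ?thesis using jack_row_test[OF v n, of "1 / \<theta>"] that by simp
  qed
  then have "\<forall>\<^sub>F \<theta> in at_right 0. (\<Sum>\<mu>\<in>partitions_of n. c \<mu> * \<theta> ^ size \<mu>) / \<theta> \<ge> 0"
    by (auto intro: eventually_mono[OF eventually_at_right_less])
  then have "c {#n#} \<ge> 0"
    using row_sum_limit[OF n, of c] by (intro tendsto_lowerbound) auto
  moreover have "z_aut {#n#} > 0" using n by (intro z_aut_pos) (auto simp: is_partition_def)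
  ultimately show ?thesis by (simp add: c_def zero_le_divide_iff)
qed

text \<open>Both sides of the hook inequality have order \<theta>^3. The leading coefficients are
  \<open>v n\<close> and \<open>v (n - 1) * v 1\<close>, with the same positive factor 1 / (n (n -
  1)).\<close>

lemma totally_jack_positive_step:
  assumes v: "totally_jack_positive v" and n: "n \<ge> 2"
  shows "v n \<le> v (n - 1) * v 1"
proof -
  let ?P = "partitions_of n"
  have n1: "n \<ge> 1" using n by simp
  define a where "a \<mu> = 1 / z_aut \<mu>" for \<mu>
  define b where "b \<mu> = real (count \<mu> 1) / z_aut \<mu>" for \<mu>
  define av where "av \<mu> = a \<mu> * (\<Prod>k\<in>#\<mu>. v k)" for \<mu>
  define bv where "bv \<mu> = b \<mu> * (\<Prod>k\<in>#\<mu>. v k)" for \<mu>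
  define S where "S c \<theta> = (\<Sum>\<mu>\<in>?P. c \<mu> * \<theta> ^ size \<mu>)" for c and \<theta> :: real
  have "S b \<theta> / \<theta>\<^sup>2 * (S av \<theta> / \<theta>) \<le> S a \<theta> / \<theta> * (S bv \<theta> / \<theta>\<^sup>2)" if \<theta>: "\<theta> > 0" for \<theta>
  proof -
    have eq: "1 / jack_weight (1 / \<theta>) \<mu> = a \<mu> * \<theta> ^ size \<mu>"
      "real (count \<mu> 1) / jack_weight (1 / \<theta>) \<mu> = b \<mu> * \<theta> ^ size \<mu>" for \<mu>
      using \<theta> by (simp_all add: inverse_jack_weight a_def b_def)
    have "S b \<theta> * S av \<theta> \<le> S a \<theta> * S bv \<theta>"
      using jack_hook_test[OF v n, of "1 / \<theta>"] \<theta>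
      unfolding eq S_def av_def bv_def by (simp add: mult_ac)
    then have "S b \<theta> * S av \<theta> / (\<theta>\<^sup>2 * \<theta>) \<le> S a \<theta> * S bv \<theta> / (\<theta>\<^sup>2 * \<theta>)"
      using \<theta> by (intro divide_right_mono) auto
    then show ?thesis by (simp add: mult.commute)
  qed
  then have ev: "\<forall>\<^sub>F \<theta> in at_right 0. S b \<theta> / \<theta>\<^sup>2 * (S av \<theta> / \<theta>) \<le> S a \<theta> / \<theta> * (S bv \<theta> / \<theta>\<^sup>2)"
    by (auto intro: eventually_mono[OF eventually_at_right_less])
  have z: "b \<mu> = 0" "bv \<mu> = 0" if "1 \<notin># \<mu>" for \<mu>
    using that by (simp_all add: b_def bv_def not_in_iff)
  have "b {#n - 1, 1#} * av {#n#} \<le> a {#n#} * bv {#n - 1, 1#}"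
    unfolding S_def
    by (rule tendsto_le[OF trivial_limit_at_right_real _ _ ev[unfolded S_def]])
      (rule tendsto_mult[OF hook_sum_limit[OF n] row_sum_limit[OF n1]]
        tendsto_mult[OF row_sum_limit[OF n1] hook_sum_limit[OF n]]; simp add: z)+
  moreover have "a {#n#} = 1 / real n" by (simp add: a_def z_aut_def)
  \<comment> \<open>For n = 2 the two parts coincide: the count and \<open>z_aut\<close> are both 2,
    and the quotient is again 1 / (n - 1).\<close>
  moreover have "b {#n - 1, 1#} = 1 / real (n - 1)"
    using n by (cases "n = 2") (auto simp: b_def z_aut_def)
  ultimately have "1 / real (n - 1) * (1 / real n * v n)
      \<le> 1 / real n * (1 / real (n - 1) * (v (n - 1) * v 1))"
    by (simp add: av_def bv_def mult_ac)
  then have "1 / (real (n - 1) * real n) * v n \<le> 1 / (real (n - 1) * real n) * (v (n - 1) * v 1)"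
    by (simp add: mult_ac)
  then show ?thesis using n by (subst (asm) mult_le_cancel_left_pos) auto
qed

lemma totally_jack_positive_le_1:
  assumes v: "totally_jack_positive v" and v1: "v 1 = 1" and n: "n \<ge> 1"
  shows "v n \<le> 1"
  using n
proof (induction n rule: nat_induct_at_least)
  case (Suc n)
  then show ?case using totally_jack_positive_step[OF v, of "Suc n"] v1 by simp
qed (use v1 in simp)

section \<open>Weighted paths\<close>

text \<open>The weight of a step from height a to height b. A level step on the axis has weight 0,
  and in this way the paths excluded from \<open>lukasiewicz_paths\<close> drop out of the
  sums.\<close>

definition step_weight :: "real \<Rightarrow> (nat \<Rightarrow> real) \<Rightarrow> nat \<Rightarrow> nat \<Rightarrow> real" where
  "step_weight g v a b =
     (if b + 1 = a then 1 else if b = a then real a * g else if b > a then v (b - a) else 0)"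

fun path_weight :: "real \<Rightarrow> (nat \<Rightarrow> real) \<Rightarrow> nat list \<Rightarrow> real" where
  "path_weight g v (a # b # y) = step_weight g v a b * path_weight g v (b # y)"
| "path_weight g v y = 1"

text \<open>The starting height is arbitrary and level steps on the axis are allowed, so that
  deleting the first vertex gives a path of the same kind.\<close>

definition descents :: "nat \<Rightarrow> nat \<Rightarrow> nat list set" where
  "descents l n = {y. length y = Suc l \<and> y ! 0 = n \<and> y ! l = 0 \<and> (\<forall>j<l. y ! j \<le> y ! Suc j + 1)}"

text \<open>Recursion on the first step. The cutoff at l loses nothing: a path that ends at 0 and
  falls by at most 1 per step cannot start above its length.\<close>

primrec descent_sum :: "real \<Rightarrow> (nat \<Rightarrow> real) \<Rightarrow> nat \<Rightarrow> nat \<Rightarrow> real" where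
  "descent_sum g v 0 n = (if n = 0 then 1 else 0)"
| "descent_sum g v (Suc l) n = (\<Sum>m\<le>l. step_weight g v n m * descent_sum g v l m)"

lemma descents_height: "y \<in> descents l n \<Longrightarrow> n \<le> l"
proof (induction l arbitrary: y n)
  case (Suc l)
  then have "y = n # tl y" "tl y \<in> descents l (y ! 1)" "n \<le> y ! 1 + 1"
    by (cases y; auto simp: descents_def nth_tl)+
  then show ?case using Suc.IH[of "tl y" "y ! 1"] by simp
qed (auto simp: descents_def)

lemma descents_0: "descents 0 n = (if n = 0 then {[0]} else {})"
  by (auto simp: descents_def length_Suc_conv)

lemma descents_Suc: "descents (Suc l) n = (\<Union>m\<in>{m. m \<le> l \<and> n \<le> m + 1}. (#) n ` descents l m)"
proof (intro set_eqI iffI)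
  fix y assume y: "y \<in> descents (Suc l) n"
  then have *: "y = n # tl y" "tl y \<in> descents l (y ! 1)" "n \<le> y ! 1 + 1"
    by (cases y; auto simp: descents_def nth_tl)+
  then have "y ! 1 \<le> l" using descents_height by blast
  then show "y \<in> (\<Union>m\<in>{m. m \<le> l \<and> n \<le> m + 1}. (#) n ` descents l m)"
    using * by auto
next
  fix y assume "y \<in> (\<Union>m\<in>{m. m \<le> l \<and> n \<le> m + 1}. (#) n ` descents l m)"
  then obtain m z where "m \<le> l" "n \<le> m + 1" "z \<in> descents l m" "y = n # z" by auto
  then show "y \<in> descents (Suc l) n"
    by (auto simp: descents_def nth_Cons split: nat.splits)
qed

lemma finite_descents: "finite (descents l n)"
  by (induction l arbitrary: n) (auto simp: descents_0 descents_Suc)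

lemma sum_descents: "(\<Sum>y\<in>descents l n. path_weight g v y) = descent_sum g v l n"
proof (induction l arbitrary: n)
  case 0
  then show ?case by (simp add: descents_0)
next
  case (Suc l)
  have hd: "\<exists>z'. z = m # z'" if "z \<in> descents l m" for z m
    using that by (cases z) (auto simp: descents_def)
  have "(\<Sum>y\<in>descents (Suc l) n. path_weight g v y)
      = (\<Sum>m | m \<le> l \<and> n \<le> m + 1. \<Sum>y\<in>(#) n ` descents l m. path_weight g v y)"
    unfolding descents_Suc
  proof (intro sum.UNION_disjoint)
    show "\<forall>i\<in>{m. m \<le> l \<and> n \<le> m + 1}. \<forall>j\<in>{m. m \<le> l \<and> n \<le> m + 1}.
        i \<noteq> j \<longrightarrow> (#) n ` descents l i \<inter> (#) n ` descents l j = {}"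
      by (auto simp: descents_def)
  qed (auto simp: finite_descents)
  also have "\<dots> = (\<Sum>m | m \<le> l \<and> n \<le> m + 1. \<Sum>z\<in>descents l m. path_weight g v (n # z))"
    by (rule sum.cong[OF refl], subst sum.reindex) (simp_all add: inj_on_def)
  also have "\<dots> = (\<Sum>m | m \<le> l \<and> n \<le> m + 1. step_weight g v n m * (\<Sum>z\<in>descents l m. path_weight g v z))"
    unfolding sum_distrib_left by (intro sum.cong refl) (auto dest: hd)
  also have "\<dots> = (\<Sum>m\<le>l. step_weight g v n m * descent_sum g v l m)"
    unfolding Suc.IH by (intro sum.mono_neutral_left) (auto simp: step_weight_def)
  finally show ?case by simp
qed

lemma path_weight_prod:
  "path_weight g v y = (\<Prod>j\<in>{1..<length y}. step_weight g v (y ! (j - 1)) (y ! j))"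
proof (induction g v y rule: path_weight.induct)
  case (1 g v a b y)
  have "{1..<length (a # b # y)} = insert 1 (Suc ` {1..<length (b # y)})"
    by (auto simp: image_Suc_atLeastLessThan)
  then have "(\<Prod>j\<in>{1..<length (a # b # y)}. step_weight g v ((a # b # y) ! (j - 1)) ((a # b # y) ! j))
     = step_weight g v a b * (\<Prod>j\<in>Suc ` {1..<length (b # y)}.
          step_weight g v ((a # b # y) ! (j - 1)) ((a # b # y) ! j))"
    by (simp add: image_iff)
  also have "(\<Prod>j\<in>Suc ` {1..<length (b # y)}. step_weight g v ((a # b # y) ! (j - 1)) ((a # b # y) ! j))
    = (\<Prod>j\<in>{1..<length (b # y)}. step_weight g v ((b # y) ! (j - 1)) ((b # y) ! j))"
  proof (subst prod.reindex; (intro prod.cong refl)?)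
    fix j assume "j \<in> {1..<length (b # y)}"
    then obtain i where "j = Suc i" by (cases j) auto
    then show "((\<lambda>j. step_weight g v ((a # b # y) ! (j - 1)) ((a # b # y) ! j)) \<circ> Suc) j
        = step_weight g v ((b # y) ! (j - 1)) ((b # y) ! j)" by simp
  qed simp
  finally show ?case using 1 by simp
qed auto

lemma path_weight_eq:
  assumes y: "y \<in> descents l 0"
  shows "path_weight g v y =
    (if y \<in> lukasiewicz_paths l
     then \<Prod>i\<in>{1..l}. (real i * g) ^ card (horizontal_steps_at y i) * v i ^ card (up_steps y i)
     else 0)"
proof -
  have len: "length y = Suc l" and y0: "y ! 0 = 0" and yl: "y ! l = 0"
    and st: "\<And>j. j < l \<Longrightarrow> y ! j \<le> y ! Suc j + 1"
    using y by (auto simp: descents_def)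
  have st': "y ! (j - 1) \<le> y ! j + 1" if "j \<in> {1..l}" for j
    using st[of "j - 1"] that by (cases j) auto
  have height: "y ! (l - k) \<le> k" if "k \<le> l" for k
    using that
  proof (induction k)
    case (Suc k)
    then show ?case using st[of "l - Suc k"] by (simp add: Suc_diff_Suc)
  qed (use yl in simp)
  have height': "y ! j \<le> l - j" if "j \<le> l" for j using height[of "l - j"] that by simp
  have mem: "y \<in> lukasiewicz_paths l \<longleftrightarrow> \<not> (\<exists>j\<in>{1..l}. y ! j = 0 \<and> y ! (j - 1) = 0)"
  proof -
    have "int (y ! j) - int (y ! (j - 1)) \<ge> -1" if "j \<in> {1..l}" for j
      using st'[OF that] by linarith
    then show ?thesis using len y0 yl unfolding lukasiewicz_paths_def by blast
  qed
  let ?w = "\<lambda>j. step_weight g v (y ! (j - 1)) (y ! j)"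
  have pw: "path_weight g v y = (\<Prod>j\<in>{1..l}. ?w j)"
    by (simp add: path_weight_prod len atLeastLessThanSuc_atLeastAtMost)
  show ?thesis
  proof (cases "y \<in> lukasiewicz_paths l")
    case False
    then obtain j where "j \<in> {1..l}" "y ! j = 0" "y ! (j - 1) = 0" using mem by blast
    then have "?w j = 0" by (simp add: step_weight_def)
    then have "path_weight g v y = 0" unfolding pw using \<open>j \<in> {1..l}\<close> by (intro prod_zero) auto
    then show ?thesis using False by simp
  next
    case True
    define H U where "H i = horizontal_steps_at y i" and "U i = up_steps y i" for i
    have H: "H i = {j\<in>{1..l}. y ! j = i \<and> y ! (j - 1) = i}"
      and U: "i \<ge> 1 \<Longrightarrow> U i = {j\<in>{1..l}. y ! j = y ! (j - 1) + i}" for i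
      by (auto simp: H_def U_def horizontal_steps_at_def up_steps_def len)
    have up: "y ! j - y ! (j - 1) \<le> l" if "j \<in> {1..l}" for j
      using height'[of j] that by simp
    \<comment> \<open>The weight of one step becomes a product over all i in which at most one
      condition holds. The double product can then be exchanged, and each i collects its own
      power.\<close>
    have single: "?w j = (\<Prod>i\<in>{1..l}. (if j \<in> H i then real i * g else 1) * (if j \<in> U i then v i else 1))"
      if j: "j \<in> {1..l}" for j
    proof -
      have "(\<Prod>i\<in>{1..l}. (if j \<in> H i then real i * g else 1) * (if j \<in> U i then v i else 1))
        = (\<Prod>i\<in>{1..l}. (if i = y ! j then (if y ! (j - 1) = y ! j then real i * g else 1) else 1)) *
          (\<Prod>i\<in>{1..l}. (if i = y ! j - y ! (j - 1) then v i else 1))"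
        unfolding prod.distrib using j
        by (intro arg_cong2[of _ _ _ _ "(*)"] prod.cong refl) (auto simp: H U)
      also have "\<dots> = (if y ! j \<in> {1..l} \<and> y ! (j - 1) = y ! j then real (y ! j) * g else 1) *
          (if y ! j - y ! (j - 1) \<in> {1..l} then v (y ! j - y ! (j - 1)) else 1)"
        by (simp add: prod.delta)
      also have "\<dots> = ?w j"
      proof -
        have "\<not> (y ! j = 0 \<and> y ! (j - 1) = 0)" using mem True j by blast
        then show ?thesis
          using j up[OF j] st'[OF j] height'[of j] by (auto simp: step_weight_def)
      qed
      finally show ?thesis by simp
    qed
    have "path_weight g v y =
      (\<Prod>j\<in>{1..l}. \<Prod>i\<in>{1..l}. (if j \<in> H i then real i * g else 1) * (if j \<in> U i then v i else 1))"
      unfolding pw by (intro prod.cong refl single)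
    also have "\<dots> = (\<Prod>i\<in>{1..l}. \<Prod>j\<in>{1..l}. (if j \<in> H i then real i * g else 1) * (if j \<in> U i then v i else 1))"
      by (rule prod.swap)
    also have "\<dots> = (\<Prod>i\<in>{1..l}. (real i * g) ^ card (H i) * v i ^ card (U i))"
    proof (intro prod.cong refl)
      fix i assume i: "i \<in> {1..l}"
      have "(\<Prod>j\<in>{1..l}. if j \<in> H i then real i * g else 1) = (real i * g) ^ card (H i)"
        by (simp flip: prod.inter_filter) (intro arg_cong[of _ _ "\<lambda>s. _ ^ card s"], auto simp: H)
      moreover have "(\<Prod>j\<in>{1..l}. if j \<in> U i then v i else 1) = v i ^ card (U i)"
        using i by (simp flip: prod.inter_filter) (intro arg_cong[of _ _ "\<lambda>s. _ ^ card s"], auto simp: U)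
      ultimately show "(\<Prod>j\<in>{1..l}. (if j \<in> H i then real i * g else 1) * (if j \<in> U i then v i else 1))
        = (real i * g) ^ card (H i) * v i ^ card (U i)" by (simp add: prod.distrib)
    qed
    finally show ?thesis using True by (simp add: H_def U_def)
  qed
qed

lemma path_moment_eq_descent_sum: "path_moment g v l = descent_sum g v l 0"
proof -
  have sub: "lukasiewicz_paths l \<subseteq> descents l 0"
  proof
    fix y assume y: "y \<in> lukasiewicz_paths l"
    have "y ! j \<le> y ! Suc j + 1" if "j < l" for j
    proof -
      have "Suc j \<in> {1..l}" using that by simp
      then have "int (y ! Suc j) - int (y ! (Suc j - 1)) \<ge> -1"
        using y unfolding lukasiewicz_paths_def by blast
      then show ?thesis by simp
    qed
    then show "y \<in> descents l 0" using y by (simp add: lukasiewicz_paths_def descents_def)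
  qed
  have "descent_sum g v l 0 = (\<Sum>y\<in>descents l 0. path_weight g v y)"
    by (simp add: sum_descents)
  also have "\<dots> = (\<Sum>y\<in>lukasiewicz_paths l. path_weight g v y)"
    using sub by (intro sum.mono_neutral_right) (auto simp: finite_descents path_weight_eq)
  also have "\<dots> = path_moment g v l"
    unfolding path_moment_def using sub by (intro sum.cong refl) (auto simp: path_weight_eq)
  finally show ?thesis by simp
qed

lemma descent_sum_eq_0: "n > l \<Longrightarrow> descent_sum g v l n = 0"
  by (induction l arbitrary: n) (auto simp: step_weight_def intro!: sum.neutral)

context
  fixes g :: real and v :: "nat \<Rightarrow> real"
  assumes g: "g > 0" and v_nonneg: "\<And>n. n \<ge> 1 \<Longrightarrow> v n \<ge> 0"
begin

lemma step_weight_nonneg: "step_weight g v a b \<ge> 0"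
  using g v_nonneg by (auto simp: step_weight_def)

lemma descent_sum_nonneg: "descent_sum g v l n \<ge> 0"
  by (induction l arbitrary: n) (auto intro!: sum_nonneg mult_nonneg_nonneg step_weight_nonneg)

lemma descent_sum_Suc_ge: "descent_sum g v (Suc l) n \<ge> step_weight g v n m * descent_sum g v l m"
proof (cases "m \<le> l")
  case True
  then show ?thesis
    unfolding descent_sum.simps
    by (intro member_le_sum) (auto intro!: mult_nonneg_nonneg step_weight_nonneg descent_sum_nonneg)
next
  case False
  then show ?thesis using descent_sum_nonneg[of "Suc l" n] by (simp add: descent_sum_eq_0)
qed

text \<open>The bound comes from the paths that climb to height \<open>h\<close> by unit steps and stay there.\<close>

lemma path_moment_ge:
  assumes "v 1 = 1"
  shows "path_moment g v (h + k + h) \<ge> (real h * g) ^ k"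
proof -
  have down: "descent_sum g v h h \<ge> 1" for h
  proof (induction h)
    case (Suc h)
    then show ?case using descent_sum_Suc_ge[of "Suc h" h h] by (simp add: step_weight_def del: descent_sum.simps(2))
  qed simp
  have flat: "descent_sum g v (k + h) h \<ge> (real h * g) ^ k"
  proof (induction k)
    case (Suc k)
    have "(real h * g) ^ Suc k \<le> (real h * g) * descent_sum g v (k + h) h"
      using Suc g by (simp add: mult_left_mono)
    also have "\<dots> \<le> descent_sum g v (Suc k + h) h"
      using descent_sum_Suc_ge[of h h "k + h"] by (simp add: step_weight_def del: descent_sum.simps(2))
    finally show ?case .
  qed (use down in simp)
  have up: "j \<le> h \<Longrightarrow> descent_sum g v (j + k + h) (h - j) \<ge> (real h * g) ^ k" for j
  proof (induction j)
    case (Suc j)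
    have "(real h * g) ^ k \<le> descent_sum g v (j + k + h) (h - j)" using Suc by simp
    also have "\<dots> \<le> descent_sum g v (Suc (j + k + h)) (h - Suc j)"
    proof -
      have "h - j = Suc (h - Suc j)" using Suc.prems by simp
      then have "step_weight g v (h - Suc j) (h - j) = 1" using assms by (simp add: step_weight_def)
      then show ?thesis
        using descent_sum_Suc_ge[of "h - Suc j" "h - j" "j + k + h"] by (simp del: descent_sum.simps(2))
    qed
    finally show ?case by (simp del: descent_sum.simps(2))
  qed (use flat in simp)
  show ?thesis using up[of h] by (simp add: path_moment_eq_descent_sum)
qed

end

section \<open>Polynomials of the path operator\<close>

text \<open>
  The polynomials with \<open>p\<^sub>n(T) e\<^sub>0 = e\<^sub>n\<close>, for the operator \<open>T\<close> whose matrix entries are the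
  step weights of the paths.
\<close>

fun path_poly :: "real \<Rightarrow> (nat \<Rightarrow> real) \<Rightarrow> nat \<Rightarrow> 'a::real_normed_field poly" where
  "path_poly g v 0 = 1"
| "path_poly g v (Suc n) = [:- of_real (g * real n), 1:] * path_poly g v n
     - (\<Sum>i\<in>{1..n}. smult (of_real (v i)) (path_poly g v (n - i)))"

declare path_poly.simps(2) [simp del]

lemma poly_path_poly_Suc:
  "poly (path_poly g v (Suc n)) x = (x - of_real (g * real n)) * poly (path_poly g v n) x
     - (\<Sum>i\<in>{1..n}. of_real (v i) * poly (path_poly g v (n - i)) x)"
  by (simp add: path_poly.simps(2) poly_sum algebra_simps)

lemma poly_path_poly_of_real:
  "poly (path_poly g v n) (of_real x :: 'a::real_normed_field) = of_real (poly (path_poly g v n) x)"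
proof (induction n rule: less_induct)
  case (less n)
  show ?case
  proof (cases n)
    case (Suc m)
    show ?thesis unfolding Suc poly_path_poly_Suc using less.IH by (auto simp: Suc)
  qed simp
qed

lemma smult_sum_right: "smult c (\<Sum>i\<in>A. f i) = (\<Sum>i\<in>A. smult c (f i))"
  by (induction A rule: infinite_finite_induct) (auto simp: smult_add_right)

text \<open>The defining recursion solved for x p_k: the coefficients are the weights of the steps
  that end at height k.\<close>

lemma X_times_path_poly:
  "[:0, 1:] * path_poly g v k =
     (\<Sum>m\<le>Suc k. smult (of_real (step_weight g v m k)) (path_poly g v m :: 'a::real_normed_field poly))"
proof -
  let ?P = "path_poly g v :: nat \<Rightarrow> 'a poly"
  have "(\<Sum>m\<le>Suc k. smult (of_real (step_weight g v m k)) (?P m))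
      = ?P (Suc k) + smult (of_real (g * real k)) (?P k)
        + (\<Sum>m<k. smult (of_real (v (k - m))) (?P m))"
    by (simp add: step_weight_def lessThan_Suc_atMost[symmetric] mult.commute)
  also have "(\<Sum>m<k. smult (of_real (v (k - m))) (?P m)) = (\<Sum>i\<in>{1..k}. smult (of_real (v i)) (?P (k - i)))"
    by (rule sum.reindex_bij_witness[of _ "\<lambda>i. k - i" "\<lambda>m. k - m"]) auto
  finally show ?thesis by (simp add: path_poly.simps(2))
qed

text \<open>The coordinates of T^l e_0, transported to polynomials. A further multiplication by x
  puts one more step in front of the paths counted by \<open>descent_sum\<close>.\<close>

lemma monom_eq_path_polys:
  "monom 1 l = (\<Sum>k\<le>l. smult (of_real (descent_sum g v l k)) (path_poly g v k :: 'a::real_normed_field poly))"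
proof (induction l)
  case (Suc l)
  let ?P = "path_poly g v :: nat \<Rightarrow> 'a poly"
  have "monom 1 (Suc l) = [:0, 1:] * (monom 1 l :: 'a poly)" by (simp add: monom_Suc)
  also have "\<dots> = (\<Sum>k\<le>l. smult (of_real (descent_sum g v l k)) ([:0, 1:] * ?P k))"
    unfolding Suc by (simp add: sum_distrib_left)
  also have "\<dots> = (\<Sum>k\<le>l. \<Sum>m\<le>Suc l. smult (of_real (step_weight g v m k * descent_sum g v l k)) (?P m))"
  proof (intro sum.cong refl)
    fix k assume k: "k \<in> {..l}"
    have "[:0, 1:] * ?P k = (\<Sum>m\<le>Suc l. smult (of_real (step_weight g v m k)) (?P m))"
      unfolding X_times_path_poly using k
      by (intro sum.mono_neutral_left) (auto simp: step_weight_def)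
    then show "smult (of_real (descent_sum g v l k)) ([:0, 1:] * ?P k) =
      (\<Sum>m\<le>Suc l. smult (of_real (step_weight g v m k * descent_sum g v l k)) (?P m))"
      by (simp only: smult_sum_right smult_smult of_real_mult mult.commute)
  qed
  also have "\<dots> = (\<Sum>m\<le>Suc l. \<Sum>k\<le>l. smult (of_real (step_weight g v m k * descent_sum g v l k)) (?P m))"
    by (rule sum.swap)
  also have "\<dots> = (\<Sum>m\<le>Suc l. smult (of_real (descent_sum g v (Suc l) m)) (?P m))"
    by (simp only: descent_sum.simps of_real_sum smult_sum)
  finally show ?case .
qed simp

lemma descent_sum_diag: "descent_sum g v n n = 1"
proof (induction n)
  case (Suc n)
  have "(\<Sum>m\<le>n. step_weight g v (Suc n) m * descent_sum g v n m)
      = (\<Sum>m\<le>n. if m = n then descent_sum g v n n else 0)"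
    by (intro sum.cong refl) (auto simp: step_weight_def)
  then show ?case using Suc by simp
qed simp

text \<open>One term of the exponential series; it serves as a weak form of Stirling's
  formula.\<close>

lemma power_le_fact_exp: "x ^ n \<le> fact n * exp x" if "x \<ge> 0" for x :: real
proof -
  have "(\<Sum>k\<in>{n}. x ^ k /\<^sub>R fact k) \<le> exp x"
    unfolding exp_def using that by (intro sum_le_suminf summable_exp_generic) auto
  then show ?thesis by (simp add: field_simps)
qed

section \<open>Moments of the path polynomials\<close>

locale path_measure =
  fixes g :: real and v :: "nat \<Rightarrow> real" and M :: "real measure"
  assumes g: "g > 0" and v_nonneg: "\<And>n. n \<ge> 1 \<Longrightarrow> v n \<ge> 0" and v_le: "\<And>n. n \<ge> 1 \<Longrightarrow> v n \<le> 1"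
    and v1: "v 1 = 1" and path_measure: "is_path_measure g v M"
begin

sublocale real_distribution M
  using path_measure by (simp add: is_path_measure_def)

abbreviation "pp \<equiv> path_poly g v :: nat \<Rightarrow> real poly"

definition expect :: "real poly \<Rightarrow> real" where
  "expect q = (LINT x|M. poly q x)"

lemma moment: "has_bochner_integral M (\<lambda>x. x ^ l) (descent_sum g v l 0)"
proof (cases "l = 0")
  case True
  then show ?thesis
    using has_bochner_integral_integrable[of M "\<lambda>_. 1 :: real"] prob_space by simp
next
  case False
  then show ?thesis
    using path_measure by (simp add: is_path_measure_def path_moment_eq_descent_sum)
qed

lemma integrable_poly: "integrable M (poly q)"
proof -
  have "integrable M (\<lambda>x. \<Sum>i\<le>degree q. coeff q i * x ^ i)"
    using moment
    by (intro Bochner_Integration.integrable_sum integrable_mult_right) (auto simp: has_bochner_integral_iff)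
  then show ?thesis by (simp add: poly_altdef[abs_def])
qed

lemma expect_add: "expect (p + q) = expect p + expect q"
  by (simp add: expect_def integrable_poly)

lemma expect_smult: "expect (smult c q) = c * expect q"
  by (simp add: expect_def)

lemma expect_0: "expect 0 = 0"
  by (simp add: expect_def)

lemma expect_sum: "expect (\<Sum>i\<in>A. f i) = (\<Sum>i\<in>A. expect (f i))"
  by (induction A rule: infinite_finite_induct) (auto simp: expect_add expect_0)

lemma expect_monom: "expect (monom 1 l) = descent_sum g v l 0"
  using moment[of l] by (simp add: expect_def poly_monom has_bochner_integral_iff)

text \<open>For n > 0 the term k = 0 in the expansion of x^n already equals the whole n-th moment.
  The terms in between have expectation 0 by induction, and p_n enters with coefficient 1.\<close>

lemma expect_path_poly: "expect (pp n) = (if n = 0 then 1 else 0)"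
proof (induction n rule: less_induct)
  case (less n)
  show ?case
  proof (cases "n = 0")
    case True
    then show ?thesis using expect_monom[of 0] by (simp add: one_poly_def monom_0 pCons_one)
  next
    case False
    have "descent_sum g v n 0 = expect (\<Sum>k\<le>n. smult (descent_sum g v n k) (pp k))"
      using expect_monom[of n] monom_eq_path_polys[of n g v, where 'a = real] by simp
    also have "\<dots> = (\<Sum>k\<le>n. descent_sum g v n k * expect (pp k))"
      by (simp add: expect_sum expect_smult)
    also have "\<dots> = (\<Sum>k<n. descent_sum g v n k * (if k = 0 then 1 else 0)) + expect (pp n)"
      using less.IH by (simp add: descent_sum_diag flip: lessThan_Suc_atMost)
    also have "(\<Sum>k<n. descent_sum g v n k * (if k = 0 then 1 else 0)) = descent_sum g v n 0"
      using False by (simp add: if_distrib[of "\<lambda>x. _ * x"] cong: if_cong)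
    finally show ?thesis using False by simp
  qed
qed

definition gram :: "nat \<Rightarrow> nat \<Rightarrow> real" where
  "gram a b = expect (pp a * pp b)"

lemma gram_0: "gram 0 b = (if b = 0 then 1 else 0)"
  by (simp add: gram_def expect_path_poly)

lemma gram_X:
  "expect ([:0, 1:] * pp a * pp b) = gram (Suc a) b + g * real a * gram a b
     + (\<Sum>i\<in>{1..a}. v i * gram (a - i) b)"
proof -
  have "[:0, 1:] * pp a * pp b = pp (Suc a) * pp b + smult (g * real a) (pp a * pp b)
      + (\<Sum>i\<in>{1..a}. smult (v i) (pp (a - i) * pp b))"
    by (simp add: path_poly.simps(2) algebra_simps sum_distrib_left sum_distrib_right)
  then show ?thesis by (simp add: gram_def expect_add expect_smult expect_sum)
qed

text \<open>Inside the integral x may multiply either factor, and the two expansions of the same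
  expectation are compared. The first index falls at the cost of raising the second by one.\<close>

lemma gram_step:
  "gram (Suc a) b = gram a (Suc b) + g * (real b - real a) * gram a b
     + (\<Sum>i\<in>{1..b}. v i * gram a (b - i)) - (\<Sum>i\<in>{1..a}. v i * gram (a - i) b)"
proof -
  have comm: "gram a b = gram b a" for a b by (simp add: gram_def mult.commute)
  have "[:0, 1:] * pp a * pp b = [:0, 1:] * pp b * pp a" by (simp add: mult_ac)
  then show ?thesis using gram_X[of a b] gram_X[of b a] by (simp add: comm[of _ a] algebra_simps)
qed

text \<open>Every entry on the right of \<open>gram_step\<close> has first index at most a and index
  sum at most a + b + 1, so a single bound T covers them all. The coefficients then add up to at
  most (g + 1) (a + b + 1). The exponent depends on the first index only, which gives order n!
  rather than (n!)^2 on the diagonal.\<close>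

lemma abs_gram_le: "\<bar>gram a b\<bar> \<le> (g + 1) ^ a * (real a + real b) ^ a"
proof (induction a arbitrary: b rule: less_induct)
  case (less a')
  show ?case
  proof (cases a')
    case 0
    then show ?thesis by (simp add: gram_0)
  next
    case (Suc a)
    define T where "T = (g + 1) ^ a * (real a + real b + 1) ^ a"
    have T: "T \<ge> 0" using g by (simp add: T_def)
    have mono: "(g + 1) ^ c * (real c + real d) ^ c \<le> T" if "c \<le> a" "c + d \<le> a + b + 1" for c d
    proof -
      have "(real c + real d) ^ c \<le> (real a + real b + 1) ^ c"
        using that by (intro power_mono) (auto simp flip: of_nat_add)
      also have "\<dots> \<le> (real a + real b + 1) ^ a"
        using that by (intro power_increasing) auto
      finally show ?thesis
        unfolding T_def using that g by (intro mult_mono power_increasing) auto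
    qed
    have IH: "\<bar>gram c d\<bar> \<le> T" if "c \<le> a" "c + d \<le> a + b + 1" for c d
      using less.IH[of c d] mono[OF that] Suc that by auto
    have sum_le: "\<bar>\<Sum>i\<in>{1..n}. v i * f i\<bar> \<le> real n * T" if "\<And>i. i \<in> {1..n} \<Longrightarrow> \<bar>f i\<bar> \<le> T" for f n
    proof -
      have "\<bar>\<Sum>i\<in>{1..n}. v i * f i\<bar> \<le> (\<Sum>i\<in>{1..n}. \<bar>v i * f i\<bar>)" by (rule sum_abs)
      also have "\<dots> \<le> (\<Sum>i\<in>{1..n}. 1 * T)"
        unfolding abs_mult using that v_nonneg v_le T by (intro sum_mono mult_mono) auto
      finally show ?thesis by simp
    qed
    have 1: "\<bar>gram a (Suc b)\<bar> \<le> T" by (rule IH) auto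
    have 2: "\<bar>g * (real b - real a) * gram a b\<bar> \<le> g * (real a + real b) * T"
      unfolding abs_mult using g IH[of a b] by (intro mult_mono) auto
    have 3: "\<bar>\<Sum>i\<in>{1..b}. v i * gram a (b - i)\<bar> \<le> real b * T" by (intro sum_le IH) auto
    have 4: "\<bar>\<Sum>i\<in>{1..a}. v i * gram (a - i) b\<bar> \<le> real a * T" by (intro sum_le IH) auto
    have "\<bar>gram (Suc a) b\<bar> \<le> T + g * (real a + real b) * T + real b * T + real a * T"
      unfolding gram_step using 1 2 3 4 by linarith
    also have "\<dots> \<le> (g + 1) * (real a + real b + 1) * T"
      using T g by (simp add: algebra_simps)
    also have "\<dots> = (g + 1) ^ Suc a * (real (Suc a) + real b) ^ Suc a"
      by (simp add: T_def algebra_simps)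
    finally show ?thesis unfolding Suc .
  qed
qed

lemma expect_square_le: "expect ((pp n)\<^sup>2) \<le> (g + 1) ^ n * (2 * real n) ^ n"
  using abs_gram_le[of n n] by (simp add: gram_def power2_eq_square)

text \<open>By x^n \<le> n! e^x the second moments are at most of order C^n n!. Against the square
  of the factorial in the denominator, an exponential series in B remains.\<close>

lemma summable_second_moments:
  "summable (\<lambda>n. expect ((pp (Suc n))\<^sup>2) * (A ^ n / fact n)\<^sup>2)"
proof (rule summable_comparison_test)
  define B where "B = 2 * (g + 1) * exp 2 * A\<^sup>2"
  have "norm (expect ((pp (Suc n))\<^sup>2) * (A ^ n / fact n)\<^sup>2) \<le> (g + 1) * exp 2 * (B ^ n /\<^sub>R fact n)" for n
  proof -
    have 0: "expect ((pp (Suc n))\<^sup>2) \<ge> 0" unfolding expect_def by (intro integral_nonneg_AE) auto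
    have "expect ((pp (Suc n))\<^sup>2) \<le> (g + 1) ^ Suc n * (2 * real (Suc n)) ^ Suc n"
      by (rule expect_square_le)
    also have "\<dots> \<le> (g + 1) ^ Suc n * (fact (Suc n) * exp (2 * real (Suc n)))"
      using g by (intro mult_left_mono power_le_fact_exp) auto
    also have "\<dots> \<le> (g + 1) ^ Suc n * (2 ^ n * fact n * exp (2 * real (Suc n)))"
    proof -
      have "Suc n \<le> 2 ^ n" by (induction n) auto
      then have "real (Suc n) \<le> 2 ^ n" using of_nat_mono[of "Suc n" "2 ^ n", where 'a = real] by simp
      then have "fact (Suc n) \<le> (2 ^ n * fact n :: real)"
        by (simp only: fact_Suc) (intro mult_right_mono, auto)
      then show ?thesis using g by (intro mult_left_mono mult_right_mono) auto
    qed
    finally have "expect ((pp (Suc n))\<^sup>2) * (A ^ n / fact n)\<^sup>2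
        \<le> (g + 1) ^ Suc n * (2 ^ n * fact n * exp (2 * real (Suc n))) * (A ^ n / fact n)\<^sup>2"
      by (intro mult_right_mono) auto
    also have "\<dots> = (g + 1) * exp 2 * (B ^ n /\<^sub>R fact n)"
    proof -
      have alg: "(G * P1) * (P * F * (e * E)) * (a / F\<^sup>2) = G * e * ((P * P1 * E * a) / F)"
        if "F \<noteq> 0" for G P1 P F e E a :: real
        using that by (simp add: power2_eq_square)
      have e: "exp (2 * real (Suc n)) = exp 2 * exp 2 ^ n"
        using exp_of_nat_mult[of "Suc n" "2::real"] by (simp only: power_Suc mult.commute)
      have a: "(A ^ n / fact n)\<^sup>2 = (A\<^sup>2) ^ n / (fact n)\<^sup>2"
        by (simp add: power_divide flip: power_mult) (simp add: mult.commute)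
      show ?thesis
        unfolding e a power_Suc[of "g + 1"] B_def power_mult_distrib
        by (subst alg) (simp_all add: divide_inverse mult.commute)
    qed
    finally show ?thesis using 0 by simp
  qed
  then show "\<exists>N. \<forall>n\<ge>N. norm (expect ((pp (Suc n))\<^sup>2) * (A ^ n / fact n)\<^sup>2)
      \<le> (g + 1) * exp 2 * (B ^ n /\<^sub>R fact n)" by blast
  show "summable (\<lambda>n. (g + 1) * exp 2 * (B ^ n /\<^sub>R fact n))"
    by (intro summable_mult summable_exp_generic)
qed

text \<open>
  The second moments of the \<open>p\<^sub>n\<close> grow only like \<open>n!\<close>, whereas \<open>p\<^sub>n\<^sup>2\<close> itself grows like \<open>(n!)\<^sup>2\<close> outside of
  a discrete set.
\<close>

lemma AE_path_poly_small:
  "AE x in M. \<forall>A::nat. (\<lambda>n. poly (pp (Suc n)) x * real A ^ n / fact n) \<longlonglongrightarrow> 0"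
  \<comment> \<open>Natural numbers A give only countably many exceptional null sets; later A has to
    exceed a bound that depends on x.\<close>
  unfolding AE_all_countable
proof
  fix A :: nat
  let ?f = "\<lambda>n x. (poly (pp (Suc n)) x * real A ^ n / fact n)\<^sup>2"
  have [measurable]: "poly q \<in> borel_measurable M" for q :: "real poly"
    using integrable_poly by (rule borel_measurable_integrable)
  have int: "(\<integral>\<^sup>+x. ennreal (?f n x) \<partial>M) = ennreal (expect ((pp (Suc n))\<^sup>2) * (real A ^ n / fact n)\<^sup>2)" for n
  proof -
    have eq: "?f n x = poly ((pp (Suc n))\<^sup>2) x * (real A ^ n / fact n)\<^sup>2" for x
      by (simp add: power_mult_distrib power_divide)
    have "(\<integral>\<^sup>+x. ennreal (?f n x) \<partial>M) = ennreal (LINT x|M. ?f n x)"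
      unfolding eq
      by (intro nn_integral_eq_integral integrable_mult_left integrable_poly) (auto intro!: AE_I2)
    then show ?thesis unfolding eq expect_def by (simp del: poly_power)
  qed
  have "(\<integral>\<^sup>+x. (suminf (\<lambda>n. ennreal (?f n x))) \<partial>M)
      = (suminf (\<lambda>n. ennreal (expect ((pp (Suc n))\<^sup>2) * (real A ^ n / fact n)\<^sup>2)))"
    by (subst nn_integral_suminf) (auto simp: int)
  also have "\<dots> \<noteq> \<infinity>"
    unfolding infinity_ennreal_def
    by (intro ennreal_suminf_neq_top[OF summable_second_moments])
      (auto simp: expect_def intro!: mult_nonneg_nonneg integral_nonneg_AE)
  finally have "AE x in M. (suminf (\<lambda>n. ennreal (?f n x))) \<noteq> \<infinity>"
    by (intro nn_integral_PInf_AE) auto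
  then show "AE x in M. (\<lambda>n. poly (pp (Suc n)) x * real A ^ n / fact n) \<longlonglongrightarrow> 0"
  proof eventually_elim
    case (elim x)
    then have "summable (\<lambda>n. ?f n x)"
      by (intro summable_suminf_not_top) auto
    then have "(\<lambda>n. ?f n x) \<longlonglongrightarrow> 0" by (rule summable_LIMSEQ_zero)
    then have "(\<lambda>n. sqrt (?f n x)) \<longlonglongrightarrow> sqrt 0" by (intro tendsto_real_sqrt)
    then have "(\<lambda>n. \<bar>poly (pp (Suc n)) x * real A ^ n / fact n\<bar>) \<longlonglongrightarrow> 0"
      by (simp only: real_sqrt_abs real_sqrt_zero)
    then show ?case by (rule tendsto_rabs_zero_cancel)
  qed
qed

end

section \<open>The limiting entire function\<close>

text \<open>A discrete Gronwall argument. The increment may depend on all earlier terms, but only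
  through their common bound B. The product of the factors 1 + \<epsilon> n is at most
  \<open>exp (suminf \<epsilon>)\<close>, which bounds all terms; the increments are then dominated
  by a convergent series.\<close>

lemma uniform_limit_of_recursive_bound:
  fixes b :: "nat \<Rightarrow> 'a \<Rightarrow> 'b::banach"
  assumes \<epsilon>: "summable \<epsilon>" "\<And>n. \<epsilon> n \<ge> 0"
    and b0: "\<And>u. u \<in> S \<Longrightarrow> norm (b 0 u) \<le> B0" "B0 \<ge> 0"
    and step: "\<And>n u B. u \<in> S \<Longrightarrow> (\<And>k. k \<le> n \<Longrightarrow> norm (b k u) \<le> B) \<Longrightarrow>
      norm (b (Suc n) u - b n u) \<le> \<epsilon> n * B"
  shows "\<exists>l. uniform_limit S b l sequentially"
proof -
  define T where "T n = (\<Sum>j<n. \<epsilon> j)" for n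
  have T_mono: "T k \<le> T n" if "k \<le> n" for k n
    unfolding T_def using that \<epsilon>(2) by (intro sum_mono2) auto
  have bound: "norm (b n u) \<le> B0 * exp (T n)" if u: "u \<in> S" for u n
  proof (induction n rule: less_induct)
    case (less n)
    show ?case
    proof (cases n)
      case 0
      then show ?thesis using b0(1)[OF u] by (simp add: T_def)
    next
      case (Suc m)
      have le: "norm (b k u) \<le> B0 * exp (T m)" if "k \<le> m" for k
        using less.IH[of k] that T_mono[OF that] b0(2) Suc
        by (meson dual_order.trans exp_le_cancel_iff le_imp_less_Suc mult_left_mono)
      have "norm (b (Suc m) u) \<le> norm (b m u) + norm (b (Suc m) u - b m u)"
        by (metis add.commute norm_triangle_sub)
      also have "\<dots> \<le> B0 * exp (T m) + \<epsilon> m * (B0 * exp (T m))"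
        using le[of m] step[OF u le] by (intro add_mono) auto
      also have "\<dots> = B0 * exp (T m) * (1 + \<epsilon> m)" by (simp add: algebra_simps)
      also have "\<dots> \<le> B0 * exp (T m) * exp (\<epsilon> m)"
        using b0(2) by (intro mult_left_mono) auto
      also have "\<dots> = B0 * exp (T n)" by (simp add: Suc T_def exp_add)
      finally show ?thesis by (simp add: Suc)
    qed
  qed
  define K where "K = B0 * exp (suminf \<epsilon>)"
  have bound': "norm (b n u) \<le> K" if "u \<in> S" for u n
  proof -
    have "T n \<le> suminf \<epsilon>" unfolding T_def using \<epsilon> by (intro sum_le_suminf) auto
    then show ?thesis using bound[OF that, of n] b0(2) unfolding K_def
      by (meson dual_order.trans exp_le_cancel_iff mult_left_mono)
  qed
  have "uniform_limit S (\<lambda>n u. \<Sum>i<n. b (Suc i) u - b i u) (\<lambda>u. (suminf (\<lambda>i. b (Suc i) u - b i u))) sequentially"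
  proof (rule Weierstrass_m_test)
    show "norm (b (Suc n) u - b n u) \<le> \<epsilon> n * K" if "u \<in> S" for n u
      using step[OF that bound'[OF that]] .
    show "summable (\<lambda>n. \<epsilon> n * K)" using \<epsilon>(1) by (rule summable_mult2)
  qed
  then have "uniform_limit S (\<lambda>n u. b 0 u + (\<Sum>i<n. b (Suc i) u - b i u))
      (\<lambda>u. b 0 u + (suminf (\<lambda>i. b (Suc i) u - b i u))) sequentially"
    by (intro uniform_limit_intros)
  moreover have "b 0 u + (\<Sum>i<n. b (Suc i) u - b i u) = b n u" for n u
    using sum_lessThan_telescope[of "\<lambda>n. b n u" n] by simp
  ultimately show ?thesis by auto
qed

text \<open>The term of first order in z cancels: the derivative - w exp w has modulus at most |z|
  exp |z| on the ball, and the mean value estimate adds another factor |z|. The square makes the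
  errors at z = u / (g n) summable.\<close>

lemma norm_weierstrass_factor_le: "norm ((1 - z) * exp z - 1) \<le> (norm z)\<^sup>2 * exp (norm z)" for z :: complex
proof -
  let ?B = "norm z * exp (norm z)"
  have "norm ((1 - z) * exp z - (1 - 0) * exp 0) \<le> ?B * norm (z - 0)"
  proof (rule field_differentiable_bound[where S = "cball 0 (norm z)" and f' = "\<lambda>w. - w * exp w"])
    fix w :: complex assume w: "w \<in> cball 0 (norm z)"
    show "((\<lambda>z. (1 - z) * exp z) has_field_derivative - w * exp w) (at w within cball 0 (norm z))"
      by (auto intro!: derivative_eq_intros simp: algebra_simps)
    have "Re w \<le> norm z" using w complex_Re_le_cmod[of w] by simp
    then show "norm (- w * exp w) \<le> ?B" using w by (auto simp: norm_mult intro!: mult_mono)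
  qed auto
  then show ?thesis by (simp add: power2_eq_square mult_ac)
qed

lemma fact_mult_fact_le: "fact a * fact b \<le> (fact (a + b) :: real)"
proof (induction a)
  case (Suc a)
  have "fact (Suc a) * fact b = (real (Suc a)) * (fact a * fact b :: real)" by simp
  also have "\<dots> \<le> real (Suc (a + b)) * fact (a + b)"
    using Suc by (intro mult_mono) auto
  finally show ?case by simp
qed simp

lemma summable_power_fact_shift: "summable (\<lambda>i. C ^ i / fact (i - 2) :: real)"
proof -
  have "summable (\<lambda>i. C\<^sup>2 * (C ^ i /\<^sub>R fact i))" by (intro summable_mult summable_exp_generic)
  then have "summable (\<lambda>i. C ^ (i + 2) / fact (i + 2 - 2) :: real)"
    by (simp add: field_simps power2_eq_square)
  then show ?thesis by (subst (asm) summable_iff_shift)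
qed

lemma summable_divide_squares: "summable (\<lambda>n. c / (real n)\<^sup>2)"
  using summable_mult[OF inverse_power_summable[of 2, where 'a = real], of c] by (simp add: divide_inverse)

context path_measure
begin

abbreviation "cpp \<equiv> path_poly g v :: nat \<Rightarrow> complex poly"

text \<open>
  The exponential factors are those of a Weierstrass product: with them, consecutive normed
  polynomials differ by a relative error \<open>O(1/n\<^sup>2)\<close>.
\<close>

definition norming :: "nat \<Rightarrow> complex \<Rightarrow> complex" where
  "norming n u = (\<Prod>k\<in>{1..<n}. - of_real (g * real k) * exp (- u / of_real (g * real k)))"

definition normed_poly :: "nat \<Rightarrow> complex \<Rightarrow> complex" where
  "normed_poly n u = poly (cpp n) u / norming n u"

lemma norming_nonzero: "norming n u \<noteq> 0"
  using g by (auto simp: norming_def)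

lemma norming_Suc:
  "n \<ge> 1 \<Longrightarrow> norming (Suc n) u = norming n u * (- of_real (g * real n) * exp (- u / of_real (g * real n)))"
  by (simp add: norming_def)

lemma norming_0_1: "norming 0 u = 1" "norming (Suc 0) u = 1"
  by (simp_all add: norming_def)

text \<open>For |u| \<le> R the factor of index k in \<open>norming\<close> has modulus at least k
  divided by this constant. The maximum with 1 makes its powers increase with the exponent.\<close>

definition ratio_const :: "real \<Rightarrow> real" where
  "ratio_const R = max 1 (exp (R / g) / g)"

text \<open>The truncated subtractions are deliberate: \<open>norming\<close> equals 1 at both 0 and
  1, and so does \<open>fact (m - 1)\<close>.\<close>

lemma norming_ratio_le:
  assumes u: "norm u \<le> R" and mn: "m \<le> n"
  shows "norm (norming m u) / norm (norming n u) \<le> ratio_const R ^ (n - m) * fact (m - 1) / fact (n - 1)"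
  using mn
proof (induction n rule: dec_induct)
  case base
  then show ?case using norming_nonzero by simp
next
  case (step n)
  have C: "ratio_const R \<ge> 1" "exp (R / g) / g \<le> ratio_const R" by (simp_all add: ratio_const_def)
  show ?case
  proof (cases "n = 0")
    case True
    then show ?thesis using step C by (simp add: norming_0_1)
  next
    case False
    have R: "0 \<le> R" using u norm_ge_zero order_trans by blast
    let ?d = "norm (- of_real (g * real n) * exp (- u / of_real (g * real n)) :: complex)"
    have "Re u \<le> R" using u complex_Re_le_cmod[of u] by linarith
    then have "Re u / (g * real n) \<le> R / (g * 1)"
      using R False g by (intro frac_le mult_left_mono) auto
    then have le: "exp (Re u / (g * real n)) \<le> exp (R / g)" by simp
    have d_eq: "?d = g * real n * exp (- (Re u / (g * real n)))"
      using g by (simp add: norm_mult Re_divide_of_real del: of_real_mult)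
    have "1 / ?d = exp (Re u / (g * real n)) / (g * real n)"
      unfolding d_eq by (simp add: exp_minus divide_inverse)
    also have "\<dots> \<le> exp (R / g) / (g * real n)"
      using le g by (intro divide_right_mono) auto
    also have "\<dots> \<le> ratio_const R / real n"
      using C(2) False by (simp add: field_simps)
    finally have d: "1 / ?d \<le> ratio_const R / real n" .
    have "norm (norming m u) / norm (norming (Suc n) u) = norm (norming m u) / norm (norming n u) * (1 / ?d)"
      using False by (simp add: norming_Suc norm_mult)
    also have "\<dots> \<le> (ratio_const R ^ (n - m) * fact (m - 1) / fact (n - 1)) * (ratio_const R / real n)"
      using step.IH d C by (intro mult_mono) auto
    also have "\<dots> = ratio_const R ^ (Suc n - m) * fact (m - 1) / fact (Suc n - 1)"
      using step.hyps False by (cases n) (auto simp: Suc_diff_le mult_ac)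
    finally show ?thesis .
  qed
qed

lemma normed_poly_0_1: "normed_poly 0 u = 1" "normed_poly (Suc 0) u = u"
  by (simp_all add: normed_poly_def norming_0_1 poly_path_poly_Suc)

text \<open>Dividing u - g n by the new factor of \<open>norming\<close> gives (1 - z) exp z with z
  = u / (g n). Its distance from 1 is the first error term; the lower polynomials of the recursion
  form the second.\<close>

lemma normed_poly_step:
  assumes n: "n \<ge> 1"
  defines "z u \<equiv> u / of_real (g * real n)"
  shows "normed_poly (Suc n) u - normed_poly n u =
    ((1 - z u) * exp (z u) - 1) * normed_poly n u +
    exp (z u) / of_real (g * real n) * (\<Sum>i\<in>{1..n}. of_real (v i) * poly (cpp (n - i)) u / norming n u)"
proof -
  let ?c = "of_real (g * real n) :: complex"
  have c: "?c \<noteq> 0" using g n by simp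
  have N: "norming n u \<noteq> 0" by (rule norming_nonzero)
  define S where "S = (\<Sum>i\<in>{1..n}. of_real (v i) * poly (cpp (n - i)) u)"
  have "normed_poly (Suc n) u = ((u - ?c) * poly (cpp n) u - S) / (norming n u * (- ?c * exp (- z u)))"
    using n by (simp add: normed_poly_def poly_path_poly_Suc norming_Suc S_def z_def)
  also have "\<dots> = (1 - z u) * exp (z u) * normed_poly n u + exp (z u) / ?c * (S / norming n u)"
    using c N by (simp add: normed_poly_def exp_minus z_def field_simps)
  finally show ?thesis by (simp add: S_def sum_divide_distrib algebra_simps)
qed

lemma normed_poly_step_le:
  assumes n: "n \<ge> 1" and u: "norm u \<le> R"
  shows "norm (normed_poly (Suc n) u - normed_poly n u) \<le>
    (R / g)\<^sup>2 * exp (R / g) / (real n)\<^sup>2 * norm (normed_poly n u) +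
    exp (R / g) / (g * real n) * (\<Sum>i\<in>{1..n}. norm (poly (cpp (n - i)) u) / norm (norming n u))"
proof -
  let ?z = "u / of_real (g * real n)"
  have R: "0 \<le> R" using u norm_ge_zero order_trans by blast
  have z: "norm ?z \<le> R / g / real n"
    using u g n by (simp add: norm_divide norm_mult divide_right_mono field_simps)
  also have "\<dots> \<le> R / g / 1" using R g n by (intro divide_left_mono) auto
  finally have z': "norm ?z \<le> R / g" by simp
  have "norm ((1 - ?z) * exp ?z - 1) \<le> (norm ?z)\<^sup>2 * exp (norm ?z)" by (rule norm_weierstrass_factor_le)
  also have "\<dots> \<le> (R / g / real n)\<^sup>2 * exp (R / g)"
    using z z' by (intro mult_mono power_mono) auto
  finally have 1: "norm ((1 - ?z) * exp ?z - 1) \<le> (R / g)\<^sup>2 * exp (R / g) / (real n)\<^sup>2"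
    by (simp add: power_divide power_mult_distrib)
  have "norm (exp ?z) \<le> exp (R / g)"
    using z' norm_exp[of ?z] by (meson dual_order.trans exp_le_cancel_iff)
  then have 2: "norm (exp ?z / of_real (g * real n)) \<le> exp (R / g) / (g * real n)"
    using g n by (simp add: norm_divide norm_mult divide_right_mono)
  have 3: "norm (\<Sum>i\<in>{1..n}. of_real (v i) * poly (cpp (n - i)) u / norming n u)
      \<le> (\<Sum>i\<in>{1..n}. norm (poly (cpp (n - i)) u) / norm (norming n u))"
  proof (rule sum_norm_le)
    fix i assume "i \<in> {1..n}"
    then have "\<bar>v i\<bar> * norm (poly (cpp (n - i)) u) \<le> 1 * norm (poly (cpp (n - i)) u)"
      using v_le[of i] v_nonneg[of i] by (intro mult_right_mono) auto
    then show "norm (of_real (v i) * poly (cpp (n - i)) u / norming n u)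
        \<le> norm (poly (cpp (n - i)) u) / norm (norming n u)"
      by (simp add: norm_divide norm_mult divide_right_mono)
  qed
  show ?thesis
    unfolding normed_poly_step[OF n]
  proof (intro order_trans[OF norm_triangle_ineq] add_mono)
    show "norm (((1 - ?z) * exp ?z - 1) * normed_poly n u)
        \<le> (R / g)\<^sup>2 * exp (R / g) / (real n)\<^sup>2 * norm (normed_poly n u)"
      unfolding norm_mult using 1 by (intro mult_right_mono) auto
    show "norm (exp ?z / of_real (g * real n) *
          (\<Sum>i\<in>{1..n}. of_real (v i) * poly (cpp (n - i)) u / norming n u))
        \<le> exp (R / g) / (g * real n) * (\<Sum>i\<in>{1..n}. norm (poly (cpp (n - i)) u) / norm (norming n u))"
      unfolding norm_mult[of "exp ?z / _"] using 2 3 g by (intro mult_mono) auto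
  qed
qed

text \<open>The gain is one factor 1 / n. With the factor 1 / (g n) in front of the sum in
  \<open>normed_poly_step_le\<close>, the lower polynomials then contribute O(1 / n^2). The shift in
  \<open>fact (i - 2)\<close> keeps this factor free; for i = 1 and n \<ge> 2 the estimate is (n -
  2)! / (n - 1)! = 1 / (n - 1) \<le> 2 / n.\<close>

lemma sum_norming_ratio_le:
  assumes u: "norm u \<le> R" and n: "n \<ge> 1"
  shows "(\<Sum>i\<in>{1..n}. norm (norming (n - i) u) / norm (norming n u))
    \<le> 2 / real n * (suminf (\<lambda>i. ratio_const R ^ i / fact (i - 2)))"
proof -
  let ?C = "ratio_const R"
  have C: "?C \<ge> 1" by (simp add: ratio_const_def)
  have "norm (norming (n - i) u) / norm (norming n u) \<le> 2 / real n * (?C ^ i / fact (i - 2))"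
    if i: "i \<in> {1..n}" for i
  proof -
    have "fact (n - i - 1) * fact (i - 2) * real n \<le> (2 * fact (n - 1) :: real)"
    proof (cases "n = 1")
      case False
      have "fact (n - i - 1) * fact (i - 2) \<le> (fact (n - i - 1 + (i - 2)) :: real)"
        by (rule fact_mult_fact_le)
      also have "\<dots> \<le> fact (n - 2)" using i False by (intro fact_mono) auto
      finally have "fact (n - i - 1) * fact (i - 2) * real n \<le> fact (n - 2) * (2 * real (n - 1))"
        using False n by (intro mult_mono) auto
      also have "\<dots> = 2 * fact (n - 1)"
      proof -
        obtain m where "n = Suc (Suc m)" using False n by (metis One_nat_def Suc_le_D le_SucE not0_implies_Suc)
        then show ?thesis by (simp add: algebra_simps)
      qed
      finally show ?thesis .
    qed (use i in simp)
    then have "fact (n - i - 1) / fact (n - 1) \<le> 2 / real n * (1 / (fact (i - 2) :: real))"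
      using n by (simp add: field_simps)
    then have "?C ^ i * (fact (n - i - 1) / fact (n - 1)) \<le> ?C ^ i * (2 / real n * (1 / fact (i - 2)))"
      using C by (intro mult_left_mono) auto
    then show ?thesis
      using norming_ratio_le[OF u, of "n - i" n] i by (simp add: mult_ac)
  qed
  then have "(\<Sum>i\<in>{1..n}. norm (norming (n - i) u) / norm (norming n u))
      \<le> (\<Sum>i\<in>{1..n}. 2 / real n * (?C ^ i / fact (i - 2)))" by (rule sum_mono)
  also have "\<dots> = 2 / real n * (\<Sum>i\<in>{1..n}. ?C ^ i / fact (i - 2))"
    by (simp add: sum_distrib_left)
  also have "\<dots> \<le> 2 / real n * (suminf (\<lambda>i. ?C ^ i / fact (i - 2)))"
    using C by (intro mult_left_mono sum_le_suminf summable_power_fact_shift) auto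
  finally show ?thesis .
qed

lemma normed_poly_uniform_limit: "\<exists>l. uniform_limit (cball 0 R) normed_poly l sequentially"
proof (cases "R \<ge> 0")
  case R: True
  define E where "E = (suminf (\<lambda>i. ratio_const R ^ i / fact (i - 2)))"
  define c where "c = (R / g)\<^sup>2 * exp (R / g) + exp (R / g) / g * (2 * E)"
  \<comment> \<open>At n = 0 the increment is u - 1, of modulus at most R + 1. From n = 1 on, c
    collects the constants of the Weierstrass error and of the lower polynomials.\<close>
  define \<epsilon> where "\<epsilon> n = (if n = 0 then R + 1 else c / (real n)\<^sup>2)" for n
  have E: "E \<ge> 0"
    unfolding E_def ratio_const_def by (intro suminf_nonneg summable_power_fact_shift) auto
  show ?thesis
  proof (rule uniform_limit_of_recursive_bound[where \<epsilon> = \<epsilon> and ?B0.0 = 1])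
    have "summable (\<lambda>n. \<epsilon> (Suc n))"
      using summable_divide_squares[of c] by (subst (asm) summable_Suc_iff[symmetric]) (simp add: \<epsilon>_def)
    then show "summable \<epsilon>" by (simp add: summable_Suc_iff)
    show "\<epsilon> n \<ge> 0" for n using R E g by (auto simp: \<epsilon>_def c_def)
    show "norm (normed_poly 0 u) \<le> 1" for u by (simp add: normed_poly_0_1)
    fix n u B assume u': "u \<in> cball 0 R" and B: "\<And>k. k \<le> n \<Longrightarrow> norm (normed_poly k u) \<le> B"
    have u: "norm u \<le> R" using u' by simp
    have "B \<ge> 1" using B[of 0] by (simp add: normed_poly_0_1)
    show "norm (normed_poly (Suc n) u - normed_poly n u) \<le> \<epsilon> n * B"
    proof (cases "n = 0")
      case True
      have "norm (u - 1) \<le> R + 1" using u norm_triangle_ineq4[of u 1] by simp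
      also have "\<dots> \<le> (R + 1) * B" using R \<open>B \<ge> 1\<close> by (simp add: mult_le_cancel_left1)
      finally show ?thesis using True by (simp add: normed_poly_0_1 \<epsilon>_def)
    next
      case False
      then have n: "n \<ge> 1" by simp
      have "(\<Sum>i\<in>{1..n}. norm (poly (cpp (n - i)) u) / norm (norming n u))
          \<le> (\<Sum>i\<in>{1..n}. B * (norm (norming (n - i) u) / norm (norming n u)))"
      proof (rule sum_mono)
        fix i
        have "norm (poly (cpp (n - i)) u) = norm (normed_poly (n - i) u) * norm (norming (n - i) u)"
          using norming_nonzero by (simp add: normed_poly_def norm_divide)
        also have "\<dots> \<le> B * norm (norming (n - i) u)" by (intro mult_right_mono B) auto
        finally show "norm (poly (cpp (n - i)) u) / norm (norming n u)
            \<le> B * (norm (norming (n - i) u) / norm (norming n u))"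
          by (simp add: divide_right_mono)
      qed
      also have "\<dots> = B * (\<Sum>i\<in>{1..n}. norm (norming (n - i) u) / norm (norming n u))"
        by (simp add: sum_distrib_left)
      also have "\<dots> \<le> B * (2 / real n * E)"
        unfolding E_def using \<open>B \<ge> 1\<close> by (intro mult_left_mono sum_norming_ratio_le u n) auto
      finally have S: "(\<Sum>i\<in>{1..n}. norm (poly (cpp (n - i)) u) / norm (norming n u)) \<le> B * (2 / real n * E)" .
      have "norm (normed_poly (Suc n) u - normed_poly n u) \<le>
          (R / g)\<^sup>2 * exp (R / g) / (real n)\<^sup>2 * B + exp (R / g) / (g * real n) * (B * (2 / real n * E))"
        using S B[of n] g
        by (intro order_trans[OF normed_poly_step_le[OF n u]] add_mono mult_left_mono) auto
      also have "\<dots> = \<epsilon> n * B"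
        using n g by (simp add: \<epsilon>_def c_def power2_eq_square field_simps)
      finally show ?thesis .
    qed
  qed auto
qed auto

text \<open>Defined pointwise, so that the uniform limits on balls of all radii are restrictions of
  one function.\<close>

definition limit_fun :: "complex \<Rightarrow> complex" where
  "limit_fun u = lim (\<lambda>n. normed_poly n u)"

lemma normed_poly_uniform_limit_limit_fun:
  "uniform_limit (cball 0 R) normed_poly limit_fun sequentially"
proof -
  obtain l where l: "uniform_limit (cball 0 R) normed_poly l sequentially"
    using normed_poly_uniform_limit by blast
  have "l u = limit_fun u" if "u \<in> cball 0 R" for u
    unfolding limit_fun_def using tendsto_uniform_limitI[OF l that] by (simp add: limI)
  then show ?thesis using l by (subst (asm) uniform_limit_cong') auto
qed

lemma normed_poly_tendsto: "(\<lambda>n. normed_poly n u) \<longlonglongrightarrow> limit_fun u"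
  by (rule tendsto_uniform_limitI[OF normed_poly_uniform_limit_limit_fun[of "norm u"]]) simp

lemma limit_fun_holomorphic: "limit_fun holomorphic_on UNIV"
proof (rule holomorphic_uniform_sequence)
  show "normed_poly n holomorphic_on UNIV" for n
    unfolding normed_poly_def[abs_def] norming_def[abs_def] using g
    by (intro holomorphic_intros) auto
  fix x :: complex
  have "cball x 1 \<subseteq> cball 0 (norm x + 1)"
    by (auto simp: dist_norm) (metis add.commute add_left_mono dist_norm norm_minus_commute
      norm_triangle_sub order_trans)
  then have "uniform_limit (cball x 1) normed_poly limit_fun sequentially"
    using normed_poly_uniform_limit_limit_fun by (rule uniform_limit_on_subset[rotated])
  then show "\<exists>d>0. cball x d \<subseteq> UNIV \<and> uniform_limit (cball x d) normed_poly limit_fun sequentially"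
    by (intro exI[of _ 1]) auto
qed simp

text \<open>With C = \<open>ratio_const \<bar>x\<bar>\<close> the modulus of
  \<open>norming (Suc n)\<close> at x is at least n! / C^n, so smallness for one natural number A
  \<ge> C makes the normed polynomials tend to 0.\<close>

lemma limit_fun_eq_0:
  assumes "\<forall>A::nat. (\<lambda>n. poly (pp (Suc n)) x * real A ^ n / fact n) \<longlonglongrightarrow> 0"
  shows "limit_fun (of_real x) = 0"
proof -
  define A where "A = nat \<lceil>ratio_const \<bar>x\<bar>\<rceil>"
  have A: "ratio_const \<bar>x\<bar> \<le> real A" unfolding A_def by (rule real_nat_ceiling_ge)
  have C: "ratio_const \<bar>x\<bar> \<ge> 1" by (simp add: ratio_const_def)
  have "(\<lambda>n. normed_poly (Suc n) (of_real x)) \<longlonglongrightarrow> 0"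
  proof (rule Lim_null_comparison)
    show "(\<lambda>n. \<bar>poly (pp (Suc n)) x * real A ^ n / fact n\<bar>) \<longlonglongrightarrow> 0"
      using assms tendsto_rabs_zero by blast
    have "norm (normed_poly (Suc n) (of_real x)) \<le> \<bar>poly (pp (Suc n)) x * real A ^ n / fact n\<bar>" for n
    proof -
      have "1 / norm (norming (Suc n) (of_real x)) \<le> ratio_const \<bar>x\<bar> ^ n / fact n"
        using norming_ratio_le[of "of_real x" "\<bar>x\<bar>" 1 "Suc n"] by (simp add: norming_0_1)
      also have "\<dots> \<le> real A ^ n / fact n"
        using A C by (intro divide_right_mono power_mono) auto
      finally have "\<bar>poly (pp (Suc n)) x\<bar> * (1 / norm (norming (Suc n) (of_real x)))
          \<le> \<bar>poly (pp (Suc n)) x\<bar> * (real A ^ n / fact n)" by (intro mult_left_mono) auto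
      then show ?thesis
        by (simp add: normed_poly_def norm_divide poly_path_poly_of_real abs_mult)
    qed
    then show "\<forall>\<^sub>F n in sequentially. norm (normed_poly (Suc n) (of_real x))
        \<le> \<bar>poly (pp (Suc n)) x * real A ^ n / fact n\<bar>" by simp
  qed
  then show ?thesis
    using normed_poly_tendsto[of "of_real x"] LIMSEQ_unique LIMSEQ_Suc by blast
qed

text \<open>To the left of -4 the factor x - g n is negative, the signs of p_n alternate, and q n is
  the modulus. The doubling property controls the sum in the recursion: as v i \<le> 1, the lower
  terms amount to at most q n times a geometric sum, hence to at most q n. The factor - x - 1 + g n
  that remains is at least 3 and reproduces the doubling.\<close>

lemma abs_path_poly_growth:
  assumes x: "x \<le> -4"
  defines "q n \<equiv> (-1) ^ n * poly (pp n) x"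
  shows "q n > 0 \<and> (\<forall>i\<le>n. q (n - i) * 2 ^ i \<le> q n) \<and> q (Suc n) \<ge> (- x - 1 + g * real n) * q n"
proof -
  have step: "q (Suc n) \<ge> (- x - 1 + g * real n) * q n"
    if q: "q n > 0" "\<And>i. i \<le> n \<Longrightarrow> q (n - i) * 2 ^ i \<le> q n" "\<And>i. i \<le> n \<Longrightarrow> q i > 0" for n
  proof -
    have "q (Suc n) = (- x + g * real n) * q n
        + (\<Sum>i\<in>{1..n}. (-1) ^ n * v i * poly (pp (n - i)) x)"
      unfolding q_def poly_path_poly_Suc by (simp add: algebra_simps sum_distrib_left sum_negf)
    moreover have "\<bar>\<Sum>i\<in>{1..n}. (-1) ^ n * v i * poly (pp (n - i)) x\<bar> \<le> q n"
    proof -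
      have "\<bar>\<Sum>i\<in>{1..n}. (-1) ^ n * v i * poly (pp (n - i)) x\<bar>
          \<le> (\<Sum>i\<in>{1..n}. \<bar>(-1) ^ n * v i * poly (pp (n - i)) x\<bar>)" by (rule sum_abs)
      also have "\<dots> \<le> (\<Sum>i\<in>{1..n}. q n * (1/2) ^ i)"
      proof (rule sum_mono)
        fix i assume i: "i \<in> {1..n}"
        have "\<bar>poly (pp (n - i)) x\<bar> = q (n - i)"
        proof -
          have "\<bar>q (n - i)\<bar> = q (n - i)" using q(3)[of "n - i"] by simp
          then show ?thesis by (simp add: q_def abs_mult power_abs)
        qed
        then have "\<bar>(-1) ^ n * v i * poly (pp (n - i)) x\<bar> = v i * q (n - i)"
          using i v_nonneg[of i] by (simp add: abs_mult power_abs)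
        also have "\<dots> \<le> 1 * q (n - i)"
          using i v_le[of i] q(3)[of "n - i"] by (intro mult_right_mono) auto
        also have "\<dots> \<le> q n * (1/2) ^ i"
          using q(2)[of i] i by (simp add: field_simps power_one_over)
        finally show "\<bar>(-1) ^ n * v i * poly (pp (n - i)) x\<bar> \<le> q n * (1/2) ^ i" .
      qed
      also have "\<dots> = q n * (\<Sum>i\<in>{1..n}. (1/2) ^ i)" by (simp add: sum_distrib_left)
      also have "(\<Sum>i\<in>{1..n}. (1/2) ^ i) = 1 - (1/2 :: real) ^ n"
        by (induction n) (auto simp: field_simps)
      also have "q n * (1 - (1/2) ^ n) \<le> q n * 1"
        using q(1) by (intro mult_left_mono) auto
      finally show ?thesis by simp
    qed
    ultimately show ?thesis by (simp add: algebra_simps)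
  qed
  have "(\<forall>k\<le>n. q k > 0) \<and> (\<forall>i\<le>n. q (n - i) * 2 ^ i \<le> q n)"
  proof (induction n)
    case (Suc n)
    have st: "q (Suc n) \<ge> (- x - 1 + g * real n) * q n" using Suc by (intro step) auto
    moreover have "(- x - 1 + g * real n) * q n \<ge> 2 * q n"
    proof (rule mult_right_mono)
      have "g * real n \<ge> 0" using g by simp
      then show "2 \<le> - x - 1 + g * real n" using x by linarith
    qed (use Suc in \<open>auto intro: less_imp_le\<close>)
    ultimately have 2: "q (Suc n) \<ge> 2 * q n" by linarith
    have "q (Suc n) > 0" using 2 Suc by (smt (verit) order_refl)
    moreover have "q (Suc n - i) * 2 ^ i \<le> q (Suc n)" if "i \<le> Suc n" for i
    proof (cases i)
      case (Suc j)
      then have "q (n - j) * 2 ^ j \<le> q n" using \<open>_ \<and> (\<forall>i\<le>n. q (n - i) * 2 ^ i \<le> q n)\<close> that by auto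
      then show ?thesis using 2 by (simp add: Suc)
    qed simp
    ultimately show ?case using Suc by (auto simp: le_Suc_eq)
  qed (simp add: q_def)
  then show ?thesis using step[of n] by auto
qed

lemma abs_path_poly_eq:
  assumes "x \<le> -4"
  shows "\<bar>poly (pp n) x\<bar> = (-1) ^ n * poly (pp n) x"
proof -
  have "(-1) ^ n * poly (pp n) x > 0" using abs_path_poly_growth[OF assms] by blast
  then have "\<bar>(-1) ^ n * poly (pp n) x\<bar> = (-1) ^ n * poly (pp n) x" by simp
  then show ?thesis by (simp add: abs_mult power_abs)
qed

text \<open>Each step gains a factor of at least g n, so |p_(n+1)| is at least g^n n!; for A \<ge> 1
  / g the sequence never falls below 1 in modulus.\<close>

lemma not_small_left:
  assumes x: "x \<le> -4"
  shows "\<not> (\<forall>A::nat. (\<lambda>n. poly (pp (Suc n)) x * real A ^ n / fact n) \<longlonglongrightarrow> 0)"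
proof
  assume small: "\<forall>A::nat. (\<lambda>n. poly (pp (Suc n)) x * real A ^ n / fact n) \<longlonglongrightarrow> 0"
  define A where "A = nat \<lceil>1 / g\<rceil>"
  have "1 / g \<le> real A" unfolding A_def by (rule real_nat_ceiling_ge)
  then have A: "g * real A \<ge> 1" using g by (simp add: field_simps)
  have big: "\<bar>poly (pp (Suc n)) x\<bar> \<ge> g ^ n * fact n" for n
  proof (induction n)
    case 0
    then show ?case using x by (simp add: poly_path_poly_Suc)
  next
    case (Suc n)
    have "g ^ Suc n * fact (Suc n) = (g * real (Suc n)) * (g ^ n * fact n)" by simp
    also have "\<dots> \<le> (- x - 1 + g * real (Suc n)) * \<bar>poly (pp (Suc n)) x\<bar>"
      using Suc x g by (intro mult_mono) auto
    also have "\<dots> \<le> \<bar>poly (pp (Suc (Suc n))) x\<bar>"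
      using abs_path_poly_growth[OF x, of "Suc n"] by (simp add: abs_path_poly_eq[OF x])
    finally show ?case .
  qed
  have "1 \<le> \<bar>poly (pp (Suc n)) x * real A ^ n / fact n\<bar>" for n
  proof -
    have "1 \<le> (g * real A) ^ n" using A by simp
    also have "\<dots> = (g ^ n * fact n) * real A ^ n / fact n" by (simp add: power_mult_distrib)
    also have "\<dots> \<le> \<bar>poly (pp (Suc n)) x\<bar> * real A ^ n / fact n"
      using big[of n] by (intro divide_right_mono mult_right_mono) auto
    finally show ?thesis by (simp add: abs_mult)
  qed
  moreover have "(\<lambda>n. \<bar>poly (pp (Suc n)) x * real A ^ n / fact n\<bar>) \<longlonglongrightarrow> 0"
    using small tendsto_rabs_zero by blast
  ultimately have "(1::real) \<le> 0" by (intro LIMSEQ_le_const) auto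
  then show False by simp
qed

text \<open>At -4 the increments are small relative to the current term itself, not only to a bound
  on all earlier terms. From N on, the moduli are therefore at least b N times 1 minus the sum of
  the relative errors, and N is chosen to keep that sum below 1/2.\<close>

lemma limit_fun_nonzero: "limit_fun (-4) \<noteq> 0"
proof -
  let ?u = "-4 :: complex"
  define b where "b n = norm (normed_poly n ?u)" for n
  have u: "?u = of_real (-4)" by simp
  have P: "norm (poly (cpp n) ?u) = \<bar>poly (pp n) (-4)\<bar>" for n
    unfolding u poly_path_poly_of_real by simp
  define q where "q n = \<bar>poly (pp n) (-4)\<bar>" for n
  have q: "q n > 0" "i \<le> n \<Longrightarrow> q (n - i) * 2 ^ i \<le> q n" "q (Suc n) \<ge> (3 + g * real n) * q n" for n i
    using abs_path_poly_growth[of "-4" n] by (auto simp: q_def abs_path_poly_eq)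
  have b_pos: "b n > 0" for n
    using q(1)[of n] P[of n] norming_nonzero by (auto simp: b_def normed_poly_def q_def)
  \<comment> \<open>Chosen so that c0 n \<le> 3 + g (n - 1): the step from n - 1 to n multiplies q
    by at least c0 n, and this supplies the second factor 1 / n of the relative error.\<close>
  define c0 where "c0 = min 3 g"
  have c0: "c0 > 0" using g by (simp add: c0_def)
  define c where "c = (4 / g)\<^sup>2 * exp (4 / g) + exp (4 / g) / g * (2 / c0)"
  have step: "norm (normed_poly (Suc n) ?u - normed_poly n ?u) \<le> c / (real n)\<^sup>2 * b n" if n: "n \<ge> 1" for n
  proof -
    have "(\<Sum>i\<in>{1..n}. q (n - i)) \<le> (\<Sum>i\<in>{1..n}. 2 * q (n - 1) * (1/2) ^ i)"
    proof (rule sum_mono)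
      fix i assume i: "i \<in> {1..n}"
      then have "q (n - 1 - (i - 1)) * 2 ^ (i - 1) \<le> q (n - 1)" by (intro q(2)) auto
      moreover have "(2::real) ^ i = 2 * 2 ^ (i - 1)" using i by (cases i) auto
      ultimately show "q (n - i) \<le> 2 * q (n - 1) * (1/2) ^ i"
        using i by (simp add: field_simps power_one_over)
    qed
    also have "\<dots> = 2 * q (n - 1) * (\<Sum>i\<in>{1..n}. (1/2) ^ i)" by (simp add: sum_distrib_left)
    also have "(\<Sum>i\<in>{1..n}. (1/2) ^ i) = 1 - (1/2 :: real) ^ n"
      by (induction n) (auto simp: field_simps)
    also have "2 * q (n - 1) * (1 - (1/2) ^ n) \<le> 2 * q (n - 1) * 1"
      using q(1)[of "n - 1"] by (intro mult_left_mono) auto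
    finally have S: "(\<Sum>i\<in>{1..n}. q (n - i)) \<le> 2 * q (n - 1)" by simp
    have "c0 * real n \<le> 3 + g * real (n - 1)"
    proof -
      have "c0 * real n = c0 + c0 * real (n - 1)" using n by (simp add: of_nat_diff algebra_simps)
      also have "\<dots> \<le> 3 + g * real (n - 1)"
        unfolding c0_def by (intro add_mono mult_right_mono) auto
      finally show ?thesis .
    qed
    then have "c0 * real n * q (n - 1) \<le> (3 + g * real (n - 1)) * q (n - 1)"
      using q(1)[of "n - 1"] by (intro mult_right_mono) auto
    also have "\<dots> \<le> q n" using q(3)[of "n - 1"] n by simp
    finally have "q (n - 1) \<le> q n / (c0 * real n)" using c0 n by (simp add: field_simps)
    then have S': "(\<Sum>i\<in>{1..n}. q (n - i)) \<le> 2 / (c0 * real n) * q n" using S by simp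
    have "(\<Sum>i\<in>{1..n}. norm (poly (cpp (n - i)) ?u) / norm (norming n ?u))
        = (\<Sum>i\<in>{1..n}. q (n - i)) / norm (norming n ?u)"
      by (simp add: P q_def sum_divide_distrib)
    also have "\<dots> \<le> 2 / (c0 * real n) * q n / norm (norming n ?u)"
      using S' by (intro divide_right_mono) auto
    also have "\<dots> = 2 / (c0 * real n) * b n"
      by (simp add: b_def normed_poly_def P q_def norm_divide)
    finally have S'': "(\<Sum>i\<in>{1..n}. norm (poly (cpp (n - i)) ?u) / norm (norming n ?u))
        \<le> 2 / (c0 * real n) * b n" .
    have "norm (normed_poly (Suc n) ?u - normed_poly n ?u) \<le>
        (4 / g)\<^sup>2 * exp (4 / g) / (real n)\<^sup>2 * b n + exp (4 / g) / (g * real n) * (2 / (c0 * real n) * b n)"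
      unfolding b_def using S''[unfolded b_def] g
      by (intro order_trans[OF normed_poly_step_le[OF n, of _ 4]] add_mono mult_left_mono) auto
    also have "\<dots> = c / (real n)\<^sup>2 * b n"
      using n g c0 by (simp add: c_def power2_eq_square field_simps)
    finally show ?thesis .
  qed
  define \<epsilon> where "\<epsilon> n = c / (real n)\<^sup>2" for n
  have c: "c \<ge> 0" using g c0 by (simp add: c_def)
  then have \<epsilon>: "\<epsilon> n \<ge> 0" for n by (simp add: \<epsilon>_def)
  have sum: "summable \<epsilon>" unfolding \<epsilon>_def[abs_def] by (rule summable_divide_squares)
  obtain N0 where N0: "\<And>n. n \<ge> N0 \<Longrightarrow> norm (suminf (\<lambda>i. \<epsilon> (i + n))) < 1/2"
    using suminf_exist_split[OF _ sum, of "1/2"] by auto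
  define N where "N = max 1 N0"
  have N: "N \<ge> 1" "(suminf (\<lambda>i. \<epsilon> (i + N))) < 1/2" using N0[of N] by (auto simp: N_def)
  have part: "(\<Sum>j<k. \<epsilon> (j + N)) \<le> 1/2" for k
  proof -
    have "summable (\<lambda>i. \<epsilon> (i + N))" using sum by (subst summable_iff_shift)
    then have "(\<Sum>j<k. \<epsilon> (j + N)) \<le> (suminf (\<lambda>i. \<epsilon> (i + N)))" using \<epsilon> by (intro sum_le_suminf) auto
    then show ?thesis using N by linarith
  qed
  have low: "b (k + N) \<ge> b N * (1 - (\<Sum>j<k. \<epsilon> (j + N)))" for k
  proof (induction k)
    case (Suc k)
    have e: "\<epsilon> (k + N) \<le> 1"
    proof -
      have "\<epsilon> (k + N) \<le> (\<Sum>j<Suc k. \<epsilon> (j + N))" using \<epsilon> by (intro member_le_sum) auto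
      then show ?thesis using part[of "Suc k"] by linarith
    qed
    have "b (k + N) \<le> b (Suc (k + N)) + norm (normed_poly (Suc (k + N)) ?u - normed_poly (k + N) ?u)"
      unfolding b_def by (metis norm_minus_commute norm_triangle_sub)
    then have "b (Suc (k + N)) \<ge> b (k + N) - \<epsilon> (k + N) * b (k + N)"
      using step[of "k + N"] N by (simp add: \<epsilon>_def)
    then have 1: "b (Suc (k + N)) \<ge> b (k + N) * (1 - \<epsilon> (k + N))" by (simp add: algebra_simps)
    have "b N * (1 - (\<Sum>j<k. \<epsilon> (j + N))) * (1 - \<epsilon> (k + N)) \<le> b (k + N) * (1 - \<epsilon> (k + N))"
      using Suc e by (intro mult_right_mono) auto
    moreover have "b N * (1 - (\<Sum>j<Suc k. \<epsilon> (j + N))) \<le> b N * (1 - (\<Sum>j<k. \<epsilon> (j + N))) * (1 - \<epsilon> (k + N))"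
    proof -
      have "0 \<le> b N * ((\<Sum>j<k. \<epsilon> (j + N)) * \<epsilon> (k + N))"
        using b_pos[of N] \<epsilon> by (intro mult_nonneg_nonneg sum_nonneg) (auto intro: less_imp_le)
      then show ?thesis by (simp add: algebra_simps)
    qed
    ultimately show ?case using 1 by simp
  qed simp
  have "b N / 2 \<le> b (k + N)" for k
  proof -
    have "b N * (1/2) \<le> b N * (1 - (\<Sum>j<k. \<epsilon> (j + N)))"
      using part[of k] b_pos[of N] by (intro mult_left_mono) auto
    then show ?thesis using low[of k] by simp
  qed
  moreover have "(\<lambda>k. b (k + N)) \<longlonglongrightarrow> norm (limit_fun ?u)"
    unfolding b_def by (intro tendsto_norm LIMSEQ_ignore_initial_segment normed_poly_tendsto)
  ultimately have "b N / 2 \<le> norm (limit_fun ?u)" by (intro LIMSEQ_le_const) auto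
  then show ?thesis using b_pos[of N] by auto
qed

lemma concentrated_on_discrete:
  "\<exists>Z. Z \<subseteq> {-4<..} \<and> (\<forall>R. finite (Z \<inter> {..R})) \<and> (AE x in M. x \<in> Z)"
proof (intro exI conjI allI)
  let ?Z = "{x. limit_fun (of_real x) = 0 \<and> x > -4}"
  show "?Z \<subseteq> {-4<..}" by auto
  \<comment> \<open>A constant function would be nonzero everywhere, like its value at -4, but it
    has to vanish almost everywhere for a measure of total mass 1.\<close>
  have nc: "\<not> limit_fun constant_on UNIV"
  proof
    assume "limit_fun constant_on UNIV"
    then have "limit_fun u \<noteq> 0" for u
      using limit_fun_nonzero unfolding constant_on_def by (metis UNIV_I)
    moreover have "AE x in M. limit_fun (of_real x) = 0"
      using AE_path_poly_small by eventually_elim (rule limit_fun_eq_0)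
    ultimately have "AE x in M. False" by simp
    then show False by simp
  qed
  show "finite (?Z \<inter> {..R})" for R
  proof -
    have "finite {z \<in> cball 0 (\<bar>R\<bar> + 4). limit_fun z = 0}"
      by (rule holomorphic_compact_finite_zeros[OF limit_fun_holomorphic]) (auto simp: nc)
    then have "finite (of_real -` {z \<in> cball (0::complex) (\<bar>R\<bar> + 4). limit_fun z = 0})"
      by (rule finite_vimageI) (simp add: inj_of_real)
    then show ?thesis by (rule finite_subset[rotated]) auto
  qed
  show "AE x in M. x \<in> ?Z"
    using AE_path_poly_small
  proof eventually_elim
    case (elim x)
    then show ?case using limit_fun_eq_0[of x] not_small_left[of x] by force
  qed
qed

end

section \<open>The support of the path measure\<close>

text \<open>A point outside the support is null because one of its neighbourhoods is, and Z contains
  only countably many such points.\<close>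

lemma measure_support_outside_null:
  assumes "real_distribution M" "countable Z" "AE x in M. x \<in> Z"
  shows "AE x in M. x \<in> measure_support M"
proof -
  interpret real_distribution M by fact
  have null: "{x} \<in> null_sets M" if x: "x \<notin> measure_support M" for x
  proof -
    obtain U where U: "open U" "x \<in> U" "\<not> emeasure M U > 0"
      using x by (auto simp: measure_support_def)
    have "emeasure M {x} \<le> emeasure M U" using U by (intro emeasure_mono) auto
    then show ?thesis using U by (auto simp: null_sets_def)
  qed
  have "(\<Union>x\<in>Z - measure_support M. {x}) \<in> null_sets M"
    using assms(2) by (intro null_sets_UN') (auto intro: null)
  then have "AE x in M. x \<notin> Z - measure_support M"
    using AE_not_in by fastforce
  with assms(3) show ?thesis by eventually_elim auto
qed

lemma measure_support_subset:
  assumes "real_distribution M" "closed Z" "AE x in M. x \<in> Z"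
  shows "measure_support M \<subseteq> Z"
proof
  fix x assume x: "x \<in> measure_support M"
  interpret real_distribution M by fact
  show "x \<in> Z"
  proof (rule ccontr)
    assume "x \<notin> Z"
    then have "emeasure M (- Z) > 0"
      using x assms(2) by (auto simp: measure_support_def)
    moreover have "emeasure M (- Z) = 0"
    proof -
      have "- Z \<in> null_sets M"
        using assms(2,3) by (subst AE_iff_null_sets) (auto intro: borel_closed)
      then show ?thesis by auto
    qed
    ultimately show False by simp
  qed
qed

lemma closed_if_locally_finite:
  fixes Z :: "real set"
  assumes "\<And>R. finite (Z \<inter> {..R})"
  shows "closed Z"
proof -
  have "\<not> x islimpt Z" for x
  proof
    assume "x islimpt Z"
    then have "infinite ({..<x + 1} \<inter> Z)"
      by (auto simp: islimpt_eq_acc_point dest!: spec[of _ "{..<x + 1}"])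
    moreover have "{..<x + 1} \<inter> Z \<subseteq> Z \<inter> {..x + 1}" by auto
    ultimately show False using assms finite_subset by blast
  qed
  then show ?thesis by (simp add: closed_limpt)
qed

text \<open>Removing the other points of the support leaves an open neighbourhood of x that carries
  only the mass of x.\<close>

lemma measure_support_point_pos:
  assumes "real_distribution M" "\<And>R. finite (measure_support M \<inter> {..R})"
    and AE: "AE x in M. x \<in> measure_support M" and x: "x \<in> measure_support M"
  shows "measure M {x} > 0"
proof -
  interpret real_distribution M by fact
  let ?S = "measure_support M"
  have "closed (?S - {x})"
    by (rule closed_if_locally_finite) (rule finite_subset[OF _ assms(2)], auto)
  then have "emeasure M (- (?S - {x})) > 0"
    using x by (auto simp: measure_support_def)
  also have "emeasure M (- (?S - {x})) = emeasure M {x}"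
  proof (rule emeasure_eq_AE)
    show "AE y in M. y \<in> - (?S - {x}) \<longleftrightarrow> y \<in> {x}" using AE by eventually_elim auto
    have "open (- (?S - {x}))" using \<open>closed (?S - {x})\<close> by (simp only: open_Compl)
    then show "- (?S - {x}) \<in> sets M" by simp
  qed simp
  finally show ?thesis by (simp add: emeasure_eq_measure)
qed

lemma islimpt_ereal_image:
  fixes S :: "real set"
  assumes S: "infinite S" "S \<subseteq> {c<..}" "\<And>R. finite (S \<inter> {..R})"
  shows "{a. a islimpt ereal ` S} = {\<infinity>}"
proof (intro equalityI subsetI)
  fix a assume "a \<in> {a. a islimpt ereal ` S}"
  then have a: "infinite (U \<inter> ereal ` S)" if "a \<in> U" "open U" for U
    using that by (auto simp: islimpt_eq_acc_point)
  show "a \<in> {\<infinity>}"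
  proof (cases a)
    case (real r)
    have "infinite ({..<ereal (r + 1)} \<inter> ereal ` S)" using real by (intro a) auto
    moreover have "{..<ereal (r + 1)} \<inter> ereal ` S \<subseteq> ereal ` (S \<inter> {..r + 1})" by auto
    ultimately show ?thesis using S(3)[of "r + 1"] finite_subset by blast
  next
    case MInf
    have "infinite ({..<ereal c} \<inter> ereal ` S)" using MInf by (intro a) auto
    moreover have "{..<ereal c} \<inter> ereal ` S = {}" using S(2) by auto
    ultimately show ?thesis by simp
  qed simp
next
  fix a :: ereal assume "a \<in> {\<infinity>}"
  have "\<infinity> islimpt ereal ` S"
  proof (rule islimptI)
    fix T :: "ereal set" assume T: "\<infinity> \<in> T" "open T"
    then obtain b where b: "{ereal b<..} \<subseteq> T" using open_PInfty by auto
    have "\<exists>x\<in>S. x > b"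
    proof (rule ccontr)
      assume "\<not> (\<exists>x\<in>S. x > b)"
      then have "S \<inter> {..b} = S" by (auto simp: not_less)
      then show False using S(1) S(3)[of b] by simp
    qed
    then obtain x where "x \<in> S" "x > b" by blast
    then show "\<exists>y\<in>ereal ` S. y \<in> T \<and> y \<noteq> \<infinity>" using subsetD[OF b, of "ereal x"] by auto
  qed
  then show "a \<in> {a. a islimpt ereal ` S}" using \<open>a \<in> {\<infinity>}\<close> by simp
qed

text \<open>Every nonempty part of S has a least element, the minimum of a finite initial piece, so
  successors can be iterated. A point that is never reached would have infinitely many points of S
  below it.\<close>

lemma increasing_enumeration:
  fixes S :: "real set"
  assumes inf: "infinite S" and fin: "\<And>R. finite (S \<inter> {..R})"
  shows "\<exists>a :: nat \<Rightarrow> real. strict_mono a \<and> range a = S \<and> filterlim a at_top sequentially"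
proof -
  define least where "least T = (SOME m. m \<in> T \<and> (\<forall>t\<in>T. m \<le> t))" for T :: "real set"
  have least: "least T \<in> T \<and> (\<forall>t\<in>T. least T \<le> t)" if T: "T \<subseteq> S" "T \<noteq> {}" for T
  proof -
    obtain t where t: "t \<in> T" using T by blast
    have f: "finite (T \<inter> {..t})" by (rule finite_subset[OF _ fin[of t]]) (use T in auto)
    have ne: "T \<inter> {..t} \<noteq> {}" using t by auto
    have "Min (T \<inter> {..t}) \<in> T \<inter> {..t}" using f ne by (rule Min_in)
    moreover have "Min (T \<inter> {..t}) \<le> s" if "s \<in> T" for s
    proof (cases "s \<le> t")
      case True
      then show ?thesis using f that by (intro Min_le) auto
    next
      case False
      then show ?thesis using \<open>Min (T \<inter> {..t}) \<in> T \<inter> {..t}\<close> by auto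
    qed
    ultimately have "\<exists>m. m \<in> T \<and> (\<forall>t\<in>T. m \<le> t)" by blast
    then show ?thesis unfolding least_def by (rule someI_ex)
  qed
  have ne: "S \<inter> {x<..} \<noteq> {}" for x
  proof
    assume "S \<inter> {x<..} = {}"
    then have "S \<subseteq> S \<inter> {..x}" by (auto simp: not_less disjoint_iff)
    then show False using inf fin[of x] finite_subset by blast
  qed
  define a where "a = rec_nat (least S) (\<lambda>_ x. least (S \<inter> {x<..}))"
  have a0: "a 0 = least S" and aS: "a (Suc n) = least (S \<inter> {a n<..})" for n
    by (simp_all add: a_def)
  have a_S: "a n \<in> S" for n
  proof (cases n)
    case 0
    then show ?thesis using least[of S] inf a0 by auto
  next
    case (Suc m)
    then show ?thesis using least[of "S \<inter> {a m<..}"] ne[of "a m"] aS by auto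
  qed
  have "a n < a (Suc n)" for n
    using least[of "S \<inter> {a n<..}"] ne[of "a n"] aS by auto
  then have mono: "strict_mono a" by (simp add: strict_mono_Suc_iff)
  have fin': "finite {n. a n \<le> R}" for R
  proof -
    have "finite (a -` (S \<inter> {..R}))"
      using strict_mono_imp_inj_on[OF mono] by (intro finite_vimageI fin) auto
    moreover have "{n. a n \<le> R} = a -` (S \<inter> {..R})" using a_S by auto
    ultimately show ?thesis by simp
  qed
  have "s \<in> range a" if s: "s \<in> S" for s
  proof (rule ccontr)
    assume ns: "s \<notin> range a"
    have "a n < s" for n
    proof (induction n)
      case 0
      then show ?case using least[of S] s a0 ns by (metis empty_iff order_le_less rangeI subset_refl)
    next
      case (Suc n)
      then have "a (Suc n) \<le> s" using least[of "S \<inter> {a n<..}"] ne[of "a n"] aS s by auto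
      then show ?case using ns by (metis order_le_less rangeI)
    qed
    then have "{n. a n \<le> s} = UNIV" by (auto intro: less_imp_le)
    then show False using fin'[of s] by simp
  qed
  then have "range a = S" using a_S by auto
  moreover have "filterlim a at_top sequentially"
    unfolding filterlim_at_top_dense
  proof
    fix R
    obtain N where "\<forall>n\<in>{n. a n \<le> R}. n < N" using fin'[of R] finite_nat_set_iff_bounded by blast
    then show "\<forall>\<^sub>F n in sequentially. R < a n"
      by (intro eventually_sequentiallyI[of N]) (auto simp: not_le[symmetric])
  qed
  ultimately show ?thesis using mono by blast
qed

context path_measure
begin

lemma support_properties:
  shows "measure_support M \<subseteq> {-4<..}" and "finite (measure_support M \<inter> {..R})"
    and "AE x in M. x \<in> measure_support M" and "infinite (measure_support M)"
proof -
  let ?S = "measure_support M"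
  obtain Z where Z: "Z \<subseteq> {-4<..}" "\<And>R. finite (Z \<inter> {..R})" "AE x in M. x \<in> Z"
    using concentrated_on_discrete by blast
  have sub: "?S \<subseteq> Z"
    by (rule measure_support_subset[OF _ closed_if_locally_finite[OF Z(2)] Z(3)]) (rule real_distribution_axioms)
  show S1: "?S \<subseteq> {-4<..}" using sub Z(1) by blast
  show "finite (?S \<inter> {..R})" using Z(2)[of R] by (rule finite_subset[rotated]) (use sub in auto)
  have "Z \<subseteq> (\<Union>n::nat. Z \<inter> {..real n})"
  proof
    fix x assume "x \<in> Z"
    moreover obtain n :: nat where "x \<le> real n" using real_arch_simple by blast
    ultimately show "x \<in> (\<Union>n::nat. Z \<inter> {..real n})" by blast
  qed
  moreover have "countable (\<Union>n::nat. Z \<inter> {..real n})"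
  proof (rule countable_UN)
    show "countable (Z \<inter> {..real n})" for n using Z(2) by (rule countable_finite)
  qed simp
  ultimately have "countable Z" by (rule countable_subset)
  then show AE: "AE x in M. x \<in> ?S"
    using measure_support_outside_null[OF _ _ Z(3)] real_distribution_axioms by blast
  show "infinite ?S"
  proof
    assume "finite ?S"
    then obtain C where C: "\<And>x. x \<in> ?S \<Longrightarrow> \<bar>x\<bar> \<le> C"
      using finite_imp_bounded[of ?S] by (auto simp: bounded_iff)
    define D where "D = max 1 C"
    have D: "D \<ge> 1" "\<And>x. x \<in> ?S \<Longrightarrow> \<bar>x\<bar> \<le> D" using C by (force simp: D_def)+
    have upper: "path_moment g v l \<le> D ^ l" for l
    proof -
      have m: "has_bochner_integral M (\<lambda>x. x ^ l) (path_moment g v l)"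
        using moment by (simp add: path_moment_eq_descent_sum)
      have "(LINT x|M. x ^ l) \<le> (LINT x|M. D ^ l)"
      proof (rule integral_mono_AE)
        show "AE x in M. x ^ l \<le> D ^ l"
          using AE
        proof eventually_elim
          case (elim x)
          have "x ^ l \<le> \<bar>x\<bar> ^ l" by (metis abs_ge_self power_abs)
          also have "\<dots> \<le> D ^ l" using D(2)[OF elim] by (intro power_mono) auto
          finally show ?case .
        qed
      qed (use m in \<open>auto simp: has_bochner_integral_iff\<close>)
      then show ?thesis using m prob_space by (simp add: has_bochner_integral_iff)
    qed
    \<comment> \<open>For this h the paths that stay at height h make the moment of order 2 h + k at
      least (2 D)^k, whereas a support in [-D, D] allows at most D^(2 h + k). The discrepancy 2^k is
      unbounded in k.\<close>
    obtain h :: nat where h: "2 * D / g < real h" using reals_Archimedean2 by blast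
    then have hg: "2 * D \<le> real h * g" using g by (simp add: field_simps)
    have "2 ^ k \<le> D ^ (2 * h)" for k :: nat
    proof -
      have "2 ^ k * D ^ k = (2 * D) ^ k" by (simp only: power_mult_distrib)
      also have "\<dots> \<le> (real h * g) ^ k" by (rule power_mono[OF hg]) (use D in simp)
      also have "\<dots> \<le> path_moment g v (h + k + h)"
        using path_moment_ge[of g v h k] g v_nonneg v1 by simp
      also have "\<dots> \<le> D ^ (h + k + h)" by (rule upper)
      also have "h + k + h = 2 * h + k" by simp
      also have "D ^ (2 * h + k) = D ^ (2 * h) * D ^ k" by (rule power_add)
      finally show ?thesis by (rule mult_right_le_imp_le) (use D in simp)
    qed
    moreover obtain k where "D ^ (2 * h) < 2 ^ k" using real_arch_pow[of 2 "D ^ (2 * h)"] by auto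
    ultimately show False by (simp add: not_less[symmetric])
  qed
qed

end

section \<open>Differentiation of Lipschitz functions\<close>

text \<open>Continuity makes single points null. The formula is wanted for open intervals because
  these are the boxes by which \<open>lborel_eqI\<close> characterizes Lebesgue measure.\<close>

lemma emeasure_interval_measure_Ioo:
  assumes ab: "a \<le> b" and F: "\<And>x y. x \<le> y \<Longrightarrow> F x \<le> F y" "continuous_on UNIV F"
  shows "emeasure (interval_measure F) {a<..<b} = ennreal (F b - F a)"
proof (cases "a = b")
  case False
  let ?M = "interval_measure F"
  have pt: "emeasure ?M {x} = 0" for x
    using emeasure_interval_measure_Icc[of x x F] F by simp
  have "emeasure ?M {a..b} \<le> emeasure ?M {a<..<b} + emeasure ?M {a, b}"
  proof -
    have "{a..b} = {a<..<b} \<union> {a, b}" using ab by auto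
    then show ?thesis using emeasure_subadditive[of "{a<..<b}" ?M "{a, b}"] by simp
  qed
  moreover have "emeasure ?M {a, b} \<le> emeasure ?M {a} + emeasure ?M {b}"
    using emeasure_subadditive[of "{a}" ?M "{b}"] by (simp add: insert_commute)
  moreover have "emeasure ?M {a<..<b} \<le> emeasure ?M {a..b}"
    by (intro emeasure_mono) auto
  ultimately have "emeasure ?M {a<..<b} = emeasure ?M {a..b}"
    by (simp add: pt antisym)
  then show ?thesis using emeasure_interval_measure_Icc[OF ab F] by simp
qed simp

text \<open>On an interval the increments of F and of x - F add up to the length, and Lebesgue
  measure is determined by intervals. The measure of F is thereby dominated by Lebesgue
  measure.\<close>

lemma interval_measure_add_eq_lborel:
  fixes F :: "real \<Rightarrow> real"
  assumes F: "\<And>x y. x \<le> y \<Longrightarrow> F x \<le> F y" "continuous_on UNIV F"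
    and G: "\<And>x y. x \<le> y \<Longrightarrow> x - F x \<le> y - F y"
    and A: "A \<in> sets borel"
  shows "emeasure (interval_measure F) A + emeasure (interval_measure (\<lambda>x. x - F x)) A = emeasure lborel A"
proof -
  let ?N1 = "interval_measure F" and ?N2 = "interval_measure (\<lambda>x. x - F x)"
  define \<mu> where "\<mu> A = emeasure ?N1 A + emeasure ?N2 A" for A
  define N where "N = measure_of UNIV (sets borel) \<mu>"
  have sets_N: "sets N = sets borel"
    unfolding N_def using sets.sigma_sets_eq[of "borel :: real measure"] by (simp add: sets_measure_of_conv)
  have "countably_additive (sets N) \<mu>"
    unfolding countably_additive_def
  proof (intro allI impI)
    fix A :: "nat \<Rightarrow> real set"
    assume A: "range A \<subseteq> sets N" "disjoint_family A"
    have "(suminf (\<lambda>i. \<mu> (A i))) = (suminf (\<lambda>i. emeasure ?N1 (A i))) + (suminf (\<lambda>i. emeasure ?N2 (A i)))"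
      unfolding \<mu>_def by (rule suminf_add[symmetric]) auto
    also have "\<dots> = \<mu> (\<Union>i. A i)"
      unfolding \<mu>_def using A by (subst (1 2) suminf_emeasure) (auto simp: sets_N)
    finally show "(suminf (\<lambda>i. \<mu> (A i))) = \<mu> (\<Union>i. A i)" .
  qed
  moreover have "positive (sets N) \<mu>" by (simp add: positive_def \<mu>_def)
  ultimately have em: "emeasure N A = \<mu> A" if "A \<in> sets borel" for A
    using that by (intro emeasure_measure_of[OF N_def]) (auto simp: sets_N)
  have G': "continuous_on UNIV (\<lambda>x. x - F x)" by (intro continuous_intros F)
  have "lborel = N"
  proof (rule lborel_eqI)
    fix l u :: real assume "\<And>b. b \<in> Basis \<Longrightarrow> l \<bullet> b \<le> u \<bullet> b"
    then have lu: "l \<le> u" by simp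
    have "emeasure N {l<..<u} = ennreal (F u - F l) + ennreal ((u - F u) - (l - F l))"
      using emeasure_interval_measure_Ioo[OF lu F] emeasure_interval_measure_Ioo[OF lu G G']
      by (simp add: em \<mu>_def)
    also have "\<dots> = ennreal (u - l)"
      using F(1)[OF lu] G[OF lu] by (subst ennreal_plus[symmetric]) auto
    finally show "emeasure N (box l u) = (\<Prod>b\<in>Basis. (u - l) \<bullet> b)" by simp
  qed (simp add: sets_N)
  then show ?thesis using em[OF A] by (simp add: \<mu>_def)
qed

text \<open>Both measures have densities, which add up to 1 almost everywhere. Truncating the first
  one at 1 alters it only on a null set and makes the bounds hold at every point.\<close>

lemma interval_measure_density:
  fixes F :: "real \<Rightarrow> real"
  assumes F: "\<And>x y. x \<le> y \<Longrightarrow> F x \<le> F y"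
    and G: "\<And>x y. x \<le> y \<Longrightarrow> x - F x \<le> y - F y"
  shows "\<exists>h. h \<in> borel_measurable borel \<and> (\<forall>x. 0 \<le> h x \<and> h x \<le> 1) \<and>
    interval_measure F = density lborel (\<lambda>x. ennreal (h x))"
proof -
  have "\<bar>F y - F x\<bar> \<le> 1 * \<bar>y - x\<bar>" for x y
    using F[of x y] F[of y x] G[of x y] G[of y x] by (cases x y rule: linorder_cases) auto
  then have "1-lipschitz_on UNIV F"
    by (intro lipschitz_onI) (auto simp: dist_real_def abs_minus_commute)
  then have cont: "continuous_on UNIV F" by (rule lipschitz_on_continuous_on)
  let ?N1 = "interval_measure F" and ?N2 = "interval_measure (\<lambda>x. x - F x)"
  have add: "emeasure ?N1 A + emeasure ?N2 A = emeasure lborel A" if "A \<in> sets borel" for A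
    by (rule interval_measure_add_eq_lborel[OF F cont G that])
  have "absolutely_continuous lborel ?N1" "absolutely_continuous lborel ?N2"
    unfolding absolutely_continuous_def
    using add by (auto simp: null_sets_def) (metis add_eq_0_iff_both_eq_0)+
  then obtain f1 f2 where f: "f1 \<in> borel_measurable lborel" "density lborel f1 = ?N1"
    "f2 \<in> borel_measurable lborel" "density lborel f2 = ?N2"
    using sigma_finite_measure.Radon_Nikodym[OF sigma_finite_lborel, of ?N1]
      sigma_finite_measure.Radon_Nikodym[OF sigma_finite_lborel, of ?N2] by auto
  note [measurable] = f(1,3)
  have "density lborel (\<lambda>x. f1 x + f2 x) = density lborel (\<lambda>_. 1)"
  proof (rule measure_eqI)
    fix A assume "A \<in> sets (density lborel (\<lambda>x. f1 x + f2 x))"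
    then have A[measurable]: "A \<in> sets borel" by simp
    have "emeasure (density lborel (\<lambda>x. f1 x + f2 x)) A
        = emeasure (density lborel f1) A + emeasure (density lborel f2) A"
      by (simp add: emeasure_density nn_integral_add[symmetric] distrib_right)
    then show "emeasure (density lborel (\<lambda>x. f1 x + f2 x)) A = emeasure (density lborel (\<lambda>_. 1)) A"
      using add[OF A] by (simp add: f density_1)
  qed simp
  then have "AE x in lborel. f1 x + f2 x = 1"
    by (intro sigma_finite_measure.density_unique[OF sigma_finite_lborel]) auto
  then have le: "AE x in lborel. f1 x = ennreal (enn2real (min 1 (f1 x)))"
  proof eventually_elim
    case (elim x)
    then have "f1 x \<le> 1" by (metis le_iff_add)
    moreover from this have "f1 x \<noteq> top" by (metis ennreal_one_neq_top top.extremum_unique)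
    ultimately show ?case by (simp add: min_absorb2 ennreal_enn2real_if)
  qed
  show ?thesis
  proof (intro exI conjI allI)
    show "(\<lambda>x. enn2real (min 1 (f1 x))) \<in> borel_measurable borel" by measurable
    show "0 \<le> enn2real (min 1 (f1 x))" for x by simp
    show "enn2real (min 1 (f1 x)) \<le> 1" for x
      using enn2real_mono[of "min 1 (f1 x)" 1] by simp
    show "?N1 = density lborel (\<lambda>x. ennreal (enn2real (min 1 (f1 x))))"
      unfolding f(2)[symmetric] by (rule density_cong) (use le in auto)
  qed
qed

text \<open>
  Vitali covering by intervals with difference quotient above \<open>d\<close>, inside an open set that exceeds
  \<open>{h < c}\<close> only by a small measure.
\<close>

lemma negligible_upper_derivate_ball:
  fixes F h :: "real \<Rightarrow> real"
  assumes h[measurable]: "h \<in> borel_measurable borel" and h1: "\<And>x. 0 \<le> h x \<and> h x \<le> 1"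
    and N: "N = density lborel (\<lambda>x. ennreal (h x))"
    and Icc: "\<And>a b. a \<le> b \<Longrightarrow> emeasure N {a..b} = ennreal (F b - F a)"
    and cd: "0 \<le> c" "c < d"
  shows "negligible {x \<in> ball 0 R. h x < c \<and>
    (\<forall>e>0. \<exists>p q. p \<le> x \<and> x \<le> q \<and> p < q \<and> q - p < e \<and> F q - F p > d * (q - p))}"
    (is "negligible ?E")
  unfolding negligible_outer
proof (intro allI impI)
  fix e :: real assume e: "e > 0"
  define B where "B = {x \<in> ball 0 R. h x < c}"
  have B[measurable]: "B \<in> sets borel" unfolding B_def by measurable
  \<comment> \<open>Calibrated for the final estimate: if w is the length of W, then d w \<le> N(W)
    \<le> c w + e' gives w \<le> e / 2.\<close>
  define e' where "e' = (d - c) * e / 2"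
  have e': "e' > 0" using e cd by (simp add: e'_def)
  obtain V where V: "open V" "B \<subseteq> V" "V - B \<in> lmeasurable" "emeasure lebesgue (V - B) < ennreal e'"
    using sets_lebesgue_outer_open[of B e'] B e' by (auto simp: sets_completionI_sets)
  define U where "U = V \<inter> ball 0 R"
  have U: "open U" "B \<subseteq> U" "U \<subseteq> ball 0 R" using V by (auto simp: U_def B_def)
  have [measurable]: "U \<in> sets borel" using U(1) by simp
  have UB: "emeasure lborel (U - B) \<le> ennreal e'"
  proof -
    have "emeasure lborel (U - B) = emeasure lebesgue (U - B)" by (simp add: emeasure_completion)
    also have "\<dots> \<le> emeasure lebesgue (V - B)"
      using V(1) by (intro emeasure_mono) (auto simp: U_def)
    finally show ?thesis using V(4) by simp
  qed
  define K where "K = {i :: real \<times> real. 0 < snd i \<and> cball (fst i) (snd i) \<subseteq> U \<and>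
      F (fst i + snd i) - F (fst i - snd i) > d * (2 * snd i)}"
  have E: "?E \<subseteq> B" by (auto simp: B_def)
  obtain C where C: "countable C" "C \<subseteq> K"
     "pairwise (\<lambda>i j. disjnt (cball (fst i) (snd i)) (cball (fst j) (snd j))) C"
     "negligible (?E - (\<Union>i \<in> C. cball (fst i) (snd i)))"
  proof (rule Vitali_covering_theorem_cballs[of K snd ?E fst])
    show "0 < snd i" if "i \<in> K" for i using that by (simp add: K_def)
    fix x \<delta> :: real assume x: "x \<in> ?E" and \<delta>: "0 < \<delta>"
    obtain r where r: "r > 0" "ball x r \<subseteq> U"
      using x E U(1,2) by (meson openE subsetD)
    obtain p q where pq: "p \<le> x" "x \<le> q" "p < q" "q - p < min r \<delta>" "F q - F p > d * (q - p)"
      using x r(1) \<delta> by (auto dest!: spec[of _ "min r \<delta>"])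
    have mid: "(p + q) / 2 + (q - p) / 2 = q" "(p + q) / 2 - (q - p) / 2 = p"
      by (simp_all add: field_simps)
    have cb: "cball ((p + q) / 2) ((q - p) / 2) = {p..q}"
      unfolding cball_eq_atLeastAtMost mid ..
    have "{p..q} \<subseteq> ball x r" using pq by (auto simp: dist_real_def)
    moreover have "d * (2 * ((q - p) / 2)) < F ((p + q) / 2 + (q - p) / 2) - F ((p + q) / 2 - (q - p) / 2)"
    proof -
      have half: "2 * ((q - p) / 2) = q - p" by simp
      show ?thesis unfolding mid half using pq by simp
    qed
    ultimately have "((p + q) / 2, (q - p) / 2) \<in> K"
      unfolding K_def mem_Collect_eq fst_conv snd_conv cb using pq(3) r(2) by auto
    moreover have "x \<in> cball ((p + q) / 2) ((q - p) / 2)" unfolding cb using pq by simp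
    moreover have "(q - p) / 2 < \<delta>" using pq by auto
    ultimately show "\<exists>i. i \<in> K \<and> x \<in> cball (fst i) (snd i) \<and> snd i < \<delta>"
      by (intro exI[of _ "((p + q) / 2, (q - p) / 2)"]) auto
  qed auto
  define W where "W = (\<Union>i \<in> C. cball (fst i) (snd i))"
  have WU: "W \<subseteq> U" using C(2) by (auto simp: W_def K_def)
  have W[measurable]: "W \<in> sets borel" unfolding W_def using C(1) by (intro sets.countable_UN') auto
  have disj: "disjoint_family_on (\<lambda>i. cball (fst i) (snd i)) C"
    using C(3) by (auto simp: disjoint_family_on_def pairwise_def disjnt_def)
  have setsN: "sets N = sets borel" by (simp add: N)
  have fin: "emeasure lborel W < \<infinity>"
  proof -
    have "emeasure lborel W \<le> emeasure lborel (ball (0::real) R)"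
      using WU U(3) by (intro emeasure_mono) auto
    also have "\<dots> < \<infinity>" by (intro emeasure_bounded_finite) auto
    finally show ?thesis .
  qed
  have low: "ennreal d * emeasure lborel W \<le> emeasure N W"
  proof -
    have "emeasure lborel W = (\<integral>\<^sup>+i. emeasure lborel (cball (fst i) (snd i)) \<partial>count_space C)"
      unfolding W_def by (rule emeasure_UN_countable[OF _ C(1) disj]) auto
    then have "ennreal d * emeasure lborel W
        = (\<integral>\<^sup>+i. ennreal d * emeasure lborel (cball (fst i) (snd i)) \<partial>count_space C)"
      by (simp add: nn_integral_cmult)
    also have "\<dots> \<le> (\<integral>\<^sup>+i. emeasure N (cball (fst i) (snd i)) \<partial>count_space C)"
    proof (intro nn_integral_mono)
      fix i assume "i \<in> space (count_space C)"
      then have i: "i \<in> K" using C(2) by auto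
      then have "emeasure N (cball (fst i) (snd i)) = ennreal (F (fst i + snd i) - F (fst i - snd i))"
        by (simp add: cball_eq_atLeastAtMost Icc K_def)
      moreover have "ennreal d * emeasure lborel (cball (fst i) (snd i)) = ennreal (d * (2 * snd i))"
        using i cd by (simp add: cball_eq_atLeastAtMost K_def ennreal_mult)
      ultimately show "ennreal d * emeasure lborel (cball (fst i) (snd i)) \<le> emeasure N (cball (fst i) (snd i))"
        using i by (simp add: K_def ennreal_leI)
    qed
    also have "\<dots> = emeasure N W"
      unfolding W_def by (rule emeasure_UN_countable[OF _ C(1) disj, symmetric]) (auto simp: setsN)
    finally show ?thesis .
  qed
  have "emeasure N W = (\<integral>\<^sup>+x. ennreal (h x) * indicator W x \<partial>lborel)"
    unfolding N by (intro emeasure_density) auto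
  also have "\<dots> \<le> (\<integral>\<^sup>+x. ennreal c * indicator W x + indicator (U - B) x \<partial>lborel)"
  proof (intro nn_integral_mono)
    fix x
    show "ennreal (h x) * indicator W x \<le> ennreal c * indicator W x + indicator (U - B) x"
    proof (cases "x \<in> W")
      case True
      then have "x \<in> U" "x \<in> ball 0 R" using WU U(3) by auto
      show ?thesis
      proof (cases "x \<in> B")
        case True
        then have "h x \<le> c" by (simp add: B_def)
        then show ?thesis using \<open>x \<in> W\<close> True by (simp add: ennreal_leI)
      next
        case False
        have "ennreal (h x) \<le> 1" using h1[of x] by (simp add: ennreal_le_1)
        also have "\<dots> \<le> ennreal c + 1" by simp
        finally show ?thesis using \<open>x \<in> W\<close> \<open>x \<in> U\<close> False by simp
      qed
    qed simp
  qed
  also have "\<dots> = ennreal c * emeasure lborel W + emeasure lborel (U - B)"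
    by (subst nn_integral_add) (auto simp: nn_integral_cmult)
  also have "\<dots> \<le> ennreal c * emeasure lborel W + ennreal e'" using UB by (intro add_left_mono)
  finally have "ennreal d * emeasure lborel W \<le> ennreal c * emeasure lborel W + ennreal e'"
    using low by simp
  moreover obtain w where w: "emeasure lborel W = ennreal w" "w \<ge> 0"
    using fin by (cases "emeasure lborel W") auto
  ultimately have "d * w \<le> c * w + e'"
    using cd e' by (simp add: ennreal_mult[symmetric] ennreal_plus[symmetric] del: ennreal_plus)
  then have "(d - c) * w \<le> e'" by (simp add: algebra_simps)
  then have "(d - c) * w \<le> (d - c) * (e / 2)" by (simp add: e'_def)
  then have we: "w \<le> e / 2" using cd by (simp add: mult_le_cancel_left_pos)
  have nul: "?E - W \<in> null_sets lebesgue" using C(4) by (simp add: W_def negligible_iff_null_sets)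
  have Wl: "W \<in> lmeasurable" using fin W by (intro fmeasurableI) (auto simp: emeasure_completion)
  have mW: "measure lebesgue W = w" using w by (simp add: measure_completion measure_def)
  show "\<exists>T. ?E \<subseteq> T \<and> T \<in> lmeasurable \<and> measure lebesgue T < e"
  proof (intro exI conjI)
    show "?E \<subseteq> W \<union> (?E - W)" by auto
    show "W \<union> (?E - W) \<in> lmeasurable"
      using nul Wl by (intro fmeasurable.Un) (auto intro: fmeasurableI_null_sets)
    have "measure lebesgue (W \<union> (?E - W)) = measure lebesgue W"
      using nul Wl by (intro measure_Un_null_set) (auto dest: fmeasurableD)
    then show "measure lebesgue (W \<union> (?E - W)) < e" using mW we e by simp
  qed
qed

text \<open>If the bound failed for some \<epsilon>, rationals c < d between h x and h x +
  \<epsilon> would place x in one of countably many null sets. The interval from p to q may have x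
  as an end point, so one-sided difference quotients are covered.\<close>

lemma AE_upper_derivate:
  fixes F h :: "real \<Rightarrow> real"
  assumes h: "h \<in> borel_measurable borel" and h1: "\<And>x. 0 \<le> h x \<and> h x \<le> 1"
    and N: "N = density lborel (\<lambda>x. ennreal (h x))"
    and Icc: "\<And>a b. a \<le> b \<Longrightarrow> emeasure N {a..b} = ennreal (F b - F a)"
  shows "AE x in lebesgue. \<forall>\<epsilon>>0. \<exists>e>0. \<forall>p q. p \<le> x \<and> x \<le> q \<and> p < q \<and> q - p < e \<longrightarrow>
      F q - F p \<le> (h x + \<epsilon>) * (q - p)"
proof -
  define E where "E R c d = {x \<in> ball 0 R. h x < c \<and>
    (\<forall>e>0. \<exists>p q. p \<le> x \<and> x \<le> q \<and> p < q \<and> q - p < e \<and> F q - F p > d * (q - p))}" for R c d :: real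
  define I where "I = {(n :: nat, c, d). c \<in> \<rat> \<and> d \<in> \<rat> \<and> 0 \<le> c \<and> c < (d :: real)}"
  have "countable (UNIV \<times> \<rat> \<times> \<rat> :: (nat \<times> real \<times> real) set)"
    by (intro countable_SIGMA countable_rat) auto
  then have I: "countable I" by (rule countable_subset[rotated]) (auto simp: I_def)
  have "(\<Union>(n, c, d)\<in>I. E (real n) c d) \<in> null_sets lebesgue"
  proof (rule null_sets_UN'[OF I], clarify)
    fix n c d assume "(n, c, d) \<in> I"
    then show "E (real n) c d \<in> null_sets lebesgue"
      unfolding E_def negligible_iff_null_sets[symmetric]
      by (intro negligible_upper_derivate_ball[OF h h1 N Icc]) (auto simp: I_def)
  qed
  then have "AE x in lebesgue. x \<notin> (\<Union>(n, c, d)\<in>I. E (real n) c d)" by (rule AE_not_in)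
  then show ?thesis
  proof eventually_elim
    case (elim x)
    show ?case
    proof (intro allI impI)
      fix \<epsilon> :: real assume "\<epsilon> > 0"
      obtain d where d: "d \<in> \<rat>" "h x < d" "d < h x + \<epsilon>"
        using Rats_dense_in_real[of "h x" "h x + \<epsilon>"] \<open>\<epsilon> > 0\<close> by auto
      obtain c where c: "c \<in> \<rat>" "h x < c" "c < d"
        using Rats_dense_in_real[of "h x" d] d by auto
      obtain n where n: "\<bar>x\<bar> < real n" using reals_Archimedean2 by blast
      have "(n, c, d) \<in> I" using c d h1[of x] by (auto simp: I_def)
      then have "x \<notin> E (real n) c d" using elim by blast
      then have "\<not> (\<forall>e>0. \<exists>p q. p \<le> x \<and> x \<le> q \<and> p < q \<and> q - p < e \<and> F q - F p > d * (q - p))"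
        using n c by (auto simp: E_def)
      then obtain e where e: "e > 0" "\<And>p q. p \<le> x \<Longrightarrow> x \<le> q \<Longrightarrow> p < q \<Longrightarrow> q - p < e \<Longrightarrow> F q - F p \<le> d * (q - p)"
        by (meson not_less)
      have "F q - F p \<le> (h x + \<epsilon>) * (q - p)" if "p \<le> x" "x \<le> q" "p < q" "q - p < e" for p q
      proof -
        have "F q - F p \<le> d * (q - p)" using e that by blast
        also have "\<dots> \<le> (h x + \<epsilon>) * (q - p)" using d that by (intro mult_right_mono) auto
        finally show ?thesis .
      qed
      then show "\<exists>e>0. \<forall>p q. p \<le> x \<and> x \<le> q \<and> p < q \<and> q - p < e \<longrightarrow> F q - F p \<le> (h x + \<epsilon>) * (q - p)"
        using e(1) by blast
    qed
  qed
qed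

text \<open>The upper estimate is applied to F and to x - F, whose density is 1 - h; the second
  application is a lower estimate for F. Two facts are needed about the profile: its derivative at
  almost every point, as in the Markov-Krein formula, and the recovery of its increments by
  integration.\<close>

theorem monotone_lipschitz_derivative:
  fixes F :: "real \<Rightarrow> real"
  assumes F: "\<And>x y. x \<le> y \<Longrightarrow> F x \<le> F y"
    and G: "\<And>x y. x \<le> y \<Longrightarrow> x - F x \<le> y - F y"
  shows "\<exists>h. h \<in> borel_measurable borel \<and> (\<forall>x. 0 \<le> h x \<and> h x \<le> 1) \<and>
    (\<forall>a b. a \<le> b \<longrightarrow> (LINT x:{a..b}|lborel. h x) = F b - F a) \<and>
    (AE x in lebesgue. (F has_real_derivative h x) (at x))"
proof -
  have "\<bar>F y - F x\<bar> \<le> 1 * \<bar>y - x\<bar>" for x y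
    using F[of x y] F[of y x] G[of x y] G[of y x] by (cases x y rule: linorder_cases) auto
  then have "1-lipschitz_on UNIV F"
    by (intro lipschitz_onI) (auto simp: dist_real_def abs_minus_commute)
  then have cont: "continuous_on UNIV F" by (rule lipschitz_on_continuous_on)
  obtain h where h: "h \<in> borel_measurable borel" "\<And>x. 0 \<le> h x \<and> h x \<le> 1"
    "interval_measure F = density lborel (\<lambda>x. ennreal (h x))"
    using interval_measure_density[OF F G] by blast
  note [measurable] = h(1)
  have Icc: "emeasure (density lborel (\<lambda>x. ennreal (h x))) {a..b} = ennreal (F b - F a)" if "a \<le> b" for a b
    using emeasure_interval_measure_Icc[OF that F cont] by (simp add: h(3))
  have int: "(\<integral>\<^sup>+x. ennreal (h x) * indicator {a..b} x \<partial>lborel) = ennreal (F b - F a)" if "a \<le> b" for a b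
    using Icc[OF that] by (subst (asm) emeasure_density) auto
  define N' where "N' = density lborel (\<lambda>x. ennreal (1 - h x))"
  have Icc': "emeasure N' {a..b} = ennreal ((b - F b) - (a - F a))" if ab: "a \<le> b" for a b
  proof -
    have "emeasure N' {a..b} + ennreal (F b - F a)
        = (\<integral>\<^sup>+x. ennreal (1 - h x) * indicator {a..b} x + ennreal (h x) * indicator {a..b} x \<partial>lborel)"
      unfolding N'_def int[OF ab, symmetric] by (subst nn_integral_add) (auto simp: emeasure_density)
    also have "\<dots> = (\<integral>\<^sup>+x. indicator {a..b} x \<partial>lborel)"
    proof (intro nn_integral_cong)
      fix x
      have "ennreal (1 - h x) + ennreal (h x) = 1"
        using h(2)[of x] by (subst ennreal_plus[symmetric]) auto
      then show "ennreal (1 - h x) * indicator {a..b} x + ennreal (h x) * indicator {a..b} x = indicator {a..b} x"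
        by (simp add: distrib_right[symmetric])
    qed
    also have "\<dots> = ennreal ((b - F b) - (a - F a)) + ennreal (F b - F a)"
      using ab F[OF ab] G[OF ab] by (subst ennreal_plus[symmetric]) auto
    finally show ?thesis by (simp add: add.commute[of _ "ennreal (F b - F a)"] ennreal_add_left_cancel)
  qed
  have up: "AE x in lebesgue. \<forall>\<epsilon>>0. \<exists>e>0. \<forall>p q. p \<le> x \<and> x \<le> q \<and> p < q \<and> q - p < e \<longrightarrow>
      F q - F p \<le> (h x + \<epsilon>) * (q - p)"
    by (rule AE_upper_derivate[OF h(1,2) refl]) (rule Icc)
  have low: "AE x in lebesgue. \<forall>\<epsilon>>0. \<exists>e>0. \<forall>p q. p \<le> x \<and> x \<le> q \<and> p < q \<and> q - p < e \<longrightarrow>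
      (q - F q) - (p - F p) \<le> (1 - h x + \<epsilon>) * (q - p)"
    by (rule AE_upper_derivate[OF _ _ N'_def]) (use h(2) Icc' in auto)
  have "AE x in lebesgue. (F has_real_derivative h x) (at x)"
    using up low
  proof eventually_elim
    case (elim x)
    show ?case
      unfolding has_field_derivative_iff
    proof (rule LIM_I)
      fix \<epsilon> :: real assume \<epsilon>: "\<epsilon> > 0"
      then have "\<epsilon> / 2 > 0" by simp
      obtain e1 where e1: "e1 > 0"
        "\<forall>p q. p \<le> x \<and> x \<le> q \<and> p < q \<and> q - p < e1 \<longrightarrow> F q - F p \<le> (h x + \<epsilon> / 2) * (q - p)"
        using elim(1)[rule_format, OF \<open>\<epsilon> / 2 > 0\<close>] by auto
      obtain e2 where e2: "e2 > 0"
        "\<forall>p q. p \<le> x \<and> x \<le> q \<and> p < q \<and> q - p < e2 \<longrightarrow>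
           (q - F q) - (p - F p) \<le> (1 - h x + \<epsilon> / 2) * (q - p)"
        using elim(2)[rule_format, OF \<open>\<epsilon> / 2 > 0\<close>] by auto
      note e = e1(1) e2(1) e1(2)[rule_format] e2(2)[rule_format]
      have quot: "\<bar>(F q - F p) / (q - p) - h x\<bar> < \<epsilon>"
        if pq: "p \<le> x" "x \<le> q" "p < q" "q - p < min e1 e2" for p q
      proof -
        have "F q - F p \<le> (h x + \<epsilon> / 2) * (q - p)" "(h x - \<epsilon> / 2) * (q - p) \<le> F q - F p"
          using e(3)[of p q] e(4)[of p q] pq by (auto simp: algebra_simps)
        then have "(F q - F p) / (q - p) \<le> h x + \<epsilon> / 2" "h x - \<epsilon> / 2 \<le> (F q - F p) / (q - p)"
          using pq by (auto simp: pos_divide_le_eq pos_le_divide_eq)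
        then show ?thesis using \<epsilon> by linarith
      qed
      show "\<exists>s>0. \<forall>y. y \<noteq> x \<and> norm (y - x) < s \<longrightarrow> norm ((F y - F x) / (y - x) - h x) < \<epsilon>"
      proof (intro exI conjI allI impI)
        show "min e1 e2 > 0" using e by simp
        fix y assume y: "y \<noteq> x \<and> norm (y - x) < min e1 e2"
        show "norm ((F y - F x) / (y - x) - h x) < \<epsilon>"
        proof (cases "x < y")
          case True
          then show ?thesis using quot[of x y] y by simp
        next
          case False
          have "(F y - F x) / (y - x) = (F x - F y) / (x - y)"
            by (metis minus_diff_eq minus_divide_divide)
          then show ?thesis using quot[of y x] y False by simp
        qed
      qed
    qed
  qed
  moreover have "(LINT x:{a..b}|lborel. h x) = F b - F a" if ab: "a \<le> b" for a b
  proof -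
    have "(LINT x:{a..b}|lborel. h x) = enn2real (\<integral>\<^sup>+x. ennreal (indicator {a..b} x *\<^sub>R h x) \<partial>lborel)"
      unfolding set_lebesgue_integral_def using h(2) by (intro integral_eq_nn_integral) auto
    also have "(\<integral>\<^sup>+x. ennreal (indicator {a..b} x *\<^sub>R h x) \<partial>lborel) = (\<integral>\<^sup>+x. ennreal (h x) * indicator {a..b} x \<partial>lborel)"
      by (intro nn_integral_cong) (auto split: split_indicator)
    finally show ?thesis using int[OF ab] F[OF ab] by simp
  qed
  ultimately show ?thesis using h by blast
qed

section \<open>Stieltjes transforms and Poisson integrals\<close>

text \<open>
  At distance \<open>\<epsilon>\<close> from an atom of mass \<open>w\<close>, in a gap of length \<open>d\<close>, the term \<open>w / \<epsilon>\<close> of the atom in the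
  Stieltjes transform beats the terms of the other sign, whose sum is at most \<open>1 / (d - \<epsilon>)\<close>.
\<close>

lemma blow_up_arith:
  fixes w d :: real
  assumes "w > 0" "d > 0"
  defines "\<epsilon> \<equiv> w * d / (2 * (1 + w))"
  shows "0 < \<epsilon>" "\<epsilon> < d" "w * (1 / \<epsilon>) - 1 / (d - \<epsilon>) > 0"
proof -
  have e: "\<epsilon> * (2 * (1 + w)) = w * d" using assms(1) by (simp add: \<epsilon>_def)
  show pos: "0 < \<epsilon>" using assms by (simp add: \<epsilon>_def)
  have "\<epsilon> * (2 * (1 + w)) < d * (2 * (1 + w))"
    unfolding e using assms by (simp add: algebra_simps add_pos_pos)
  then show lt: "\<epsilon> < d" using assms(1) by (simp add: mult_less_cancel_right)
  have "2 * (\<epsilon> + \<epsilon> * w) = w * d" using e by (simp add: algebra_simps)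
  moreover have "w * d > 0" using assms(1,2) by simp
  ultimately have "\<epsilon> + \<epsilon> * w < w * d" by (smt (verit))
  then have "\<epsilon> < w * (d - \<epsilon>)" by (simp add: algebra_simps)
  then show "w * (1 / \<epsilon>) - 1 / (d - \<epsilon>) > 0" using pos lt by (simp add: field_simps)
qed

locale discrete_measure = real_distribution +
  fixes a :: "nat \<Rightarrow> real"
  assumes a_mono: "strict_mono a" and a_at_top: "filterlim a at_top sequentially"
    and AE_atoms: "AE x in M. x \<in> range a" and atom_pos: "measure M {a n} > 0"
begin

definition stieltjes :: "real \<Rightarrow> real" where
  "stieltjes x = (LINT t|M. 1 / (x - t))"

lemma finite_atoms_le: "finite {n. a n \<le> R}"
proof -
  have "\<forall>\<^sub>F n in sequentially. R < a n" using a_at_top by (simp add: filterlim_at_top_dense)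
  then obtain N where "\<And>n. n \<ge> N \<Longrightarrow> R < a n" by (auto simp: eventually_sequentially)
  then have "{n. a n \<le> R} \<subseteq> {..<N}" by (force simp: not_le[symmetric])
  then show ?thesis by (rule finite_subset) simp
qed

text \<open>Only finitely many atoms lie below x + 1; the others are more than 1 away.\<close>

lemma gap_distance:
  assumes "x \<notin> range a"
  shows "\<exists>\<delta>>0. \<forall>t\<in>range a. \<bar>x - t\<bar> \<ge> \<delta>"
proof -
  let ?D = "insert 1 ((\<lambda>n. \<bar>x - a n\<bar>) ` {n. a n \<le> x + 1})"
  have fin: "finite ?D" using finite_atoms_le by simp
  show ?thesis
  proof (intro exI conjI ballI)
    show "Min ?D > 0" using fin assms by (subst Min_gr_iff) auto
    fix t assume "t \<in> range a"
    then obtain n where t: "t = a n" by blast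
    show "Min ?D \<le> \<bar>x - t\<bar>"
    proof (cases "a n \<le> x + 1")
      case True
      then show ?thesis using fin t by (intro Min_le) auto
    next
      case False
      have "Min ?D \<le> 1" using fin by (intro Min_le) auto
      then show ?thesis using False t by auto
    qed
  qed
qed

lemma integrable_resolvent:
  assumes "x \<notin> range a"
  shows "integrable M (\<lambda>t. 1 / (x - t))"
proof -
  obtain \<delta> where \<delta>: "\<delta> > 0" "\<forall>t\<in>range a. \<bar>x - t\<bar> \<ge> \<delta>" using gap_distance[OF assms] by blast
  show ?thesis
  proof (rule integrable_const_bound[of _ "1 / \<delta>"])
    show "AE t in M. norm (1 / (x - t)) \<le> 1 / \<delta>"
      using AE_atoms
    proof eventually_elim
      case (elim t)
      then have "\<delta> \<le> \<bar>x - t\<bar>" using \<delta>(2) by blast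
      then show ?case using \<delta>(1) by (auto simp: norm_divide intro!: frac_le)
    qed
  qed measurable
qed

lemma integral_strict_mono_AE:
  assumes "integrable M f" "integrable M h" "AE t in M. f t < (h t :: real)"
  shows "integral\<^sup>L M f < integral\<^sup>L M h"
  using assms emeasure_space_1 by (intro integral_less_AE_space) auto

lemma stieltjes_less:
  assumes "x < y" "{x..y} \<inter> range a = {}"
  shows "stieltjes y < stieltjes x"
  unfolding stieltjes_def
proof (rule integral_strict_mono_AE)
  have "x \<in> {x..y}" "y \<in> {x..y}" using assms(1) by auto
  then have "x \<notin> range a" "y \<notin> range a" using assms(2) by blast+
  then show "integrable M (\<lambda>t. 1 / (y - t))" and "integrable M (\<lambda>t. 1 / (x - t))"
    using integrable_resolvent by blast+
  show "AE t in M. 1 / (y - t) < 1 / (x - t)"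
    using AE_atoms
  proof eventually_elim
    case (elim t)
    then have "t \<notin> {x..y}" using assms(2) by blast
    then consider "t < x" | "y < t" by fastforce
    then show ?case
    proof cases
      case 1
      then show ?thesis using assms(1) by (intro divide_strict_left_mono) auto
    next
      case 2
      then have "1 / (t - x) < 1 / (t - y)" using assms(1) by (intro divide_strict_left_mono) auto
      then show ?thesis using 2 assms(1) by (metis minus_diff_eq minus_divide_right neg_less_iff_less)
    qed
  qed
qed

lemma stieltjes_left:
  assumes "x < a 0"
  shows "stieltjes x < 0"
proof -
  have ge: "a 0 \<le> t" if "t \<in> range a" for t
    using that strict_mono_less_eq[OF a_mono] by auto
  have "stieltjes x < (LINT t|M. 0)"
    unfolding stieltjes_def
  proof (rule integral_strict_mono_AE)
    show "integrable M (\<lambda>t. 1 / (x - t))" using assms ge by (intro integrable_resolvent) force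
    show "AE t in M. 1 / (x - t) < 0"
      using AE_atoms
    proof eventually_elim
      case (elim t)
      then have "x < t" using assms ge[of t] by simp
      then show ?case by (simp add: divide_less_0_iff)
    qed
  qed simp
  then show ?thesis by simp
qed

lemma atom_cases:
  assumes "t \<in> range a"
  shows "t \<le> a n \<or> t \<ge> a (Suc n)"
proof -
  obtain m where m: "t = a m" using assms by blast
  have "m \<le> n \<or> Suc n \<le> m" by linarith
  then show ?thesis unfolding m using strict_mono_less_eq[OF a_mono] by blast
qed

lemma a_less_Suc: "a n < a (Suc n)"
  using a_mono by (simp add: strict_mono_Suc_iff)

text \<open>The comparison function next to an atom s: its own term in full, and a constant k that
  covers the atoms of the other sign.\<close>

lemma indicator_integral:
  "integrable M (\<lambda>t. indicator {s} t * c - k :: real)"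
  "(LINT t|M. indicator {s} t * c - k) = measure M {s} * c - k"
proof -
  have i: "integrable M (\<lambda>t. indicator {s} t * c :: real)"
    by (intro integrable_mult_left integrable_real_indicator) (auto simp: less_top[symmetric])
  show "integrable M (\<lambda>t. indicator {s} t * c - k :: real)"
    by (intro Bochner_Integration.integrable_diff i) simp
  show "(LINT t|M. indicator {s} t * c - k) = measure M {s} * c - k"
    using prob_space by (subst Bochner_Integration.integral_diff[OF i]) auto
qed

lemma stieltjes_pos_ex: "\<exists>x. a n < x \<and> x < a (Suc n) \<and> stieltjes x > 0"
proof -
  define w d where "w = measure M {a n}" and "d = a (Suc n) - a n"
  define \<epsilon> where "\<epsilon> = w * d / (2 * (1 + w))"
  have wd: "w > 0" "d > 0" using atom_pos a_less_Suc by (auto simp: w_def d_def)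
  note E = blow_up_arith[OF wd, folded \<epsilon>_def]
  define x where "x = a n + \<epsilon>"
  have x: "a n < x" "x < a (Suc n)" using E by (auto simp: x_def d_def)
  have nr: "x \<notin> range a" using x atom_cases[of x n] by auto
  have "w * (1 / \<epsilon>) - 1 / (d - \<epsilon>) = (LINT t|M. indicator {a n} t * (1 / \<epsilon>) - 1 / (d - \<epsilon>))"
    by (simp only: indicator_integral w_def)
  also have "\<dots> \<le> stieltjes x"
    unfolding stieltjes_def
  proof (rule integral_mono_AE)
    show "AE t in M. indicator {a n} t * (1 / \<epsilon>) - 1 / (d - \<epsilon>) \<le> 1 / (x - t)"
      using AE_atoms
    proof eventually_elim
      case (elim t)
      consider "t = a n" | "t < a n" | "t \<ge> a (Suc n)" using atom_cases[OF elim, of n] by fastforce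
      then show ?case
      proof cases
        case 1
        then show ?thesis using E by (simp add: x_def)
      next
        case 2
        have "- (1 / (d - \<epsilon>)) \<le> 0" using E by simp
        also have "0 \<le> 1 / (x - t)" using 2 x by simp
        finally show ?thesis using 2 by (simp add: indicator_def)
      next
        case 3
        then have "d - \<epsilon> \<le> t - x" by (simp add: d_def x_def)
        then have "1 / (t - x) \<le> 1 / (d - \<epsilon>)" using E by (intro divide_left_mono) auto
        moreover have "1 / (x - t) = - (1 / (t - x))" by (metis minus_diff_eq minus_divide_right)
        ultimately show ?thesis using 3 a_less_Suc[of n] by (simp add: indicator_def)
      qed
    qed
  qed (intro indicator_integral(1) integrable_resolvent nr)+
  finally have "stieltjes x > 0" using E(3) by linarith
  then show ?thesis using x by blast
qed

lemma stieltjes_neg_ex: "\<exists>x. a n < x \<and> x < a (Suc n) \<and> stieltjes x < 0"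
proof -
  define w d where "w = measure M {a (Suc n)}" and "d = a (Suc n) - a n"
  define \<epsilon> where "\<epsilon> = w * d / (2 * (1 + w))"
  have wd: "w > 0" "d > 0" using atom_pos a_less_Suc by (auto simp: w_def d_def)
  note E = blow_up_arith[OF wd, folded \<epsilon>_def]
  define x where "x = a (Suc n) - \<epsilon>"
  have x: "a n < x" "x < a (Suc n)" using E by (auto simp: x_def d_def)
  have nr: "x \<notin> range a" using x atom_cases[of x n] by auto
  have "stieltjes x \<le> (LINT t|M. - (indicator {a (Suc n)} t * (1 / \<epsilon>) - 1 / (d - \<epsilon>)))"
    unfolding stieltjes_def
  proof (rule integral_mono_AE)
    show "integrable M (\<lambda>t. - (indicator {a (Suc n)} t * (1 / \<epsilon>) - 1 / (d - \<epsilon>)))"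
      by (intro integrable_minus indicator_integral)
    show "AE t in M. 1 / (x - t) \<le> - (indicator {a (Suc n)} t * (1 / \<epsilon>) - 1 / (d - \<epsilon>))"
      using AE_atoms
    proof eventually_elim
      case (elim t)
      consider "t = a (Suc n)" | "t > a (Suc n)" | "t \<le> a n" using atom_cases[OF elim, of n] by fastforce
      then show ?case
      proof cases
        case 1
        then show ?thesis using E by (simp add: x_def)
      next
        case 2
        then have "1 / (x - t) \<le> 0" using x by (simp add: divide_nonneg_nonpos)
        also have "0 \<le> 1 / (d - \<epsilon>)" using E by simp
        finally show ?thesis using 2 by (simp add: indicator_def)
      next
        case 3
        then have "d - \<epsilon> \<le> x - t" by (simp add: d_def x_def)
        then have "1 / (x - t) \<le> 1 / (d - \<epsilon>)" using E by (intro divide_left_mono) auto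
        then show ?thesis using 3 a_less_Suc[of n] by (simp add: indicator_def)
      qed
    qed
  qed (use integrable_resolvent[OF nr] in auto)
  also have "\<dots> = - (w * (1 / \<epsilon>) - 1 / (d - \<epsilon>))"
    by (simp only: integral_minus indicator_integral w_def)
  finally have "stieltjes x < 0" using E(3) by linarith
  then show ?thesis using x by blast
qed

text \<open>By strict decrease the points with positive value form an initial piece of the gap, and
  b is its supremum. For x beyond b the value is at most 0 halfway between b and x, hence negative
  at x.\<close>

lemma stieltjes_sign_change:
  "\<exists>b. a n < b \<and> b < a (Suc n) \<and> (\<forall>x\<in>{a n<..<b}. stieltjes x > 0) \<and>
    (\<forall>x\<in>{b<..<a (Suc n)}. stieltjes x < 0)"
proof -
  have less: "stieltjes y < stieltjes x" if "a n < x" "x < y" "y < a (Suc n)" for x y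
  proof (rule stieltjes_less[OF that(2)])
    show "{x..y} \<inter> range a = {}" using atom_cases[of _ n] that by fastforce
  qed
  define T where "T = {x. a n < x \<and> x < a (Suc n) \<and> stieltjes x > 0}"
  obtain x1 where x1: "x1 \<in> T" using stieltjes_pos_ex[of n] by (auto simp: T_def)
  obtain x2 where x2: "a n < x2" "x2 < a (Suc n)" "stieltjes x2 < 0" using stieltjes_neg_ex by blast
  have up: "y \<le> x2" if "y \<in> T" for y
    using less[of x2 y] that x2 by (force simp: T_def not_le[symmetric])
  have bdd: "bdd_above T" using up by (auto simp: bdd_above_def)
  define b where "b = Sup T"
  have b: "x1 \<le> b" "b \<le> x2"
    unfolding b_def using x1 up bdd by (auto intro: cSup_upper cSup_least)
  have "stieltjes x > 0" if "x \<in> {a n<..<b}" for x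
  proof -
    have "x < Sup T" using that by (simp add: b_def)
    then obtain t where "t \<in> T" "x < t" using x1 less_cSupE by (metis empty_iff)
    then show ?thesis using less[of x t] that by (auto simp: T_def)
  qed
  moreover have "stieltjes x < 0" if "x \<in> {b<..<a (Suc n)}" for x
  proof -
    define y where "y = (b + x) / 2"
    have y: "b < y" "y < x" using that by (auto simp: y_def)
    have "y \<notin> T" using y(1) cSup_upper[OF _ bdd, of y] by (auto simp: b_def)
    then have "stieltjes y \<le> 0" using y that b x1 by (auto simp: T_def not_less)
    moreover have "stieltjes x < stieltjes y" using y that b x1 by (intro less) (auto simp: T_def)
    ultimately show ?thesis by simp
  qed
  ultimately show ?thesis using b x1 x2 by (intro exI[of _ b]) (auto simp: T_def)
qed

lemma stieltjes_boundary:
  assumes "x \<notin> range a"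
  shows "(\<lambda>n. LINT t|M. 1 / (Complex x (1 / real (Suc n)) - of_real t)) \<longlonglongrightarrow> of_real (stieltjes x)"
proof -
  obtain \<delta> where \<delta>: "\<delta> > 0" "\<forall>t\<in>range a. \<bar>x - t\<bar> \<ge> \<delta>" using gap_distance[OF assms] by blast
  have "(\<lambda>n. LINT t|M. 1 / (Complex x (1 / real (Suc n)) - of_real t))
      \<longlonglongrightarrow> (LINT t|M. complex_of_real (1 / (x - t)))"
  proof (rule integral_dominated_convergence[where w = "\<lambda>_. 1 / \<delta>"])
    show "(\<lambda>t. 1 / (Complex x (1 / real (Suc n)) - complex_of_real t)) \<in> borel_measurable M" for n
      by measurable
    show "(\<lambda>t. complex_of_real (1 / (x - t))) \<in> borel_measurable M" by measurable
    have lim: "(\<lambda>n. Complex x (1 / real (Suc n))) \<longlonglongrightarrow> of_real x"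
      using LIMSEQ_inverse_real_of_nat
      by (simp add: tendsto_complex_iff inverse_eq_divide)
    show "AE t in M. (\<lambda>n. 1 / (Complex x (1 / real (Suc n)) - complex_of_real t))
        \<longlonglongrightarrow> complex_of_real (1 / (x - t))"
      using AE_atoms
    proof eventually_elim
      case (elim t)
      then have "x \<noteq> t" using assms by auto
      then have "(\<lambda>n. 1 / (Complex x (1 / real (Suc n)) - complex_of_real t))
          \<longlonglongrightarrow> 1 / (complex_of_real x - complex_of_real t)"
        by (intro tendsto_intros lim) auto
      then show ?case by simp
    qed
    show "AE t in M. norm (1 / (Complex x (1 / real (Suc n)) - complex_of_real t)) \<le> 1 / \<delta>" for n
      using AE_atoms
    proof eventually_elim
      case (elim t)
      have "\<delta> \<le> \<bar>x - t\<bar>" using \<delta>(2) elim by blast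
      also have "\<dots> = \<bar>Re (Complex x (1 / real (Suc n)) - complex_of_real t)\<bar>" by simp
      also have "\<dots> \<le> norm (Complex x (1 / real (Suc n)) - complex_of_real t)" by (rule abs_Re_le_cmod)
      finally show ?case using \<delta>(1) by (auto simp: norm_divide intro!: frac_le)
    qed
  qed simp
  then show ?thesis by (simp add: stieltjes_def del: of_real_divide of_real_diff)
qed

end

section \<open>The Poisson kernel and the angle of a profile\<close>

lemma tendsto_arctan_scaled:
  fixes c :: real
  shows "(\<lambda>n. arctan (c * real (Suc n))) \<longlonglongrightarrow> (if c > 0 then pi / 2 else if c < 0 then - (pi / 2) else 0)"
proof -
  have lim: "filterlim (\<lambda>n. real (Suc n)) at_top sequentially"
    by (rule filterlim_compose[OF filterlim_real_sequentially filterlim_Suc])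
  consider "c > 0" | "c < 0" | "c = 0" by linarith
  then show ?thesis
  proof cases
    case 1
    then show ?thesis
      using filterlim_compose[OF tendsto_arctan_at_top
          filterlim_tendsto_pos_mult_at_top[OF tendsto_const 1 lim]] by simp
  next
    case 2
    then show ?thesis
      using filterlim_compose[OF tendsto_arctan_at_bot
          filterlim_tendsto_neg_mult_at_bot[OF tendsto_const 2 lim]] by simp
  qed simp
qed

text \<open>The Poisson kernel of the upper half plane, up to a factor \<open>\<pi>\<close>.\<close>

definition poisson :: "real \<Rightarrow> real \<Rightarrow> real \<Rightarrow> real" where
  "poisson y x t = y / ((t - x)\<^sup>2 + y\<^sup>2)"

lemma poisson_nonneg: "y > 0 \<Longrightarrow> poisson y x t \<ge> 0"
  by (simp add: poisson_def)

lemma poisson_denom_pos: "(y::real) > 0 \<Longrightarrow> (t - x)\<^sup>2 + y\<^sup>2 > 0"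
  by (simp add: add_nonneg_pos)

lemma poisson_le: "y > 0 \<Longrightarrow> poisson y x t \<le> 1 / y"
proof -
  assume y: "y > 0"
  have "y / ((t - x)\<^sup>2 + y\<^sup>2) \<le> y / y\<^sup>2"
    using y poisson_denom_pos[OF y, of t x] by (intro divide_left_mono mult_pos_pos) auto
  then show ?thesis using y by (simp add: poisson_def power2_eq_square)
qed

lemma poisson_le': "y > 0 \<Longrightarrow> t \<noteq> x \<Longrightarrow> poisson y x t \<le> y / (t - x)\<^sup>2"
  unfolding poisson_def by (intro divide_left_mono) (auto intro!: mult_pos_pos add_pos_pos)

lemma poisson_commute: "poisson y x t = poisson y t x"
  by (simp add: poisson_def power2_commute)

lemma poisson_Im: "Im (1 / (complex_of_real t - Complex x y)) = poisson y x t"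
  by (simp add: poisson_def Im_divide power2_eq_square)

lemma poisson_measurable [measurable (raw)]:
  "f \<in> borel_measurable N \<Longrightarrow> h \<in> borel_measurable N \<Longrightarrow> (\<lambda>z. poisson y (f z) (h z)) \<in> borel_measurable N"
  unfolding poisson_def
  by (intro borel_measurable_divide borel_measurable_add borel_measurable_power borel_measurable_diff
      borel_measurable_const)

lemma poisson_integral:
  assumes y: "y > 0" and pq: "p \<le> q"
  shows "has_bochner_integral lborel (\<lambda>x. poisson y x t * indicator {p..q} x)
     (arctan ((q - t) / y) - arctan ((p - t) / y))"
proof (rule has_bochner_integral_FTC_Icc_real[OF pq])
  fix x
  have "((\<lambda>x. arctan ((x - t) / y)) has_real_derivative (inverse (1 + ((x - t) / y)\<^sup>2)) * (1 / y)) (at x)"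
    using y by (auto intro!: derivative_eq_intros)
  also have "inverse (1 + ((x - t) / y)\<^sup>2) * (1 / y) = poisson y x t"
  proof -
    have y0: "y \<noteq> 0" using y by simp
    then have "1 + ((x - t) / y)\<^sup>2 = ((x - t)\<^sup>2 + y\<^sup>2) / y\<^sup>2" by (simp add: power_divide add_divide_distrib)
    with y0 show ?thesis
      unfolding poisson_def power2_commute[of t x] by (simp add: power2_eq_square)
  qed
  finally show "((\<lambda>x. arctan ((x - t) / y)) has_real_derivative poisson y x t) (at x)" .
  show "isCont (\<lambda>x. poisson y x t) x"
    unfolding poisson_def using poisson_denom_pos[OF y, of t x] by (intro continuous_intros) auto
qed

lemma arctan_diff_bounds:
  assumes "p \<le> q"
  shows "0 \<le> arctan q - arctan p" "arctan q - arctan p \<le> pi"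
  using arctan_le_iff[of p q] arctan_bounded[of p] arctan_bounded[of q] assms by auto


locale profile =
  fixes \<omega> :: "real \<Rightarrow> real"
  assumes lipschitz: "\<bar>\<omega> x - \<omega> y\<bar> \<le> \<bar>x - y\<bar>" and ge_abs: "\<omega> x \<ge> \<bar>x\<bar>"
begin

text \<open>The Lipschitz bound says that this function and its difference from the identity are
  both nondecreasing, as \<open>monotone_lipschitz_derivative\<close> requires. Its derivative is 1
  on slopes +1 and 0 on slopes -1.\<close>

definition rise :: "real \<Rightarrow> real" where
  "rise x = (x + \<omega> x) / 2"

lemma rise_mono: "x \<le> y \<Longrightarrow> rise x \<le> rise y" "x \<le> y \<Longrightarrow> x - rise x \<le> y - rise y"
proof -
  assume "x \<le> y"
  then have "\<omega> x - \<omega> y \<le> y - x" "\<omega> y - \<omega> x \<le> y - x" using lipschitz[of x y] by linarith+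
  then show "rise x \<le> rise y" "x - rise x \<le> y - rise y" by (auto simp: rise_def field_simps)
qed

definition slope :: "real \<Rightarrow> real" where
  "slope = (SOME h. h \<in> borel_measurable borel \<and> (\<forall>x. 0 \<le> h x \<and> h x \<le> 1) \<and>
    (\<forall>a b. a \<le> b \<longrightarrow> (LINT x:{a..b}|lborel. h x) = rise b - rise a) \<and>
    (AE x in lebesgue. (rise has_real_derivative h x) (at x)))"

lemma slope:
  "slope \<in> borel_measurable borel" "0 \<le> slope x" "slope x \<le> 1"
  "p \<le> q \<Longrightarrow> (LINT x:{p..q}|lborel. slope x) = rise q - rise p"
  "AE x in lebesgue. (rise has_real_derivative slope x) (at x)"
  using someI_ex[OF monotone_lipschitz_derivative[of rise, OF rise_mono], folded slope_def] by auto

text \<open>Almost everywhere the derivative of \<open>excess \<omega>\<close>. It is nonnegative up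
  to 0 and nonpositive beyond; integrability and the one-sided bounds on the angle rest on this sign
  pattern.\<close>

definition jump :: "real \<Rightarrow> real" where
  "jump x = slope x - (if x > 0 then 1 else 0)"

lemma slope_measurable [measurable]: "slope \<in> borel_measurable borel"
  by (rule slope(1))

lemma jump_measurable [measurable]: "jump \<in> borel_measurable borel"
  unfolding jump_def by measurable

lemma abs_jump_le: "\<bar>jump x\<bar> \<le> 1"
  using slope(2,3)[of x] by (auto simp: jump_def)

lemma excess_derivative: "AE x in lebesgue. (excess \<omega> has_real_derivative jump x) (at x)"
proof -
  have "AE x in lebesgue. x \<noteq> (0::real)"
    by (rule AE_not_in[of "{0}", simplified]) (simp flip: negligible_iff_null_sets)
  then show ?thesis
    using slope(5)
  proof eventually_elim
    case (elim x)
    define T where "T = (if x > 0 then {0<..} else {..<(0::real)})"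
    have T: "open T" "x \<in> T" using elim(1) by (auto simp: T_def)
    have "((\<lambda>y. rise y - (if x > 0 then y else 0)) has_real_derivative jump x) (at x)"
    proof (cases "x > 0")
      case True
      then show ?thesis using elim(2) by (auto simp: jump_def intro!: derivative_eq_intros)
    next
      case False
      then show ?thesis using elim(2) by (auto simp: jump_def)
    qed
    then show ?case
    proof (rule has_field_derivative_transform_within_open[OF _ T])
      fix y assume "y \<in> T"
      then show "rise y - (if x > 0 then y else 0) = excess \<omega> y"
        by (auto simp: T_def rise_def excess_def field_simps split: if_splits)
    qed
  qed
qed

lemma deriv_excess: "AE x in lebesgue. deriv (excess \<omega>) x = jump x"
  using excess_derivative by eventually_elim (rule DERIV_imp_deriv)

lemma slope_integrable_Icc: "set_integrable lborel {p..q} slope"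
proof -
  have "integrable lborel (\<lambda>x. indicator {p..q} x :: real)"
    by (intro integrable_real_indicator) (auto simp: emeasure_lborel_Icc_eq)
  then show ?thesis
    unfolding set_integrable_def
    by (rule Bochner_Integration.integrable_bound)
      (auto simp: slope(2,3) abs_of_nonneg split: split_indicator)
qed

lemma jump_integral:
  assumes pq: "p \<le> q" and sgn: "0 \<le> p \<or> q \<le> 0"
  shows "(LINT t|lborel. indicator {p..q} t * jump t) = rise q - rise p - (if 0 \<le> p then q - p else 0)"
proof -
  have one: "set_integrable lborel {p..q} (\<lambda>_. 1 :: real)"
    unfolding set_integrable_def by (simp add: integrable_real_indicator emeasure_lborel_Icc_eq)
  have "(LINT t|lborel. indicator {p..q} t * jump t)
      = (LINT t:{p..q}|lborel. slope t - (if 0 \<le> p then 1 else 0))"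
    unfolding set_lebesgue_integral_def
  proof (rule integral_cong_AE)
    have "AE t in lborel. t \<noteq> (0::real)" by (rule AE_lborel_singleton)
    then show "AE t in lborel. indicator {p..q} t * jump t
        = indicator {p..q} t *\<^sub>R (slope t - (if 0 \<le> p then 1 else 0))"
    proof eventually_elim
      case (elim t)
      then show ?case using sgn pq by (auto simp: jump_def indicator_def)
    qed
  qed auto
  also have "\<dots> = (LINT t:{p..q}|lborel. slope t) - (if 0 \<le> p then q - p else 0)"
  proof (cases "0 \<le> p")
    case True
    have "(LINT t:{p..q}|lborel. slope t - 1) = (LINT t:{p..q}|lborel. slope t) - (LINT t:{p..q}|lborel. 1)"
      by (rule set_integral_diff(2)[OF slope_integrable_Icc one])
    moreover have "(LINT t:{p..q}|lborel. (1::real)) = q - p"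
      using pq by (simp add: set_lebesgue_integral_def)
    ultimately show ?thesis using True by simp
  qed simp
  finally show ?thesis using slope(4)[OF pq] by simp
qed

text \<open>As the sign of \<open>jump\<close> is constant on each half-line, the integral of its
  modulus is a combination of increments of \<open>rise\<close>; what remains is \<omega> 0 minus
  the two excess values at the ends.\<close>

lemma abs_jump_integral_le:
  "(\<integral>\<^sup>+t. ennreal (indicator {- real n..real n} t * \<bar>jump t\<bar>) \<partial>lborel) \<le> ennreal (\<omega> 0)"
proof -
  let ?n = "real n"
  have int: "integrable lborel (\<lambda>t. indicator {p..q} t * jump t)" for p q
  proof -
    have "integrable lborel (\<lambda>x. indicator {p..q} x :: real)"
      by (intro integrable_real_indicator) (auto simp: emeasure_lborel_Icc_eq)
    then show ?thesis
      by (rule Bochner_Integration.integrable_bound)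
        (auto simp: abs_jump_le abs_mult split: split_indicator)
  qed
  have "(\<integral>\<^sup>+t. ennreal (indicator {- ?n..?n} t * \<bar>jump t\<bar>) \<partial>lborel)
      = (\<integral>\<^sup>+t. ennreal (indicator {- ?n..0} t * jump t - indicator {0..?n} t * jump t) \<partial>lborel)"
  proof (rule nn_integral_cong_AE)
    have "AE t in lborel. t \<noteq> (0::real)" by (rule AE_lborel_singleton)
    then show "AE t in lborel. ennreal (indicator {- ?n..?n} t * \<bar>jump t\<bar>)
        = ennreal (indicator {- ?n..0} t * jump t - indicator {0..?n} t * jump t)"
    proof eventually_elim
      case (elim t)
      then show ?case using slope(2,3)[of t] by (auto simp: jump_def indicator_def)
    qed
  qed
  also have "\<dots> = ennreal (LINT t|lborel. indicator {- ?n..0} t * jump t - indicator {0..?n} t * jump t)"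
  proof (rule nn_integral_eq_integral)
    have "AE t in lborel. t \<noteq> (0::real)" by (rule AE_lborel_singleton)
    then show "AE t in lborel. 0 \<le> indicator {- ?n..0} t * jump t - indicator {0..?n} t * jump t"
    proof eventually_elim
      case (elim t)
      then show ?case using slope(2,3)[of t] by (auto simp: jump_def indicator_def)
    qed
  qed (intro Bochner_Integration.integrable_diff int)
  also have "(LINT t|lborel. indicator {- ?n..0} t * jump t - indicator {0..?n} t * jump t)
      = (LINT t|lborel. indicator {- ?n..0} t * jump t) - (LINT t|lborel. indicator {0..?n} t * jump t)"
    by (intro Bochner_Integration.integral_diff int)
  also have "\<dots> = \<omega> 0 - (\<omega> (- ?n) - ?n) / 2 - (\<omega> ?n - ?n) / 2"
    by (subst (1 2) jump_integral) (auto simp: rise_def field_simps)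
  also have "ennreal \<dots> \<le> ennreal (\<omega> 0)"
  proof (rule ennreal_leI)
    have "(\<omega> (- ?n) - ?n) / 2 \<ge> 0" "(\<omega> ?n - ?n) / 2 \<ge> 0" using ge_abs[of ?n] ge_abs[of "- ?n"] by simp_all
    then show "\<omega> 0 - (\<omega> (- ?n) - ?n) / 2 - (\<omega> ?n - ?n) / 2 \<le> \<omega> 0" by linarith
  qed
  finally show ?thesis .
qed

lemma jump_integrable: "integrable lborel jump"
proof (rule integrableI_bounded)
  let ?f = "\<lambda>n t. ennreal (indicator {- real n..real n} t * \<bar>jump t\<bar>)"
  have "(\<integral>\<^sup>+t. ennreal (norm (jump t)) \<partial>lborel) = (\<integral>\<^sup>+t. (SUP n. ?f n t) \<partial>lborel)"
  proof (intro nn_integral_cong antisym)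
    fix t :: real
    obtain n :: nat where "\<bar>t\<bar> \<le> real n" using real_arch_simple by blast
    then have "ennreal (norm (jump t)) = ?f n t" by (auto simp: indicator_def)
    also have "\<dots> \<le> (SUP n. ?f n t)" by (rule SUP_upper) simp
    finally show "ennreal (norm (jump t)) \<le> (SUP n. ?f n t)" .
    show "(SUP n. ?f n t) \<le> ennreal (norm (jump t))"
      by (intro SUP_least ennreal_leI) (auto simp: indicator_def)
  qed
  also have "\<dots> = (SUP n. \<integral>\<^sup>+t. ?f n t \<partial>lborel)"
  proof (rule nn_integral_monotone_convergence_SUP)
    show "incseq ?f"
      by (intro incseq_SucI le_funI ennreal_leI mult_right_mono) (auto simp: indicator_def)
  qed measurable
  also have "\<dots> \<le> ennreal (\<omega> 0)" by (intro SUP_least abs_jump_integral_le)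
  also have "\<dots> < \<infinity>" by simp
  finally show "(\<integral>\<^sup>+t. ennreal (norm (jump t)) \<partial>lborel) < \<infinity>" .
qed measurable

definition jump_norm :: real where
  "jump_norm = (LINT t|lborel. \<bar>jump t\<bar>)"

text \<open>The imaginary part of the exponent in the Markov-Krein formula at x + i y, hence an
  argument of z times the Stieltjes transform. The kernel has total mass \<pi>, so the expected
  boundary value is \<pi> times \<open>jump\<close>.\<close>

definition angle :: "real \<Rightarrow> real \<Rightarrow> real" where
  "angle y x = (LINT t|lborel. poisson y x t * jump t)"

lemma poisson_jump_integrable: "y > 0 \<Longrightarrow> integrable lborel (\<lambda>t. poisson y x t * \<bar>jump t\<bar>)"
  "y > 0 \<Longrightarrow> integrable lborel (\<lambda>t. poisson y x t * jump t)"
proof -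
  assume y: "y > 0"
  have i: "integrable lborel (\<lambda>t. 1 / y * jump t)" using jump_integrable by simp
  show "integrable lborel (\<lambda>t. poisson y x t * \<bar>jump t\<bar>)"
    by (rule Bochner_Integration.integrable_bound[OF i], measurable)
      (use y poisson_le[OF y] poisson_nonneg[OF y] in
        \<open>auto simp: abs_mult intro!: mult_right_mono simp del: times_divide_eq_left\<close>)
  show "integrable lborel (\<lambda>t. poisson y x t * jump t)"
    by (rule Bochner_Integration.integrable_bound[OF i], measurable)
      (use y poisson_le[OF y] poisson_nonneg[OF y] in
        \<open>auto simp: abs_mult intro!: mult_right_mono simp del: times_divide_eq_left\<close>)
qed

text \<open>\<open>jump\<close> is bounded by 1 and the kernel has total mass \<pi>; truncation to
  [-n, n] reduces the mass to arctangents. The constant is sharp enough for arccos to invert the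
  cosine up to sign.\<close>

lemma abs_angle_le:
  assumes y: "y > 0"
  shows "\<bar>angle y x\<bar> \<le> pi"
proof -
  let ?f = "\<lambda>n t. indicator {- real n..real n} t * (poisson y x t * \<bar>jump t\<bar>)"
  have "(\<lambda>n. LINT t|lborel. ?f n t) \<longlonglongrightarrow> (LINT t|lborel. poisson y x t * \<bar>jump t\<bar>)"
  proof (rule integral_dominated_convergence[where w = "\<lambda>t. poisson y x t * \<bar>jump t\<bar>"])
    show "integrable lborel (\<lambda>t. poisson y x t * \<bar>jump t\<bar>)" by (rule poisson_jump_integrable[OF y])
    show "AE t in lborel. (\<lambda>n. ?f n t) \<longlonglongrightarrow> poisson y x t * \<bar>jump t\<bar>"
    proof (rule AE_I2)
      fix t :: real
      obtain N :: nat where N: "\<bar>t\<bar> \<le> real N" using real_arch_simple by blast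
      have "\<forall>\<^sub>F n in sequentially. ?f n t = poisson y x t * \<bar>jump t\<bar>"
        using eventually_ge_at_top[of N]
      proof eventually_elim
        case (elim n)
        then have "\<bar>t\<bar> \<le> real n" using N by (meson dual_order.trans of_nat_mono)
        then show ?case by (auto simp: indicator_def)
      qed
      then show "(\<lambda>n. ?f n t) \<longlonglongrightarrow> poisson y x t * \<bar>jump t\<bar>" by (rule tendsto_eventually)
    qed
    show "AE t in lborel. norm (?f n t) \<le> poisson y x t * \<bar>jump t\<bar>" for n
      using poisson_nonneg[OF y] by (auto simp: indicator_def abs_mult)
  qed measurable
  moreover have "(LINT t|lborel. ?f n t) \<le> pi" for n
  proof -
    have P: "has_bochner_integral lborel (\<lambda>t. poisson y x t * indicator {- real n..real n} t)
      (arctan ((real n - x) / y) - arctan ((- real n - x) / y))"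
      using poisson_integral[OF y, of "- real n" "real n" x] by (simp add: poisson_commute[of y _ x])
    have "(LINT t|lborel. ?f n t) \<le> (LINT t|lborel. poisson y x t * indicator {- real n..real n} t)"
    proof (rule integral_mono_AE)
      show "integrable lborel (\<lambda>t. poisson y x t * indicator {- real n..real n} t)"
        using P by (simp add: has_bochner_integral_iff)
      show "integrable lborel (?f n)"
        by (rule Bochner_Integration.integrable_bound[OF poisson_jump_integrable(1)[OF y]])
          (auto simp: indicator_def)
      show "AE t in lborel. ?f n t \<le> poisson y x t * indicator {- real n..real n} t"
        using abs_jump_le poisson_nonneg[OF y]
        by (auto simp: indicator_def intro!: mult_left_le)
    qed
    also have "\<dots> = arctan ((real n - x) / y) - arctan ((- real n - x) / y)"
      using P by (simp add: has_bochner_integral_iff)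
    also have "\<dots> \<le> pi" using y by (intro arctan_diff_bounds divide_right_mono) auto
    finally show ?thesis .
  qed
  ultimately have "(LINT t|lborel. poisson y x t * \<bar>jump t\<bar>) \<le> pi"
    by (intro LIMSEQ_le_const2) auto
  moreover have "\<bar>angle y x\<bar> \<le> (LINT t|lborel. \<bar>poisson y x t * jump t\<bar>)"
    unfolding angle_def by (rule integral_abs_bound)
  ultimately show ?thesis using poisson_nonneg[OF y] by (simp add: abs_mult)
qed

text \<open>For x > 0 the integrand is at most 0 on t > 0, and every other t has distance at least x
  from x, which leaves a multiple of y. The case x < 0 is symmetric. This decides between the limits
  \<pi> and -\<pi>, which the cosine cannot tell apart.\<close>

lemma angle_one_sided:
  assumes y: "y > 0"
  shows "x > 0 \<Longrightarrow> angle y x \<le> y / x\<^sup>2 * jump_norm"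
    and "x < 0 \<Longrightarrow> angle y x \<ge> - (y / x\<^sup>2 * jump_norm)"
proof -
  have j: "integrable lborel (\<lambda>t. y / x\<^sup>2 * \<bar>jump t\<bar>)" using jump_integrable by simp
  have sq: "y / (t - x)\<^sup>2 \<le> y / x\<^sup>2" if "x\<^sup>2 \<le> (t - x)\<^sup>2" "x \<noteq> 0" for t
    using that y by (intro divide_left_mono mult_pos_pos) (auto intro: less_le_trans)
  show "angle y x \<le> y / x\<^sup>2 * jump_norm" if x: "x > 0"
  proof -
    have "angle y x \<le> (LINT t|lborel. y / x\<^sup>2 * \<bar>jump t\<bar>)"
      unfolding angle_def
    proof (rule integral_mono_AE[OF poisson_jump_integrable(2)[OF y] j], rule AE_I2)
      fix t :: real
      show "poisson y x t * jump t \<le> y / x\<^sup>2 * \<bar>jump t\<bar>"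
      proof (cases "t > 0")
        case True
        then have "poisson y x t * jump t \<le> 0"
          using slope(3)[of t] poisson_nonneg[OF y] by (auto simp: jump_def mult_nonneg_nonpos)
        also have "0 \<le> y / x\<^sup>2 * \<bar>jump t\<bar>" using y by simp
        finally show ?thesis .
      next
        case False
        have "poisson y x t \<le> y / (t - x)\<^sup>2" using False x by (intro poisson_le' y) auto
        also have "\<dots> \<le> y / x\<^sup>2"
          using False x by (intro sq abs_le_square_iff[THEN iffD1]) auto
        finally have "poisson y x t * \<bar>jump t\<bar> \<le> y / x\<^sup>2 * \<bar>jump t\<bar>" by (intro mult_right_mono) auto
        moreover have "poisson y x t * jump t \<le> poisson y x t * \<bar>jump t\<bar>"
          using poisson_nonneg[OF y] by (intro mult_left_mono) auto
        ultimately show ?thesis by linarith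
      qed
    qed
    then show ?thesis by (simp add: jump_norm_def)
  qed
  show "angle y x \<ge> - (y / x\<^sup>2 * jump_norm)" if x: "x < 0"
  proof -
    have "(LINT t|lborel. - (y / x\<^sup>2 * \<bar>jump t\<bar>)) \<le> angle y x"
      unfolding angle_def
    proof (rule integral_mono_AE[OF integrable_minus[OF j] poisson_jump_integrable(2)[OF y]], rule AE_I2)
      fix t :: real
      show "- (y / x\<^sup>2 * \<bar>jump t\<bar>) \<le> poisson y x t * jump t"
      proof (cases "t > 0")
        case False
        have "- (y / x\<^sup>2 * \<bar>jump t\<bar>) \<le> 0" using y by simp
        also have "0 \<le> poisson y x t * jump t"
          using False slope(2)[of t] poisson_nonneg[OF y] by (auto simp: jump_def)
        finally show ?thesis .
      next
        case True
        have "poisson y x t \<le> y / (t - x)\<^sup>2" using True x by (intro poisson_le' y) auto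
        also have "\<dots> \<le> y / x\<^sup>2"
          using True x by (intro sq abs_le_square_iff[THEN iffD1]) auto
        finally have "poisson y x t * \<bar>jump t\<bar> \<le> y / x\<^sup>2 * \<bar>jump t\<bar>" by (intro mult_right_mono) auto
        moreover have "poisson y x t * (- \<bar>jump t\<bar>) \<le> poisson y x t * jump t"
          using poisson_nonneg[OF y] by (intro mult_left_mono) auto
        ultimately show ?thesis by simp
      qed
    qed
    then show ?thesis by (simp add: jump_norm_def)
  qed
qed

end

section \<open>Slopes of the limit shape\<close>

text \<open>Intended for \<open>deriv (excess \<omega>)\<close>, which is known only almost
  everywhere; completeness of Lebesgue measure transfers measurability.\<close>

lemma borel_measurable_lebesgue_cong_AE:
  assumes f: "f \<in> borel_measurable lebesgue" and AE: "AE x in lebesgue. f x = h x"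
  shows "h \<in> borel_measurable lebesgue"
proof (rule measurableI)
  fix A :: "'b set" assume A: "A \<in> sets borel"
  have "f -` A \<inter> space lebesgue \<in> sets lebesgue" using f A by (rule measurable_sets)
  moreover have "AE x in lebesgue. x \<in> f -` A \<inter> space lebesgue \<longleftrightarrow> x \<in> h -` A \<inter> space lebesgue"
    using AE by eventually_elim auto
  ultimately show "h -` A \<inter> space lebesgue \<in> sets lebesgue"
    using completion.in_sets_AE by blast
qed simp

locale limit_shape = discrete_measure M a + profile \<omega> for M a \<omega> +
  assumes limit_shape: "is_limit_shape M \<omega>"
begin

lemma resolvent_jump_integrable:
  assumes y: "y > 0"
  shows "integrable lborel (\<lambda>t. 1 / (complex_of_real t - Complex x y) * of_real (jump t))"
proof (rule Bochner_Integration.integrable_bound)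
  show "integrable lborel (\<lambda>t. 1 / y * jump t)" using jump_integrable by simp
  have "norm (1 / (complex_of_real t - Complex x y)) \<le> 1 / y" for t
  proof -
    have "y \<le> \<bar>Im (complex_of_real t - Complex x y)\<bar>" using y by simp
    also have "\<dots> \<le> norm (complex_of_real t - Complex x y)" by (rule abs_Im_le_cmod)
    finally show ?thesis using y by (auto simp: norm_divide intro!: frac_le)
  qed
  then show "AE t in lborel. norm (1 / (complex_of_real t - Complex x y) * of_real (jump t)) \<le> norm (1 / y * jump t)"
    using y by (intro AE_I2) (auto simp: norm_mult abs_mult intro!: mult_right_mono simp del: times_divide_eq_left)
qed measurable

text \<open>Here w is the exponential of the Markov-Krein exponent, which determines the angle only
  modulo 2 \<pi>; this is why the cosine is recorded.\<close>

lemma markov_krein_angle: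
  fixes x y :: real
  assumes y: "y > 0"
  defines "z \<equiv> Complex x y"
  defines "w \<equiv> z * (LINT t|M. 1 / (z - of_real t))"
  shows "cos (angle y x) = Re w / norm w"
proof -
  define I where "I = (LINT t|lborel. 1 / (of_real t - z) * of_real (jump t) :: complex)"
  have "(\<lambda>t. 1 / (of_real t - z) * of_real (jump t) :: complex) \<in> borel_measurable lborel"
    by measurable
  then have m: "(\<lambda>t. 1 / (of_real t - z) * of_real (jump t) :: complex) \<in> borel_measurable lebesgue"
    by (rule measurable_completion)
  have ae: "AE t in lebesgue. 1 / (of_real t - z) * of_real (jump t)
      = 1 / (of_real t - z) * of_real (deriv (excess \<omega>) t)"
    using deriv_excess by eventually_elim simp
  have "(LINT t|lebesgue. 1 / (of_real t - z) * of_real (deriv (excess \<omega>) t))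
      = (LINT t|lebesgue. 1 / (of_real t - z) * of_real (jump t))"
    using ae by (intro integral_cong_AE[OF borel_measurable_lebesgue_cong_AE[OF m ae] m])
      (auto elim: eventually_mono)
  also have "\<dots> = I" unfolding I_def by (rule integral_completion) measurable
  finally have leb: "(LINT t|lebesgue. 1 / (of_real t - z) * of_real (deriv (excess \<omega>) t)) = I" .
  have "Im z > 0" using y by (simp add: z_def)
  then have "(LINT t|M. 1 / (z - of_real t)) = 1 / z * exp I"
    using limit_shape unfolding is_limit_shape_def markov_krein_def leb[symmetric] by blast
  moreover have "z \<noteq> 0" using \<open>Im z > 0\<close> by auto
  ultimately have w: "w = exp I" by (simp add: w_def)
  have "Im I = (LINT t|lborel. Im (1 / (of_real t - z) * of_real (jump t)))"
    unfolding I_def z_def using resolvent_jump_integrable[OF y] by (rule integral_Im[symmetric])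
  also have "\<dots> = angle y x"
    unfolding angle_def
  proof (rule Bochner_Integration.integral_cong)
    fix t :: real
    have "Im (u * of_real r) = Im u * r" for u r by simp
    then show "Im (1 / (of_real t - z) * of_real (jump t)) = poisson y x t * jump t"
      unfolding z_def poisson_Im[symmetric] .
  qed simp
  finally show ?thesis unfolding w by (simp add: Re_exp)
qed

text \<open>
  The boundary value of \<open>z\<close> times the Stieltjes transform is real, so the angle tends to \<open>0\<close> or to
  \<open>\<plusminus>\<pi>\<close>; the sign is decided by the one-sided bound.
\<close>

lemma angle_limit:
  assumes x: "x \<notin> range a" "x \<noteq> 0" and s: "sgn (stieltjes x) = s" "s \<noteq> 0"
  shows "(\<lambda>n. angle (1 / real (Suc n)) x) \<longlonglongrightarrow> pi * (s - sgn x) / 2"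
proof -
  let ?y = "\<lambda>n. 1 / real (Suc n)" and ?\<theta> = "\<lambda>n. angle (1 / real (Suc n)) x"
  define w where "w n = Complex x (?y n) * (LINT t|M. 1 / (Complex x (?y n) - of_real t))" for n
  define r where "r = x * stieltjes x"
  have r: "r \<noteq> 0" using x(2) s by (auto simp: r_def sgn_0_0)
  have y0: "?y \<longlonglongrightarrow> 0" using LIMSEQ_inverse_real_of_nat by (simp add: inverse_eq_divide)
  have "(\<lambda>n. Complex x (?y n)) \<longlonglongrightarrow> of_real x"
    using y0 by (simp add: tendsto_complex_iff)
  then have w: "w \<longlonglongrightarrow> of_real r"
    unfolding w_def r_def of_real_mult by (intro tendsto_mult stieltjes_boundary x(1))
  have "(\<lambda>n. Re (w n) / norm (w n)) \<longlonglongrightarrow> Re (of_real r) / norm (of_real r :: complex)"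
    using r by (intro tendsto_divide tendsto_Re tendsto_norm w) auto
  moreover have "Re (w n) / norm (w n) = cos (?\<theta> n)" for n
    using markov_krein_angle[of "?y n" x] by (simp add: w_def)
  moreover have "Re (of_real r) / norm (of_real r :: complex) = sgn r"
    using r by (simp add: sgn_real_def)
  ultimately have cos: "(\<lambda>n. cos (?\<theta> n)) \<longlonglongrightarrow> sgn r" by simp
  \<comment> \<open>As the angle lies in [-\<pi>, \<pi>], arccos recovers its modulus, which
    therefore tends to 0 or \<pi>.\<close>
  have "(\<lambda>n. arccos (cos (?\<theta> n))) \<longlonglongrightarrow> arccos (sgn r)"
    by (rule continuous_on_tendsto_compose[OF continuous_on_arccos' cos]) (auto simp: sgn_real_def)
  moreover have "arccos (cos (?\<theta> n)) = \<bar>?\<theta> n\<bar>" for n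
    using abs_angle_le[of "?y n" x] arccos_cos[of "\<bar>?\<theta> n\<bar>"] by simp
  ultimately have abs: "(\<lambda>n. \<bar>?\<theta> n\<bar>) \<longlonglongrightarrow> arccos (sgn r)" by simp
  have e: "(\<lambda>n. 2 * \<bar>?y n / x\<^sup>2 * jump_norm\<bar>) \<longlonglongrightarrow> 0"
    using tendsto_mult[OF tendsto_const[of 2] tendsto_rabs[OF tendsto_mult[OF tendsto_divide[OF y0 tendsto_const[of "x\<^sup>2"]] tendsto_const[of jump_norm]]]] x(2)
    by simp
  consider "x > 0" | "x < 0" using x(2) by linarith
  then show ?thesis
  proof cases
    case 1
    \<comment> \<open>Twice the positive part of the angle, squeezed by the one-sided bound; the
      limit of the modulus then gives that of the angle.\<close>
    have "(\<lambda>n. ?\<theta> n + \<bar>?\<theta> n\<bar>) \<longlonglongrightarrow> 0"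
    proof (rule tendsto_sandwich[OF _ _ tendsto_const e])
      have "?\<theta> n + \<bar>?\<theta> n\<bar> \<le> 2 * \<bar>?y n / x\<^sup>2 * jump_norm\<bar>" for n
        using angle_one_sided(1)[of "?y n" x] 1 by (auto simp: abs_if)
      then show "\<forall>\<^sub>F n in sequentially. ?\<theta> n + \<bar>?\<theta> n\<bar> \<le> 2 * \<bar>?y n / x\<^sup>2 * jump_norm\<bar>" by simp
      show "\<forall>\<^sub>F n in sequentially. 0 \<le> ?\<theta> n + \<bar>?\<theta> n\<bar>" by (intro always_eventually) auto
    qed
    from tendsto_diff[OF this abs] have "?\<theta> \<longlonglongrightarrow> - arccos (sgn r)" by simp
    moreover have "sgn r = s" using 1 s by (simp add: r_def sgn_mult)
    moreover have "s = 1 \<or> s = -1" using s by (auto simp: sgn_real_def split: if_splits)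
    ultimately show ?thesis using 1 by auto
  next
    case 2
    have "(\<lambda>n. \<bar>?\<theta> n\<bar> - ?\<theta> n) \<longlonglongrightarrow> 0"
    proof (rule tendsto_sandwich[OF _ _ tendsto_const e])
      have "\<bar>?\<theta> n\<bar> - ?\<theta> n \<le> 2 * \<bar>?y n / x\<^sup>2 * jump_norm\<bar>" for n
        using angle_one_sided(2)[of "?y n" x] 2 by (auto simp: abs_if)
      then show "\<forall>\<^sub>F n in sequentially. \<bar>?\<theta> n\<bar> - ?\<theta> n \<le> 2 * \<bar>?y n / x\<^sup>2 * jump_norm\<bar>" by simp
      show "\<forall>\<^sub>F n in sequentially. 0 \<le> \<bar>?\<theta> n\<bar> - ?\<theta> n" by (intro always_eventually) auto
    qed
    from tendsto_diff[OF abs this] have "?\<theta> \<longlonglongrightarrow> arccos (sgn r)" by simp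
    moreover have "sgn r = - s" using 2 s by (simp add: r_def sgn_mult)
    moreover have "s = 1 \<or> s = -1" using s by (auto simp: sgn_real_def split: if_splits)
    ultimately show ?thesis using 2 by auto
  qed
qed

lemma angle_measurable [measurable]: "angle y \<in> borel_measurable borel"
  unfolding angle_def by measurable

text \<open>By Fubini's theorem the integration over x acts on the Poisson kernel alone and gives
  arctangents. Integrability on the product follows from the bound 1 / y for the kernel and the
  integrability of \<open>jump\<close>.\<close>

lemma angle_integral:
  assumes y: "y > 0" and pq: "p \<le> q"
  shows "(LINT x|lborel. indicator {p..q} x * angle y x)
    = (LINT t|lborel. jump t * (arctan ((q - t) / y) - arctan ((p - t) / y)))"
proof -
  define f where "f = (\<lambda>x t. indicator {p..q} x * (poisson y x t * jump t))"
  have f_meas[measurable]: "(\<lambda>(x, t). f x t) \<in> borel_measurable (lborel \<Otimes>\<^sub>M lborel)"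
    unfolding f_def by measurable
  have f_int: "integrable lborel (f x)" for x
    unfolding f_def by (intro integrable_mult_right poisson_jump_integrable y)
  have "integrable (lborel \<Otimes>\<^sub>M lborel) (\<lambda>(x, t). f x t)"
  proof (rule lborel_pair.Fubini_integrable)
    show "AE x in lborel. integrable lborel (\<lambda>t. case (x, t) of (x, t) \<Rightarrow> f x t)"
      using f_int by simp
    have "integrable lborel (\<lambda>x. indicator {p..q} x :: real)"
      by (intro integrable_real_indicator) (auto simp: emeasure_lborel_Icc_eq)
    then have i: "integrable lborel (\<lambda>x. indicator {p..q} x * (1 / y * jump_norm))" by (rule integrable_mult_left)
    show "integrable lborel (\<lambda>x. LINT t|lborel. norm (case (x, t) of (x, t) \<Rightarrow> f x t))"
    proof (rule Bochner_Integration.integrable_bound[OF i], measurable, rule AE_I2)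
      fix x :: real
      have "(LINT t|lborel. norm (f x t)) \<le> (LINT t|lborel. indicator {p..q} x * (1 / y * \<bar>jump t\<bar>))"
      proof (rule integral_mono_AE)
        show "integrable lborel (\<lambda>t. norm (f x t))" using f_int by (rule integrable_norm)
        show "integrable lborel (\<lambda>t. indicator {p..q} x * (1 / y * \<bar>jump t\<bar>))"
          using jump_integrable by (intro integrable_mult_right integrable_abs)
        show "AE t in lborel. norm (f x t) \<le> indicator {p..q} x * (1 / y * \<bar>jump t\<bar>)"
        proof (rule AE_I2)
          fix t :: real
          have "\<bar>poisson y x t\<bar> * \<bar>jump t\<bar> \<le> 1 / y * \<bar>jump t\<bar>"
            using poisson_le[OF y] poisson_nonneg[OF y] by (intro mult_right_mono) auto
          then show "norm (f x t) \<le> indicator {p..q} x * (1 / y * \<bar>jump t\<bar>)"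
            by (auto simp: f_def abs_mult indicator_def)
        qed
      qed
      also have "\<dots> = indicator {p..q} x * (1 / y * jump_norm)" by (simp add: jump_norm_def)
      also have "\<dots> \<le> norm (indicator {p..q} x * (1 / y * jump_norm))"
        unfolding real_norm_def by (rule abs_ge_self)
      finally have "(LINT t|lborel. norm (f x t)) \<le> norm (indicator {p..q} x * (1 / y * jump_norm))" .
      moreover have "0 \<le> (LINT t|lborel. norm (f x t))" by (intro integral_nonneg_AE) auto
      ultimately show "norm (LINT t|lborel. norm (case (x, t) of (x, t) \<Rightarrow> f x t))
          \<le> norm (indicator {p..q} x * (1 / y * jump_norm))"
        by (simp only: prod.case real_norm_def[of "integral\<^sup>L _ _"] abs_of_nonneg)
    qed
  qed measurable
  from lborel_pair.Fubini_integral[OF this]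
  have "(LINT t|lborel. LINT x|lborel. f x t) = (LINT x|lborel. LINT t|lborel. f x t)" .
  moreover have "(LINT t|lborel. f x t) = indicator {p..q} x * angle y x" for x
    unfolding f_def angle_def by simp
  moreover have "(LINT x|lborel. f x t) = jump t * (arctan ((q - t) / y) - arctan ((p - t) / y))" for t
  proof -
    have "(LINT x|lborel. f x t) = (LINT x|lborel. jump t * (poisson y x t * indicator {p..q} x))"
      by (simp add: f_def mult_ac)
    also have "\<dots> = jump t * (LINT x|lborel. poisson y x t * indicator {p..q} x)" by simp
    finally show ?thesis using poisson_integral[OF y pq, of t] by (simp add: has_bochner_integral_iff)
  qed
  ultimately show ?thesis by simp
qed

text \<open>The limit of the integral of the angle over [p, q] is computed twice: from the pointwise
  limit of the angle, and from the arctangents, whose difference tends to \<pi> times the indicator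
  of the interval. Equating the two gives the integral of \<open>jump\<close>, hence the increment
  of \<omega>. The interval lies on one side of 0 because the boundary angle involves the sign of
  x.\<close>

lemma slope_interval_one_sided:
  assumes pq: "p < q" "0 \<le> p \<or> q \<le> 0"
    and x: "\<And>x. p < x \<Longrightarrow> x < q \<Longrightarrow> x \<notin> range a \<and> sgn (stieltjes x) = s" and s: "s \<noteq> 0"
  shows "\<omega> q - \<omega> p = s * (q - p)"
proof -
  let ?y = "\<lambda>n. 1 / real (Suc n)"
  define \<sigma> :: real where "\<sigma> = (if 0 \<le> p then 1 else - 1)"
  define A where "A n = (LINT x|lborel. indicator {p..q} x * angle (?y n) x)" for n
  have ind: "integrable lborel (\<lambda>x. indicator {p..q} x :: real)"
    by (intro integrable_real_indicator) (auto simp: emeasure_lborel_Icc_eq)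
  have ae: "AE x in lborel. x \<noteq> p \<and> x \<noteq> q"
    using AE_lborel_singleton[of p] AE_lborel_singleton[of q] by eventually_elim simp
  have "A \<longlonglongrightarrow> (LINT x|lborel. indicator {p..q} x * (pi * (s - \<sigma>) / 2))"
    unfolding A_def
  proof (rule integral_dominated_convergence[where w = "\<lambda>x. indicator {p..q} x * pi"])
    show "integrable lborel (\<lambda>x. indicator {p..q} x * pi)" using ind by (rule integrable_mult_left)
    show "AE x in lborel. (\<lambda>n. indicator {p..q} x * angle (?y n) x)
        \<longlonglongrightarrow> indicator {p..q} x * (pi * (s - \<sigma>) / 2)"
      using ae
    proof eventually_elim
      case (elim u)
      show ?case
      proof (cases "u \<in> {p..q}")
        case True
        then have u: "p < u" "u < q" using elim by auto
        then have "u \<noteq> 0" "sgn u = \<sigma>" using pq by (auto simp: \<sigma>_def)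
        then have "(\<lambda>n. angle (?y n) u) \<longlonglongrightarrow> pi * (s - \<sigma>) / 2"
          using angle_limit[of u s] x[OF u] s by simp
        then show ?thesis using True by simp
      qed simp
    qed
    show "AE x in lborel. norm (indicator {p..q} x * angle (?y n) x) \<le> indicator {p..q} x * pi" for n
      using abs_angle_le[of "?y n"] by (auto simp: indicator_def abs_mult)
  qed measurable
  also have "(LINT x|lborel. indicator {p..q} x * (pi * (s - \<sigma>) / 2)) = pi * ((s - \<sigma>) / 2 * (q - p))"
    using pq by simp
  finally have lim1: "A \<longlonglongrightarrow> pi * ((s - \<sigma>) / 2 * (q - p))" .
  have "(\<lambda>n. LINT t|lborel. jump t * (arctan ((q - t) / ?y n) - arctan ((p - t) / ?y n)))
      \<longlonglongrightarrow> (LINT t|lborel. pi * (indicator {p..q} t * jump t))"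
  proof (rule integral_dominated_convergence[where w = "\<lambda>t. \<bar>jump t\<bar> * pi"])
    show "integrable lborel (\<lambda>t. \<bar>jump t\<bar> * pi)"
      using jump_integrable by (intro integrable_mult_left integrable_abs)
    show "AE t in lborel. (\<lambda>n. jump t * (arctan ((q - t) / ?y n) - arctan ((p - t) / ?y n)))
        \<longlonglongrightarrow> pi * (indicator {p..q} t * jump t)"
      using ae
    proof eventually_elim
      case (elim t)
      have "(\<lambda>n. jump t * (arctan ((q - t) * real (Suc n)) - arctan ((p - t) * real (Suc n))))
        \<longlonglongrightarrow> jump t * ((if q - t > 0 then pi / 2 else if q - t < 0 then - (pi / 2) else 0) -
          (if p - t > 0 then pi / 2 else if p - t < 0 then - (pi / 2) else 0))"
        by (intro tendsto_intros tendsto_arctan_scaled)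
      also have "jump t * ((if q - t > 0 then pi / 2 else if q - t < 0 then - (pi / 2) else 0) -
          (if p - t > 0 then pi / 2 else if p - t < 0 then - (pi / 2) else 0))
        = pi * (indicator {p..q} t * jump t)"
        using elim pq by (auto simp: indicator_def)
      finally show ?case by simp
    qed
    show "AE t in lborel. norm (jump t * (arctan ((q - t) / ?y n) - arctan ((p - t) / ?y n))) \<le> \<bar>jump t\<bar> * pi" for n
    proof (rule AE_I2)
      fix t :: real
      have "(p - t) / ?y n \<le> (q - t) / ?y n" using pq by (intro divide_right_mono) auto
      then have "\<bar>arctan ((q - t) / ?y n) - arctan ((p - t) / ?y n)\<bar> \<le> pi"
        using arctan_diff_bounds[of "(p - t) / ?y n" "(q - t) / ?y n"] by linarith
      then show "norm (jump t * (arctan ((q - t) / ?y n) - arctan ((p - t) / ?y n))) \<le> \<bar>jump t\<bar> * pi"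
        unfolding real_norm_def abs_mult by (intro mult_left_mono) auto
    qed
  qed measurable
  moreover have "A = (\<lambda>n. LINT t|lborel. jump t * (arctan ((q - t) / ?y n) - arctan ((p - t) / ?y n)))"
    unfolding A_def using pq by (intro ext angle_integral) auto
  ultimately have "A \<longlonglongrightarrow> (LINT t|lborel. pi * (indicator {p..q} t * jump t))" by (simp only:)
  then have lim2: "A \<longlonglongrightarrow> pi * (LINT t|lborel. indicator {p..q} t * jump t)" by simp
  have "(LINT t|lborel. indicator {p..q} t * jump t) = (s - \<sigma>) / 2 * (q - p)"
    using LIMSEQ_unique[OF lim1 lim2] by simp
  then have "rise q - rise p - (if 0 \<le> p then q - p else 0) = (s - \<sigma>) / 2 * (q - p)"
    using jump_integral[of p q] pq by simp
  then show ?thesis by (simp add: rise_def \<sigma>_def field_simps split: if_splits)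
qed

lemma slope_interval:
  assumes pq: "p \<le> q"
    and x: "\<And>x. p < x \<Longrightarrow> x < q \<Longrightarrow> x \<notin> range a \<and> sgn (stieltjes x) = s" and s: "s \<noteq> 0"
  shows "\<omega> q - \<omega> p = s * (q - p)"
proof -
  consider "p = q" | "p < q" "0 \<le> p \<or> q \<le> 0" | "p < 0" "0 < q" using pq by linarith
  then show ?thesis
  proof cases
    case 2
    then show ?thesis using x s by (intro slope_interval_one_sided) auto
  next
    case 3
    have "\<omega> 0 - \<omega> p = s * (0 - p)" using 3 x s by (intro slope_interval_one_sided) auto
    moreover have "\<omega> q - \<omega> 0 = s * (q - 0)" using 3 x s by (intro slope_interval_one_sided) auto
    ultimately show ?thesis by (simp add: algebra_simps)
  qed simp
qed

text \<open>To the left of all atoms the slope is -1, so \<open>excess \<omega>\<close> is a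
  constant c there, up to \<open>min (a 0) 0\<close>. Its total integral is 1, so c n \<le> 1 for
  every n and c vanishes.\<close>

lemma left_of_support:
  assumes "x \<le> a 0"
  shows "\<omega> x = - x"
proof -
  have lin: "\<omega> y = \<omega> (a 0) + a 0 - y" if y: "y \<le> a 0" for y
  proof -
    have "\<omega> (a 0) - \<omega> y = (-1) * (a 0 - y)"
    proof (rule slope_interval[OF y])
      fix u assume "y < u" "u < a 0"
      moreover have "a 0 \<le> t" if "t \<in> range a" for t
        using that strict_mono_less_eq[OF a_mono] by auto
      ultimately show "u \<notin> range a \<and> sgn (stieltjes u) = - 1"
        using stieltjes_left[of u] by force
    qed simp
    then show ?thesis by simp
  qed
  define c where "c = (\<omega> (a 0) + a 0) / 2"
  have c0: "c \<ge> 0" using ge_abs[of "a 0"] by (simp add: c_def)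
  define m where "m = min (a 0) 0"
  have ex: "excess \<omega> y = c" if "y \<le> m" for y
    using lin[of y] that by (simp add: excess_def c_def m_def)
  have ex0: "excess \<omega> y \<ge> 0" for y using ge_abs[of y] by (simp add: excess_def)
  have fin: "(\<integral>\<^sup>+y. ennreal (excess \<omega> y) \<partial>lebesgue) = ennreal 1"
    using limit_shape nn_integral_eq_integral[of lebesgue "excess \<omega>"] ex0
    by (simp add: is_limit_shape_def has_bochner_integral_iff)
  have "c * real n \<le> 1" for n
  proof -
    have "ennreal c * emeasure lebesgue {m - real n..m} = (\<integral>\<^sup>+y. ennreal c * indicator {m - real n..m} y \<partial>lebesgue)"
      by (rule nn_integral_cmult_indicator[symmetric]) (auto intro: sets_completionI_sets)
    also have "\<dots> \<le> (\<integral>\<^sup>+y. ennreal (excess \<omega> y) \<partial>lebesgue)"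
      by (intro nn_integral_mono) (auto simp: indicator_def ex)
    also have "emeasure lebesgue {m - real n..m} = ennreal (real n)"
      by (simp add: emeasure_completion)
    finally have "ennreal (c * real n) \<le> ennreal 1" using c0 by (simp add: fin ennreal_mult)
    then show ?thesis by (simp add: ennreal_le_iff del: ennreal_1)
  qed
  then have "c \<le> 0"
    by (metis mult.commute not_le reals_Archimedean3)
  then have "c = 0" using c0 by simp
  then show ?thesis using lin[OF assms] by (simp add: c_def)
qed

theorem staircase: "staircase_to_pinfinity \<omega>"
proof -
  obtain b where b: "\<And>n. a n < b n \<and> b n < a (Suc n) \<and> (\<forall>x\<in>{a n<..<b n}. stieltjes x > 0) \<and>
      (\<forall>x\<in>{b n<..<a (Suc n)}. stieltjes x < 0)"
    using stieltjes_sign_change by metis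
  have gap: "x \<notin> range a" if "a n < x" "x < a (Suc n)" for x n
    using atom_cases[of x n] that by auto
  show ?thesis
    unfolding staircase_to_pinfinity_def
  proof (intro exI conjI allI ballI impI)
    fix n
    show "a n < b n" "b n < a (Suc n)" using b by auto
    fix x
    show "\<omega> x = \<omega> (a n) + (x - a n)" if x: "x \<in> {a n..b n}"
    proof -
      have "\<omega> x - \<omega> (a n) = 1 * (x - a n)"
      proof (rule slope_interval)
        fix u assume u: "a n < u" "u < x"
        then have "u < b n" "u < a (Suc n)" using x b[of n] by auto
        then show "u \<notin> range a \<and> sgn (stieltjes u) = 1"
          using gap[of n u] b[of n] u by simp
      qed (use x in auto)
      then show ?thesis by simp
    qed
    show "\<omega> x = \<omega> (b n) - (x - b n)" if x: "x \<in> {b n..a (Suc n)}"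
    proof -
      have "\<omega> x - \<omega> (b n) = (-1) * (x - b n)"
      proof (rule slope_interval)
        fix u assume u: "b n < u" "u < x"
        then have "a n < u" "u < a (Suc n)" using x b[of n] by auto
        then show "u \<notin> range a \<and> sgn (stieltjes u) = - 1"
          using gap[of n u] b[of n] u by simp
      qed (use x in auto)
      then show ?thesis by simp
    qed
  qed (use a_at_top left_of_support in auto)
qed

end

section \<open>Reflection and conclusion\<close>

text \<open>The exponent is even for a step down, odd for a level step, and has the parity of i - 1
  for a step up by i.\<close>

lemma step_weight_reflect:
  "step_weight (- g) (\<lambda>j. (-1) ^ (j - 1) * v j) m n = (-1) ^ (m + n + 1) * step_weight g v m n"
proof -
  have "\<exists>k. n = m + Suc k" if "m < n" using less_imp_Suc_add[OF that] by simp
  then consider "n + 1 = m" | "n = m" | "n + 1 < m" | k where "n = m + Suc k" by fastforce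
  then show ?thesis
  proof cases
    case 4
    have "(-1 :: real) ^ (m + (m + Suc k) + 1) = (-1) ^ (2 * (m + 1) + k)"
      by (rule arg_cong[of _ _ "power (-1)"]) simp
    also have "\<dots> = (-1) ^ k" by (simp add: power_add)
    finally show ?thesis unfolding 4 by (simp add: step_weight_def)
  qed (auto simp: step_weight_def)
qed

text \<open>Along a path of l steps from n to 0 every inner height is counted twice, so the signs
  multiply to the parity of l + n.\<close>

lemma descent_sum_reflect:
  "descent_sum (- g) (\<lambda>j. (-1) ^ (j - 1) * v j) l n = (-1) ^ (l + n) * descent_sum g v l n"
proof (induction l arbitrary: n)
  case (Suc l)
  have "(-1) ^ (n + m + 1) * (-1) ^ (l + m) = ((-1) ^ (Suc l + n) :: real)" for m
  proof -
    have "(-1) ^ (n + m + 1) * (-1) ^ (l + m) = ((-1) ^ (Suc l + n + 2 * m) :: real)"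
      unfolding power_add[symmetric] by (rule arg_cong[of _ _ "power (-1)"]) simp
    then show ?thesis by (simp add: power_add)
  qed
  then have "(-1) ^ (n + m + 1) * step_weight g v n m * ((-1) ^ (l + m) * descent_sum g v l m)
      = (-1) ^ (Suc l + n) * (step_weight g v n m * descent_sum g v l m)" for m
    by (metis (no_types, lifting) mult.assoc mult.left_commute)
  then show ?case
    by (simp only: descent_sum.simps Suc.IH step_weight_reflect sum_distrib_left)
qed simp

lemma path_measure_reflect:
  assumes "is_path_measure g v M"
  shows "is_path_measure (- g) (\<lambda>j. (-1) ^ (j - 1) * v j) (distr M borel uminus)"
  unfolding is_path_measure_def
proof (intro conjI allI impI)
  interpret real_distribution M using assms by (simp add: is_path_measure_def)
  show "real_distribution (distr M borel uminus)" by (rule real_distribution_distr) simp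
  fix l :: nat assume "l \<ge> 1"
  then have "has_bochner_integral M (\<lambda>x. x ^ l) (path_moment g v l)"
    using assms by (simp add: is_path_measure_def)
  then have "has_bochner_integral M (\<lambda>x. (-1) ^ l * x ^ l) ((-1) ^ l * path_moment g v l)"
    by (rule has_bochner_integral_mult_right) 
  then have "has_bochner_integral M (\<lambda>x. (- x) ^ l) (path_moment (- g) (\<lambda>j. (-1) ^ (j - 1) * v j) l)"
  proof -
    have "path_moment (- g) (\<lambda>j. (-1) ^ (j - 1) * v j) l = (-1) ^ l * path_moment g v l"
      by (simp only: path_moment_eq_descent_sum descent_sum_reflect add_0_right)
    moreover have "(\<lambda>x :: real. (- x) ^ l) = (\<lambda>x. (-1) ^ l * x ^ l)" by (rule ext) (rule power_minus)
    ultimately show ?thesis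
      using \<open>has_bochner_integral M (\<lambda>x. (-1) ^ l * x ^ l) _\<close> by metis
  qed
  then show "has_bochner_integral (distr M borel uminus) (\<lambda>x. x ^ l)
      (path_moment (- g) (\<lambda>j. (-1) ^ (j - 1) * v j) l)"
    by (intro has_bochner_integral_distr) auto
qed

lemma measure_support_reflect:
  assumes "real_distribution M"
  shows "measure_support (distr M borel uminus) = uminus ` measure_support M"
proof -
  interpret real_distribution M by fact
  have em: "emeasure (distr M borel uminus) U = emeasure M (uminus ` U)" if "open U" for U
  proof -
    have "uminus -` U \<inter> space M = uminus ` U"
      by (auto simp: image_iff) (metis minus_minus)
    then show ?thesis using that by (subst emeasure_distr) auto
  qed
  have "x \<in> measure_support (distr M borel uminus) \<longleftrightarrow> - x \<in> measure_support M" for x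
  proof
    assume x: "x \<in> measure_support (distr M borel uminus)"
    show "- x \<in> measure_support M"
      unfolding measure_support_def
    proof (intro CollectI allI impI)
      fix U assume U: "open U \<and> - x \<in> U"
      then have "open (uminus ` U)" "x \<in> uminus ` U" by (auto intro: open_negations) force
      then show "emeasure M U > 0"
        using x em[of "uminus ` U"] by (auto simp: measure_support_def image_image)
    qed
  next
    assume x: "- x \<in> measure_support M"
    show "x \<in> measure_support (distr M borel uminus)"
      unfolding measure_support_def
    proof (intro CollectI allI impI)
      fix U assume U: "open U \<and> x \<in> U"
      then have "open (uminus ` U)" "- x \<in> uminus ` U" by (auto intro: open_negations)
      then show "emeasure (distr M borel uminus) U > 0"
        using x U em[of U] by (auto simp: measure_support_def)
    qed
  qed
  moreover have "x \<in> uminus ` measure_support M \<longleftrightarrow> - x \<in> measure_support M" for x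
    by (auto intro!: image_eqI[of x uminus "- x"])
  ultimately show ?thesis by blast
qed

lemma islimpt_uminus_ereal:
  fixes a :: ereal
  assumes "a islimpt A"
  shows "- a islimpt uminus ` A"
proof (rule islimptI)
  fix T :: "ereal set" assume T: "- a \<in> T" "open T"
  then have "open (uminus ` T)" "a \<in> uminus ` T"
    by (auto intro: ereal_open_uminus) (metis ereal_uminus_uminus image_eqI)
  then obtain y where y: "y \<in> A" "y \<in> uminus ` T" "y \<noteq> a"
    using assms by (auto simp: islimpt_def)
  then show "\<exists>y\<in>uminus ` A. y \<in> T \<and> y \<noteq> - a"
    by (intro bexI[of _ "- y"]) (auto simp: ereal_uminus_eq_iff)
qed

section \<open>Reflection of limit shapes\<close>

lemma lebesgue_distr_uminus: "distr lebesgue lebesgue uminus = (lebesgue :: real measure)"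
proof -
  have "(\<lambda>x :: real. -1 * x) = uminus" by auto
  then show ?thesis
    using lebesgue_real_scale[of "-1 :: real"] by (simp add: density_1)
qed

lemma uminus_measurable_lebesgue: "uminus \<in> lebesgue \<rightarrow>\<^sub>M (lebesgue :: real measure)"
proof -
  have "(*\<^sub>R) (-1) = (uminus :: real \<Rightarrow> real)" by auto
  then show ?thesis using lebesgue_measurable_scaling[of "-1", where 'a = real] by simp
qed

lemma AE_lebesgue_uminus:
  assumes "AE x in lebesgue. P (x :: real)"
  shows "AE x in lebesgue. P (- x)"
proof -
  have "AE x in distr lebesgue lebesgue uminus. P (x :: real)"
    unfolding lebesgue_distr_uminus by (rule assms)
  then show ?thesis by (rule AE_distrD[OF uminus_measurable_lebesgue])
qed

lemma profile_of_limit_shape: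
  assumes "is_limit_shape M \<omega>"
  shows "profile \<omega>"
proof
  show "\<bar>\<omega> x - \<omega> y\<bar> \<le> \<bar>x - y\<bar>" for x y
    using assms lipschitz_onD[of 1 UNIV \<omega> x y] by (auto simp: is_limit_shape_def dist_real_def)
  show "\<omega> x \<ge> \<bar>x\<bar>" for x
    using assms by (simp add: is_limit_shape_def)
qed

text \<open>The point z' = - cnj z is the mirror image of z in the imaginary axis and stays in the
  upper half plane, with 1 / (z + x) = - cnj (1 / (z' - x)). In the exponent the derivative of the
  reflected excess changes sign, and so does the kernel under x to -x, so the formula keeps its
  form.\<close>

lemma limit_shape_reflect:
  assumes M: "real_distribution M" and \<omega>: "is_limit_shape M \<omega>"
  shows "is_limit_shape (distr M borel uminus) (\<lambda>x. \<omega> (- x))"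
proof -
  interpret real_distribution M by fact
  interpret profile \<omega> using \<omega> by (rule profile_of_limit_shape)
  let ?\<omega>' = "\<lambda>x. \<omega> (- x)"
  have ex: "excess ?\<omega>' = (\<lambda>x. excess \<omega> (- x))" by (simp add: excess_def fun_eq_iff)
  have "AE x in lebesgue. deriv (excess ?\<omega>') x = - deriv (excess \<omega>) (- x)"
    using AE_lebesgue_uminus[OF excess_derivative]
  proof eventually_elim
    case (elim x)
    have "((\<lambda>x. excess \<omega> (- x)) has_real_derivative jump (- x) * (- 1)) (at x)"
      by (rule DERIV_chain2[where g = uminus, OF elim]) (auto intro!: derivative_eq_intros)
    then show ?case using DERIV_imp_deriv[OF elim] by (simp add: ex DERIV_imp_deriv)
  qed
  note deriv' = this
  have jump_leb: "jump \<in> borel_measurable lebesgue"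
    by (rule measurable_completion) simp
  have D_meas: "deriv (excess \<omega>) \<in> borel_measurable lebesgue"
    using deriv_excess by (intro borel_measurable_lebesgue_cong_AE[OF jump_leb]) (auto elim: eventually_mono)
  have D_meas': "(\<lambda>x. - deriv (excess \<omega>) (- x)) \<in> borel_measurable lebesgue"
    using measurable_compose[OF uminus_measurable_lebesgue D_meas] by simp
  have res_meas: "(\<lambda>x. 1 / (of_real x - z) :: complex) \<in> borel_measurable lebesgue" for z
    by (rule measurable_completion) measurable
  have cplx: "(\<lambda>x. complex_of_real (f x)) \<in> borel_measurable lebesgue"
    if "f \<in> borel_measurable lebesgue" for f :: "real \<Rightarrow> real"
    using that by measurable
  have E_meas: "deriv (excess ?\<omega>') \<in> borel_measurable lebesgue"
    using deriv' by (intro borel_measurable_lebesgue_cong_AE[OF D_meas']) (auto elim: eventually_mono)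
  show ?thesis
    unfolding is_limit_shape_def
  proof (intro conjI allI)
    show "1-lipschitz_on UNIV ?\<omega>'"
    proof (rule lipschitz_onI)
      show "dist (\<omega> (- x)) (\<omega> (- y)) \<le> 1 * dist x y" for x y
        using lipschitz[of "- x" "- y"] by (simp add: dist_real_def abs_minus_commute)
    qed simp
    show "\<bar>x\<bar> \<le> \<omega> (- x)" for x using ge_abs[of "- x"] by simp
    have e: "has_bochner_integral lebesgue (excess \<omega>) 1" using \<omega> by (simp add: is_limit_shape_def)
    show "has_bochner_integral lebesgue (excess ?\<omega>') 1"
      unfolding ex has_bochner_integral_iff
    proof
      have m: "excess \<omega> \<in> borel_measurable lebesgue" using e by (auto simp: has_bochner_integral_iff)
      show "integrable lebesgue (\<lambda>x. excess \<omega> (- x))"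
        using e integrable_distr_eq[OF uminus_measurable_lebesgue m]
        by (simp add: lebesgue_distr_uminus has_bochner_integral_iff)
      show "(LINT x|lebesgue. excess \<omega> (- x)) = 1"
        using e integral_distr[OF uminus_measurable_lebesgue m]
        by (simp add: lebesgue_distr_uminus has_bochner_integral_iff)
    qed
    show "markov_krein (distr M borel uminus) ?\<omega>'"
      unfolding markov_krein_def
    proof (intro allI impI)
      fix z :: complex assume z: "Im z > 0"
      define z' where "z' = - cnj z"
      have z': "Im z' > 0" "cnj z' = - z" using z by (auto simp: z'_def)
      define I where "I = (LINT x|lebesgue. 1 / (of_real x - z') * of_real (deriv (excess \<omega>) x) :: complex)"
      have MK: "(LINT x|M. 1 / (z' - of_real x)) = 1 / z' * exp I"
        using \<omega> z'(1) by (simp add: is_limit_shape_def markov_krein_def I_def)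
      have "(LINT x|distr M borel uminus. 1 / (z - of_real x)) = (LINT x|M. 1 / (z + of_real x))"
        by (subst integral_distr) auto
      also have "\<dots> = (LINT x|M. - cnj (1 / (z' - of_real x)))"
      proof (intro Bochner_Integration.integral_cong refl)
        fix x :: real
        have "- z - of_real x = - (z + complex_of_real x)" by simp
        then have "1 / (- z - complex_of_real x) = - (1 / (z + complex_of_real x))"
          by (metis minus_divide_right)
        then show "1 / (z + of_real x) = - cnj (1 / (z' - of_real x))" by (simp add: z')
      qed
      also have "\<dots> = - cnj (LINT x|M. 1 / (z' - of_real x))" by (simp only: integral_minus Bochner_Integration.integral_cnj)
      also have "\<dots> = 1 / z * exp (cnj I)"
        unfolding MK by (simp add: z' exp_cnj)
      also have "cnj I = (LINT x|lebesgue. cnj (1 / (of_real x - z') * of_real (deriv (excess \<omega>) x)))"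
        unfolding I_def by (rule Bochner_Integration.integral_cnj[symmetric])
      also have "\<dots> = (LINT x|lebesgue. 1 / (of_real x - (- z)) * of_real (deriv (excess \<omega>) x))"
        by (simp add: z')
      also have "\<dots> = (LINT x|distr lebesgue lebesgue uminus. 1 / (of_real x - (- z)) * of_real (deriv (excess \<omega>) x))"
        by (simp only: lebesgue_distr_uminus)
      also have "\<dots> = (LINT x|lebesgue. 1 / (of_real (- x) - (- z)) * of_real (deriv (excess \<omega>) (- x)))"
        by (rule integral_distr[OF uminus_measurable_lebesgue])
          (rule borel_measurable_times[OF res_meas cplx[OF D_meas]])
      also have "\<dots> = (LINT x|lebesgue. 1 / (of_real x - z) * of_real (- deriv (excess \<omega>) (- x)))"
      proof (intro Bochner_Integration.integral_cong refl)
        fix x :: real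
        have "complex_of_real (- x) - (- z) = - (of_real x - z)" by simp
        then have "1 / (complex_of_real (- x) - (- z)) = - (1 / (of_real x - z))"
          by (metis minus_divide_right)
        then show "1 / (of_real (- x) - (- z)) * of_real (deriv (excess \<omega>) (- x))
            = 1 / (of_real x - z) * of_real (- deriv (excess \<omega>) (- x))" by simp
      qed
      also have "\<dots> = (LINT x|lebesgue. 1 / (of_real x - z) * of_real (deriv (excess ?\<omega>') x))"
      proof (rule integral_cong_AE)
        show "AE x in lebesgue. 1 / (of_real x - z) * of_real (- deriv (excess \<omega>) (- x))
            = 1 / (of_real x - z) * of_real (deriv (excess ?\<omega>') x)"
          using deriv' by eventually_elim simp
        show "(\<lambda>x. 1 / (of_real x - z) * of_real (- deriv (excess \<omega>) (- x))) \<in> borel_measurable lebesgue"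
          by (rule borel_measurable_times[OF res_meas cplx[OF D_meas']])
        show "(\<lambda>x. 1 / (of_real x - z) * of_real (deriv (excess ?\<omega>') x)) \<in> borel_measurable lebesgue"
          by (rule borel_measurable_times[OF res_meas cplx[OF E_meas]])
      qed
      finally show "(LINT x|distr M borel uminus. 1 / (z - of_real x)) =
          1 / z * exp (LINT x|lebesgue. 1 / (of_real x - z) * of_real (deriv (excess ?\<omega>') x))" .
    qed
  qed
qed

lemma (in path_measure) support_and_shape:
  "countable (measure_support M)" "infinite (measure_support M)"
  "{a. a islimpt ereal ` measure_support M} = {\<infinity>}"
  "is_limit_shape M \<omega> \<Longrightarrow> staircase_to_pinfinity \<omega>"
proof -
  let ?S = "measure_support M"
  note S = support_properties
  obtain a where a: "strict_mono a" "range a = ?S" "filterlim a at_top sequentially"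
    using increasing_enumeration[OF S(4) S(2)] by blast
  show "countable ?S" unfolding a(2)[symmetric] by simp
  show "infinite ?S" by (rule S(4))
  show "{a. a islimpt ereal ` ?S} = {\<infinity>}" by (rule islimpt_ereal_image[OF S(4) S(1) S(2)])
  assume \<omega>: "is_limit_shape M \<omega>"
  interpret profile \<omega> using \<omega> by (rule profile_of_limit_shape)
  interpret limit_shape M a \<omega>
  proof
    show "AE x in M. x \<in> range a" unfolding a(2) by (rule S(3))
    show "measure M {a n} > 0" for n
      using a(2) by (intro measure_support_point_pos S real_distribution_axioms) auto
  qed (use a \<omega> in auto)
  show "staircase_to_pinfinity \<omega>" by (rule staircase)
qed

lemma path_measure_of_jack_positive:
  assumes "g > 0" "totally_jack_positive v" "v 1 = 1" "is_path_measure g v M"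
  shows "path_measure g v M"
  using assms totally_jack_positive_nonneg totally_jack_positive_le_1 by unfold_locales auto

theorem theorem6p7:
  fixes g :: real and v :: "nat \<Rightarrow> real" and M :: "real measure"
  assumes "admissible g v"
    and "v 1 = 1"
    and "is_path_measure g v M"
  shows "countable (measure_support M) \<and> infinite (measure_support M)
    \<and> (g > 0 \<longrightarrow> {a. a islimpt ereal ` measure_support M} = {\<infinity>})
    \<and> (g < 0 \<longrightarrow> {a. a islimpt ereal ` measure_support M} = {-\<infinity>})
    \<and> (\<forall>\<omega>. is_limit_shape M \<omega> \<longrightarrow>
          (g > 0 \<longrightarrow> staircase_to_pinfinity \<omega>) \<and> (g < 0 \<longrightarrow> staircase_to_minfinity \<omega>))"
proof (cases "g > 0")
  case True
  then interpret path_measure g v M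
    using assms by (intro path_measure_of_jack_positive) (auto simp: admissible_def)
  show ?thesis using True support_and_shape by auto
next
  case False
  then have g: "g < 0" and tjp: "totally_jack_positive (\<lambda>j. (-1) ^ (j - 1) * v j)"
    using assms(1) by (auto simp: admissible_def)
  have M: "real_distribution M" using assms(3) by (simp add: is_path_measure_def)
  \<comment> \<open>For g < 0 admissibility is positivity of the sequence with alternating signs,
    which is the weight sequence of the reflected measure; its first entry is still
    \<open>v 1\<close>.\<close>
  interpret R: path_measure "- g" "\<lambda>j. (-1) ^ (j - 1) * v j" "distr M borel uminus"
    using g tjp assms by (intro path_measure_of_jack_positive path_measure_reflect) auto
  let ?S = "measure_support M"
  note refl = measure_support_reflect[OF M]
  have S: "?S = uminus ` measure_support (distr M borel uminus)"
    unfolding refl by (simp add: image_image)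
  have "countable ?S" unfolding S using R.support_and_shape(1) by simp
  moreover have "infinite ?S" using R.support_and_shape(2) unfolding refl by auto
  moreover have "{a. a islimpt ereal ` ?S} = {-\<infinity>}"
  proof -
    have img: "ereal ` ?S = uminus ` ereal ` measure_support (distr M borel uminus)"
      unfolding refl by (simp add: image_image)
    have lim: "b islimpt ereal ` measure_support (distr M borel uminus) \<longleftrightarrow> b = \<infinity>" for b
      using R.support_and_shape(3) by auto
    have img': "uminus ` ereal ` ?S = ereal ` measure_support (distr M borel uminus)"
      unfolding img by (simp add: image_image)
    have "a islimpt ereal ` ?S \<longleftrightarrow> - a = \<infinity>" for a
    proof
      assume "a islimpt ereal ` ?S"
      then show "- a = \<infinity>" using islimpt_uminus_ereal[of a "ereal ` ?S"] by (simp add: img' lim)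
    next
      assume "- a = \<infinity>"
      then have "- (- a) islimpt uminus ` ereal ` measure_support (distr M borel uminus)"
        by (intro islimpt_uminus_ereal) (simp add: lim)
      then show "a islimpt ereal ` ?S" by (simp add: img)
    qed
    then show ?thesis by (auto simp: ereal_uminus_eq_reorder)
  qed
  moreover have "staircase_to_minfinity \<omega>" if "is_limit_shape M \<omega>" for \<omega>
    unfolding staircase_to_minfinity_def
    by (rule R.support_and_shape(4)[OF limit_shape_reflect[OF M that]])
  ultimately show ?thesis using False g by auto
qed

end
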